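(* Let $K$ be a field, let $B=\bigoplus_{n\geqslant 0}B_n$ be an approximable graded $K$-algebra and let $f:\mathbb{N}\to\mathbb{R}_+$ be a mapping. Assume that each $B_n$ is equipped with an $\mathbb{R}$-filtration $\mathcal{F}$ such that $B$ is $f$-quasi-filtered. Assume in addition that $$\sup_{n\geqslant 1}\lambda_{\max}(B_n)/n<+\infty\quad\text{and}\quad\lim_{n\to\infty}f(n)/n=0.$$ Then the sequence $(\lambda_{\max}(B_n)/n)_{n\geqslant 1}$ converges in $\mathbb{R}$, and the sequence of measures $(T_{\frac1n}\nu_{B_n})_{n\geqslant 1}$ converges vaguely to a Borel probability measure on $\mathbb{R}$.
   Context: An integral graded $K$-algebra $B=\bigoplus_{n\geqslant0}B_n$ (i.e. an integral domain) is approximable if: (a) all $B_n$ are finite dimensional over $K$ and $B_n\neq0$ for sufficiently large $n$; (b) for any $\varepsilon\in(0,1)$ there is an integer $p_0\geqslant1$ such that for all integers $p\geqslant p_0$, $$\liminf_{n\to\infty}\frac{\mathrm{rk}(\mathrm{Im}(S^nB_p\to B_{np}))}{\mathrm{rk}(B_{np})}>1-\varepsilon,$$ where $S^nB_p\to B_{np}$ is the canonical map given by multiplication. An $\mathbb{R}$-filtration on a finite dimensional $K$-vector space $W$ is a family $\mathcal{F}=(\mathcal{F}_tW)_{t\in\mathbb{R}}$ of subspaces with $\mathcal{F}_sW\subset\mathcal{F}_tW$ for $t\leqslant s$, $\mathcal{F}_tW=0$ for $t\gg0$, $\mathcal{F}_tW=W$ for $t\ll0$, and $t\mapsto\mathrm{rk}(\mathcal{F}_tW)$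 left continuous. If $W\neq0$, $\nu_W=\nu_{(W,\mathcal F)}$ is the Borel probability measure on $\mathbb{R}$ that is the distributional derivative of $t\mapsto-\mathrm{rk}(\mathcal{F}_tW)/\mathrm{rk}(W)$; $\nu_0$ is the zero measure. For $x\in W$, $\lambda(x)=\sup\{a\in\mathbb{R}\mid x\in\mathcal{F}_aW\}\in\mathbb R\cup\{+\infty\}$, and $\lambda_{\max}(W)=\max_{x\in W\setminus\{0\}}\lambda(x)$, with $\lambda_{\max}(0)=-\infty$. $B$ is $f$-quasi-filtered if there exists $n_0\in\mathbb{N}$ such that for any integer $l\geqslant2$ and all homogeneous elements $x_1,\dots,x_l$ of $B$ of degrees $n_1,\dots,n_l\geqslant n_0$, one has $\lambda(x_1\cdots x_l)\geqslant\sum_{i=1}^l(\lambda(x_i)-f(n_i))$. For $\varepsilon>0$, $T_\varepsilon\nu$ is the push-forward of $\nu$ by $x\mapsto\varepsilon x$. Measures $\nu_n$ converge vaguely to $\nu$ if $\int h\,\mathrm{d}\nu_n\to\int h\,\mathrm{d}\nu$ for every continuous compactly supported $h:\mathbb{R}\to\mathbb{R}$. *)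

theory Defs
  imports "HOL-Probability.Probability"
begin

section \<open>Graded algebras\<close>

context vector_space
begin

definition fin_dim :: "'b set \<Rightarrow> bool" where
  "fin_dim W \<longleftrightarrow> (\<exists>S. finite S \<and> span S = W)"

end

text \<open>The algebra is the whole type \<open>'b\<close>, whose class \<open>idom\<close> makes it a (nontrivial, commutative)
  integral domain. No relation between \<open>B 0\<close> and the field of scalars is imposed.\<close>

locale integral_graded_algebra = vector_space scale
  for scale :: "'k::field \<Rightarrow> 'b::idom \<Rightarrow> 'b" +
  fixes B :: "nat \<Rightarrow> 'b set"
  assumes scale_mult: "scale a (x * y) = scale a x * y"
    and subspace_component: "subspace (B n)"
    and one_mem: "1 \<in> B 0"
    and mult_mem: "x \<in> B m \<Longrightarrow> y \<in> B n \<Longrightarrow> x * y \<in> B (m + n)"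
    and direct_sum: "\<exists>!c. (\<forall>n. c n \<in> B n) \<and> finite {n. c n \<noteq> 0} \<and> x = (\<Sum>n | c n \<noteq> 0. c n)"
begin

text \<open>The image of the multiplication map from the \<open>n\<close>-th symmetric power of \<open>B p\<close> to \<open>B (n * p)\<close>:
  the symmetric power is spanned by the symbols \<open>x\<^sub>0 \<cdots> x\<^sub>n\<^sub>-\<^sub>1\<close> with \<open>x\<^sub>i \<in> B p\<close>, and the map
  sends such a symbol to the product in the algebra.\<close>

definition sym_image :: "nat \<Rightarrow> nat \<Rightarrow> 'b set" where
  "sym_image n p = span {\<Prod>i<n. x i | x. \<forall>i<n. x i \<in> B p}"

end

locale approximable_graded_algebra = integral_graded_algebra scale B
  for scale :: "'k::field \<Rightarrow> 'b::idom \<Rightarrow> 'b" and B :: "nat \<Rightarrow> 'b set" +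
  assumes fin_dim_component: "fin_dim (B n)"
    and eventually_nonzero: "\<exists>N. \<forall>n\<ge>N. B n \<noteq> {0}"
    and approximable: "0 < \<epsilon> \<Longrightarrow> \<epsilon> < 1 \<Longrightarrow>
      \<exists>p0\<ge>1. \<forall>p\<ge>p0.
        liminf (\<lambda>n. ereal (real (dim (sym_image n p)) / real (dim (B (n * p))))) > ereal (1 - \<epsilon>)"


section \<open>Filtrations\<close>

definition (in vector_space) R_filtration :: "'b set \<Rightarrow> (real \<Rightarrow> 'b set) \<Rightarrow> bool" where
  "R_filtration W \<F> \<longleftrightarrow>
     (\<forall>t. subspace (\<F> t) \<and> \<F> t \<subseteq> W) \<and>
     (\<forall>s t. t \<le> s \<longrightarrow> \<F> s \<subseteq> \<F> t) \<and>
     (\<forall>\<^sub>F t in at_top. \<F> t = {0}) \<and>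
     (\<forall>\<^sub>F t in at_bot. \<F> t = W) \<and>
     (\<forall>t. continuous (at_left t) (\<lambda>t. real (dim (\<F> t))))"

definition filt_lambda :: "(real \<Rightarrow> 'b set) \<Rightarrow> 'b \<Rightarrow> ereal" where
  "filt_lambda \<F> x = (SUP a\<in>{a. x \<in> \<F> a}. ereal a)"

text \<open>For a filtration of a nonzero finite-dimensional space this supremum is a maximum; for the
  zero space it is \<open>-\<infinity>\<close>.\<close>

definition lambda_max :: "'b::zero set \<Rightarrow> (real \<Rightarrow> 'b set) \<Rightarrow> ereal" where
  "lambda_max W \<F> = (SUP x\<in>W - {0}. filt_lambda \<F> x)"

text \<open>The values \<open>filt_lambda\<close> of elements of a filtered space are never \<open>-\<infinity>\<close>, so no
  indeterminate sum arises below.\<close>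

definition quasi_filtered ::
  "(nat \<Rightarrow> 'b::comm_ring_1 set) \<Rightarrow> (nat \<Rightarrow> real \<Rightarrow> 'b set) \<Rightarrow> (nat \<Rightarrow> real) \<Rightarrow> bool" where
  "quasi_filtered B \<F> f \<longleftrightarrow>
     (\<exists>n0. \<forall>l\<ge>2. \<forall>(d :: nat \<Rightarrow> nat) x. (\<forall>i<l. d i \<ge> n0 \<and> x i \<in> B (d i)) \<longrightarrow>
        filt_lambda (\<F> (\<Sum>i<l. d i)) (\<Prod>i<l. x i)
          \<ge> (\<Sum>i<l. filt_lambda (\<F> (d i)) (x i) - ereal (f (d i))))"


section \<open>Measures\<close>

definition compactly_supported :: "(real \<Rightarrow> real) \<Rightarrow> bool" where
  "compactly_supported h \<longleftrightarrow> compact (closure {x. h x \<noteq> 0})"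

definition test_function :: "(real \<Rightarrow> real) \<Rightarrow> bool" where
  "test_function \<phi> \<longleftrightarrow>
     (\<forall>k x. (deriv ^^ k) \<phi> differentiable at x) \<and> compactly_supported \<phi>"

definition is_distributional_derivative :: "(real \<Rightarrow> real) \<Rightarrow> real measure \<Rightarrow> bool" where
  "is_distributional_derivative G M \<longleftrightarrow>
     (\<forall>\<phi>. test_function \<phi> \<longrightarrow> (LINT x|M. \<phi> x) = - (LINT t|lborel. G t * deriv \<phi> t))"

text \<open>The locale predicate \<open>real_distribution\<close> says: Borel probability measure on the reals.
  For a filtration of a nonzero finite-dimensional space, exactly one measure has the defining
  property below.\<close>

definition (in vector_space) filt_measure :: "'b set \<Rightarrow> (real \<Rightarrow> 'b set) \<Rightarrow> real measure" where
  "filt_measure W \<F> =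
     (if W = {0} then null_measure borel
      else (THE M. real_distribution M \<and>
              is_distributional_derivative (\<lambda>t. - (real (dim (\<F> t)) / real (dim W))) M))"

definition rescale_measure :: "real \<Rightarrow> real measure \<Rightarrow> real measure" where
  "rescale_measure \<epsilon> M = distr M borel (\<lambda>x. \<epsilon> * x)"

definition vague_conv :: "(nat \<Rightarrow> real measure) \<Rightarrow> real measure \<Rightarrow> bool" where
  "vague_conv M N \<longleftrightarrow>
     (\<forall>h. continuous_on UNIV h \<and> compactly_supported h \<longrightarrow>
        (\<lambda>n. LINT x|M n. h x) \<longlonglongrightarrow> (LINT x|N. h x))"

end

theory Submission
  imports Defs "HOL-Computational_Algebra.Fraction_Field"
begin

text \<open>
The whole theorem rests on one principle. A product of \<open>k\<close> elements of \<open>B p\<close> lying in level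
\<open>p * t\<close> and of one auxiliary element of degree \<open>r\<close> lies in degree \<open>n = k * p + r\<close>, and by
quasi-filteredness its level is at least \<open>n * t\<close> up to a loss of order \<open>n * (f p / p)\<close>, which is
negligible for large \<open>p\<close> (\<open>eventually_power_products\<close>). Since \<open>B\<close> is a domain such a product of
nonzero elements is nonzero, so the sequence \<open>lambda_max (B n) / n\<close> is almost increasing: for
\<open>\<eta> > 0\<close> and every large \<open>p\<close>, all sufficiently late terms exceed the \<open>p\<close>-th one minus \<open>\<eta>\<close>. Being bounded above, it converges
(\<open>lambda_max_converges\<close>).

For the measures, the tail of the rescaled measure at \<open>t\<close> is the normalised rank of the level
\<open>n * t\<close> of \<open>B n\<close>, and it is enough to show that these tails are almost increasing in \<open>n\<close>, at the
price of an arbitrarily small shift of \<open>t\<close>. So one has to see that the products of \<open>k\<close> elements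
of a subspace \<open>W\<close> of \<open>B p\<close>, multiplied by auxiliary elements of bounded degree, span a space of rank
at least \<open>k ^ d * dim W\<close> up to an error that is small relative to \<open>(k * p) ^ d\<close>
(\<open>key_inequality\<close>). This is done in the manner of Okounkov bodies, but with sumsets in a lattice in
place of convex bodies:

\<^item> Approximability, used for one fixed degree \<open>a\<close> and \<open>\<epsilon> = 1/2\<close>, shows that the ranks of \<open>B n\<close> grow
  like those of the subalgebra generated by \<open>B a\<close>, which has a transcendence basis
  \<open>x 0, ..., x d\<close> in \<open>B a\<close>. Hence the ranks are bounded above and below by multiples of \<open>n ^ d\<close>
  (\<open>polynomial_growth_estimates\<close>).

\<^item> Chevalley's extension theorem gives a valuation of the fraction field for which distinct
  Laurent monomials in the ratios \<open>x (i + 1) / x 0\<close> have distinct values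
  (\<open>exists_valued_algebra\<close>). The group of values need not be generated by these monomials, so the
  values of a space \<open>W\<close> are distributed over several cosets of the lattice of monomial values, with
  multiplicities. The growth bound shows that the values of \<open>B p\<close> in one coset lie in a cube of
  side \<open>O(p)\<close> (\<open>value_difference_le\<close>), and that a valuation independent set without two different
  values in one coset has bounded size (\<open>reduced_card_le\<close>). Let \<open>U\<close> be such a set of maximal size.
  Every \<open>W\<close> then has a coset with a set \<open>T\<close> of values that satisfies \<open>dim W \<le> card U * card T\<close>
  (\<open>coset_with_many_values\<close>).

\<^item> The values of products of \<open>k\<close> elements of \<open>W\<close> and a monomial contain, up to a translation, the
  sum of \<open>k\<close> copies of \<open>T\<close> and a cube. Multiplying by \<open>U\<close> turns each of these values into \<open>card U\<close>
  independent elements (\<open>product_dim_bound\<close>), and an elementary induction on the dimension shows that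
  the sumset has at least \<open>k ^ d * card T\<close> points minus \<open>k ^ d\<close> times a boundary term of order
  \<open>p ^ (d - 1)\<close> (\<open>card_thick_sumset\<close>).

Applied to \<open>W = B p\<close>, the inequality also makes \<open>dim (B n) / n ^ d\<close> converge to a positive limit
and keeps almost all of the rank above some fixed level, so that no mass escapes to
\<open>-\<infinity>\<close> (\<open>filtered_ranks\<close>); the bound on \<open>lambda_max\<close> excludes escape to \<open>+\<infinity>\<close>. The limit of the tails,
made one-sidedly continuous, then defines the limit measure
(\<open>weak_limit_of_almost_increasing_tails\<close>). The link between ranks and measures is that the
distributional derivative of minus a normalised rank function is the uniform measure on its jumps
(\<open>filt_measure_eq_jump_measure\<close>).
\<close>

section \<open>Existence of valuation rings\<close>

definition subring_set :: "'f::field set \<Rightarrow> bool" where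
  "subring_set A \<longleftrightarrow> 1 \<in> A \<and> (\<forall>x\<in>A. \<forall>y\<in>A. x - y \<in> A \<and> x * y \<in> A)"

definition ideal_in :: "'f::field set \<Rightarrow> 'f set \<Rightarrow> bool" where
  "ideal_in A J \<longleftrightarrow> 0 \<in> J \<and> J \<subseteq> A \<and> (\<forall>x\<in>J. \<forall>y\<in>J. x + y \<in> J) \<and> (\<forall>a\<in>A. \<forall>x\<in>J. a * x \<in> J)"

lemma subring_set_simps:
  assumes "subring_set A"
  shows "0 \<in> A" "1 \<in> A" "x \<in> A \<Longrightarrow> - x \<in> A" "x \<in> A \<Longrightarrow> y \<in> A \<Longrightarrow> x + y \<in> A"
    "x \<in> A \<Longrightarrow> y \<in> A \<Longrightarrow> x - y \<in> A" "x \<in> A \<Longrightarrow> y \<in> A \<Longrightarrow> x * y \<in> A"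
proof -
  show one: "1 \<in> A" and diff: "\<And>x y. x \<in> A \<Longrightarrow> y \<in> A \<Longrightarrow> x - y \<in> A"
    and "x \<in> A \<Longrightarrow> y \<in> A \<Longrightarrow> x * y \<in> A"
    using assms by (auto simp: subring_set_def)
  show zero: "0 \<in> A" using diff[OF one one] by simp
  show minus: "\<And>x. x \<in> A \<Longrightarrow> - x \<in> A" using diff[OF zero] by simp
  show "x \<in> A \<Longrightarrow> y \<in> A \<Longrightarrow> x + y \<in> A" using diff[OF _ minus, of x y] by simp
qed

lemma subring_set_sum:
  "subring_set A \<Longrightarrow> (\<And>i. i \<in> I \<Longrightarrow> g i \<in> A) \<Longrightarrow> sum g I \<in> A"
  by (induction I rule: infinite_finite_induct) (auto simp: subring_set_simps)

lemma ideal_in_simps: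
  assumes "ideal_in A J"
  shows "0 \<in> J" "x \<in> J \<Longrightarrow> x \<in> A" "x \<in> J \<Longrightarrow> y \<in> J \<Longrightarrow> x + y \<in> J"
    "a \<in> A \<Longrightarrow> x \<in> J \<Longrightarrow> a * x \<in> J"
  using assms by (auto simp: ideal_in_def)

lemma ideal_in_sum:
  "ideal_in A J \<Longrightarrow> (\<And>i. i \<in> I \<Longrightarrow> g i \<in> J) \<Longrightarrow> sum g I \<in> J"
  by (induction I rule: infinite_finite_induct) (auto simp: ideal_in_simps)

text \<open>The ring \<open>A[x]\<close> and its ideal \<open>J A[x]\<close>: the step by which a pair of a ring and an ideal is enlarged
in the maximality argument for valuation rings.\<close>
lemma adjoin_pair:
  fixes x :: "'f::field"
  assumes A: "subring_set A" and J: "ideal_in A J"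
  defines "A' \<equiv> {poly p x |p. \<forall>i. coeff p i \<in> A}" and "J' \<equiv> {poly p x |p. \<forall>i. coeff p i \<in> J}"
  shows "subring_set A'" "ideal_in A' J'" "A \<subseteq> A'" "J \<subseteq> J'" "x \<in> A'"
proof -
  note cl = subring_set_simps[OF A] ideal_in_simps[OF J]
  have A'I: "poly p x \<in> A'" if "\<And>i. coeff p i \<in> A" for p using that by (auto simp: A'_def)
  have J'I: "poly p x \<in> J'" if "\<And>i. coeff p i \<in> J" for p using that by (auto simp: J'_def)
  have "coeff (p * q) i \<in> A" if "\<forall>i. coeff p i \<in> A" "\<forall>i. coeff q i \<in> A" for p q i
    using that by (auto simp: coeff_mult intro!: subring_set_sum[OF A] cl(6))
  moreover have "coeff (p - q) i \<in> A" if "\<forall>i. coeff p i \<in> A" "\<forall>i. coeff q i \<in> A" for p q i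
    using that by (auto intro!: cl(5))
  note closed = calculation this
  have A': "a - b \<in> A' \<and> a * b \<in> A'" if "a \<in> A'" "b \<in> A'" for a b
  proof -
    obtain p q where pq: "a = poly p x" "b = poly q x" "\<forall>i. coeff p i \<in> A" "\<forall>i. coeff q i \<in> A"
      using \<open>a \<in> A'\<close> \<open>b \<in> A'\<close> unfolding A'_def by blast
    then show ?thesis using A'I[of "p - q"] A'I[of "p * q"] closed by simp
  qed
  have const: "poly [:a:] x \<in> A'" if "a \<in> A" for a
    by (rule A'I) (use that cl in \<open>auto simp: coeff_pCons split: nat.split\<close>)
  show "subring_set A'" using A' const[of 1] cl(2) by (simp add: subring_set_def)
  show "A \<subseteq> A'" using const by auto
  have "poly [:a:] x \<in> J'" if "a \<in> J" for a
    by (rule J'I) (use that cl in \<open>auto simp: coeff_pCons split: nat.split\<close>)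
  then show "J \<subseteq> J'" by auto
  have "poly [:0, 1:] x \<in> A'"
    by (rule A'I) (use cl in \<open>auto simp: coeff_pCons split: nat.split\<close>)
  then show "x \<in> A'" by simp
  have "a + b \<in> J'" if ab: "a \<in> J'" "b \<in> J'" for a b
  proof -
    obtain p q where "a = poly p x" "b = poly q x" "\<forall>i. coeff p i \<in> J" "\<forall>i. coeff q i \<in> J"
      using ab by (auto simp: J'_def)
    then show ?thesis using J'I[of "p + q"] cl by auto
  qed
  moreover have "a * b \<in> J'" if ab: "a \<in> A'" "b \<in> J'" for a b
  proof -
    obtain p q where pq: "a = poly p x" "b = poly q x" "\<forall>i. coeff p i \<in> A" "\<forall>i. coeff q i \<in> J"
      using ab by (auto simp: J'_def A'_def)
    then have "coeff (p * q) i \<in> J" for i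
      by (auto simp: coeff_mult intro!: ideal_in_sum[OF J] cl(10))
    then show ?thesis using J'I[of "p * q"] pq by auto
  qed
  moreover have "J' \<subseteq> A'" using cl by (auto simp: J'_def A'_def)
  ultimately show "ideal_in A' J'" using J'I[of 0] cl by (auto simp: ideal_in_def)
qed

text \<open>A relation exists for some degree exactly when the extended ideal \<open>J A[x]\<close> contains \<open>1\<close>.\<close>
definition relation_of_degree :: "'f::field set \<Rightarrow> 'f \<Rightarrow> nat \<Rightarrow> bool" where
  "relation_of_degree J x n \<longleftrightarrow> (\<exists>a. (\<forall>i. a i \<in> J) \<and> (\<Sum>i\<le>n. a i * x ^ i) = 1)"

text \<open>The relation for \<open>inverse x\<close>, multiplied by \<open>x ^ Suc n\<close>, expresses \<open>(1 - b 0) * x ^ Suc n\<close> by lower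
powers of \<open>x\<close>; no negative power occurs because \<open>m \<le> Suc n\<close>. Multiplying the relation for \<open>x\<close> by
\<open>1 - b 0\<close>, adding \<open>b 0\<close>, and substituting for the top power lowers its degree.\<close>
lemma relation_reduce:
  assumes A: "subring_set A" and J: "ideal_in A J" and x: "x \<noteq> 0"
    and n: "relation_of_degree J x (Suc n)" and m: "relation_of_degree J (inverse x) m" and mn: "m \<le> Suc n"
  shows "relation_of_degree J x n"
proof -
  note cl = subring_set_simps[OF A] ideal_in_simps[OF J]
  obtain a where a: "\<And>i. a i \<in> J" "(\<Sum>i\<le>Suc n. a i * x ^ i) = 1"
    using n by (auto simp: relation_of_degree_def)
  obtain b where b: "\<And>i. b i \<in> J" "(\<Sum>i\<le>m. b i * inverse x ^ i) = 1"
    using m by (auto simp: relation_of_degree_def)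
  define a' where "a' i = (1 - b 0) * a i + (if i = 0 then b 0 else 0)
     + a (Suc n) * (if Suc n - i \<le> m then b (Suc n - i) else 0)" for i
  have "a' i \<in> J" for i
    using a(1) b(1) cl(1,2,7) cl(8)[OF b(1)] cl(8)[OF a(1)] unfolding a'_def
    by (intro cl(9) cl(10) cl(5)) auto
  moreover have "(\<Sum>i\<le>n. a' i * x ^ i) = 1"
  proof -
    have "x ^ Suc n * (1 - b 0) = (\<Sum>i\<in>{1..m}. b i * x ^ (Suc n - i))"
    proof -
      have "(\<Sum>i\<le>m. b i * inverse x ^ i) = b 0 + (\<Sum>i\<in>{1..m}. b i * inverse x ^ i)"
        by (simp add: atMost_atLeast0 sum.atLeast_Suc_atMost)
      then have "1 - b 0 = (\<Sum>i\<in>{1..m}. b i * inverse x ^ i)" using b(2) by (simp add: algebra_simps)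
      then have "x ^ Suc n * (1 - b 0) = (\<Sum>i\<in>{1..m}. x ^ Suc n * (b i * inverse x ^ i))"
        by (simp only: sum_distrib_left)
      also have "\<dots> = (\<Sum>i\<in>{1..m}. b i * x ^ (Suc n - i))"
      proof (rule sum.cong)
        fix i assume "i \<in> {1..m}"
        then have "x ^ Suc n = x ^ (Suc n - i) * x ^ i" using mn by (simp flip: power_add)
        then show "x ^ Suc n * (b i * inverse x ^ i) = b i * x ^ (Suc n - i)"
          using x by (simp add: field_simps)
      qed simp
      finally show ?thesis .
    qed
    also have "\<dots> = (\<Sum>i\<in>{i. i \<le> n \<and> Suc n - i \<le> m}. b (Suc n - i) * x ^ i)"
      by (rule sum.reindex_bij_witness[of _ "\<lambda>i. Suc n - i" "\<lambda>i. Suc n - i"]) (use mn in auto)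
    also have "\<dots> = (\<Sum>i\<le>n. (if Suc n - i \<le> m then b (Suc n - i) else 0) * x ^ i)"
      by (rule sum.mono_neutral_cong_left) auto
    finally have e: "(\<Sum>i\<le>n. (if Suc n - i \<le> m then b (Suc n - i) else 0) * x ^ i) = x ^ Suc n * (1 - b 0)" ..
    have "(\<Sum>i\<le>n. a' i * x ^ i) = (1 - b 0) * (\<Sum>i\<le>n. a i * x ^ i)
       + (\<Sum>i\<le>n. (if i = 0 then b 0 else 0) * x ^ i)
       + a (Suc n) * (\<Sum>i\<le>n. (if Suc n - i \<le> m then b (Suc n - i) else 0) * x ^ i)"
      by (simp only: a'_def distrib_right sum.distrib sum_distrib_left mult.assoc)
    also have "(\<Sum>i\<le>n. (if i = 0 then b 0 else 0) * x ^ i) = b 0"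
      by (subst sum.mono_neutral_right[of _ "{0}"]) auto
    also have "(\<Sum>i\<le>n. a i * x ^ i) = 1 - a (Suc n) * x ^ Suc n"
      using a(2) by (simp add: algebra_simps)
    finally show ?thesis unfolding e by (simp add: algebra_simps)
  qed
  ultimately show ?thesis by (auto simp: relation_of_degree_def)
qed

text \<open>The longer of the two relations can always be shortened by the other one, and a relation of degree
\<open>0\<close> would say that \<open>1 \<in> J\<close>.\<close>
lemma no_two_relations:
  assumes A: "subring_set A" and J: "ideal_in A J" and proper: "1 \<notin> J" and x: "x \<noteq> 0"
  shows "\<not> (relation_of_degree J x n \<and> relation_of_degree J (inverse x) m)"
  using x
proof (induction "n + m" arbitrary: n m x rule: less_induct)
  case less
  have 0: "\<not> relation_of_degree J y 0" for y
    using proper by (auto simp: relation_of_degree_def) metis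
  show ?case
  proof
    assume R: "relation_of_degree J x n \<and> relation_of_degree J (inverse x) m"
    then obtain n' m' where nm: "n = Suc n'" "m = Suc m'" using 0 by (metis not0_implies_Suc)
    show False
    proof (cases "m \<le> n")
      case True
      then show False using relation_reduce[OF A J less.prems, of n' m] R nm less.hyps[of n' m x] less.prems by auto
    next
      case False
      then show False using relation_reduce[OF A J, of "inverse x" m' n] R nm less.hyps[of n m' x] less.prems by auto
    qed
  qed
qed

text \<open>Chevalley's theorem. Take a maximal pair of a ring and a proper ideal above \<open>(A, J)\<close>. If neither
\<open>x\<close> nor \<open>inverse x\<close> were in the ring, adjoining either of them would make the ideal improper, which
gives relations for both and contradicts \<open>no_two_relations\<close>. In terms of the valuation belonging to
\<open>V\<close>, elements of \<open>A\<close> have nonnegative value and elements of \<open>J\<close> have positive value.\<close>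
lemma exists_valuation_ring:
  fixes A :: "'f::field set"
  assumes A: "subring_set A" and J: "ideal_in A J" and proper: "1 \<notin> J"
  shows "\<exists>V. subring_set V \<and> A \<subseteq> V \<and> (\<forall>x. x \<in> V \<or> inverse x \<in> V) \<and> (\<forall>x\<in>J. x \<noteq> 0 \<longrightarrow> inverse x \<notin> V)"
proof -
  (* A pair (ring, ideal) is coded as one subset of 'f * bool, so that inclusion of sets is the
     componentwise order and Zorn's lemma for inclusion applies. *)
  define R I where "R S = {x. (x, True) \<in> S}" and "I S = {x. (x, False) \<in> S}" for S :: "('f \<times> bool) set"
  define \<A> where "\<A> = {S. A \<subseteq> R S \<and> J \<subseteq> I S \<and> subring_set (R S) \<and> ideal_in (R S) (I S) \<and> 1 \<notin> I S}"
  define pair where "pair U W = U \<times> {True} \<union> W \<times> {False}" for U W :: "'f set"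
  have Rpair [simp]: "R (pair U W) = U" and [simp]: "I (pair U W) = W" for U W by (auto simp: R_def I_def pair_def)
  have "\<exists>M\<in>\<A>. \<forall>X\<in>\<A>. M \<subseteq> X \<longrightarrow> X = M"
  proof (rule subset_Zorn_nonempty)
    have "pair A J \<in> \<A>" using assms by (auto simp: \<A>_def)
    then show "\<A> \<noteq> {}" by auto
  next
    fix C assume C: "C \<noteq> {}" "subset.chain \<A> C"
    have sub: "S \<in> \<A>" if "S \<in> C" for S using C that by (auto simp: subset.chain_def)
    have two: "\<exists>S\<in>C. S1 \<subseteq> S \<and> S2 \<subseteq> S" if "S1 \<in> C" "S2 \<in> C" for S1 S2
    proof -
      have "S1 \<subseteq> S2 \<or> S2 \<subseteq> S1" using C(2) that unfolding subset_chain_def by blast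
      then show ?thesis using that by blast
    qed
    have mono: "R S \<subseteq> R S'" "I S \<subseteq> I S'" if "S \<subseteq> S'" for S S' using that by (auto simp: R_def I_def)
    have RU: "R (\<Union>C) = (\<Union>S\<in>C. R S)" and IU: "I (\<Union>C) = (\<Union>S\<in>C. I S)" by (auto simp: R_def I_def)
    have "subring_set (R (\<Union>C))"
      unfolding subring_set_def
    proof (intro conjI ballI)
      show "1 \<in> R (\<Union>C)" 
      proof -
        obtain S where "S \<in> C" using C(1) by blast
        moreover from this have "subring_set (R S)" using sub by (simp add: \<A>_def)
        ultimately show ?thesis unfolding RU by (auto simp: subring_set_def)
      qed
      fix x y assume "x \<in> R (\<Union>C)" "y \<in> R (\<Union>C)"
      then obtain S1 S2 where "S1 \<in> C" "S2 \<in> C" "x \<in> R S1" "y \<in> R S2" unfolding RU by blast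
      then obtain S where "S \<in> C" "x \<in> R S" "y \<in> R S" using two[of S1 S2] mono by blast
      moreover have "subring_set (R S)" using sub \<open>S \<in> C\<close> by (auto simp: \<A>_def)
      ultimately show "x - y \<in> R (\<Union>C)" "x * y \<in> R (\<Union>C)"
        unfolding RU using subring_set_simps(5,6)[of "R S" x y] by blast+
    qed
    moreover have "ideal_in (R (\<Union>C)) (I (\<Union>C))"
      unfolding ideal_in_def
    proof (intro conjI ballI)
      show "0 \<in> I (\<Union>C)" 
      proof -
        obtain S where "S \<in> C" using C(1) by blast
        moreover from this have "ideal_in (R S) (I S)" using sub by (simp add: \<A>_def)
        ultimately show ?thesis unfolding IU by (auto simp: ideal_in_def)
      qed
      show "I (\<Union>C) \<subseteq> R (\<Union>C)" unfolding IU RU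
      proof (rule UN_mono)
        fix S assume "S \<in> C"
        then have "ideal_in (R S) (I S)" using sub by (simp add: \<A>_def)
        then show "I S \<subseteq> R S" by (simp add: ideal_in_def)
      qed simp
      fix x y assume y: "y \<in> I (\<Union>C)"
      show "x + y \<in> I (\<Union>C)" if x: "x \<in> I (\<Union>C)"
      proof -
        obtain S1 S2 where "S1 \<in> C" "S2 \<in> C" "x \<in> I S1" "y \<in> I S2" using y x unfolding IU by blast
        then obtain S where "S \<in> C" "x \<in> I S" "y \<in> I S" using two[of S1 S2] mono by blast
        moreover have "ideal_in (R S) (I S)" using sub \<open>S \<in> C\<close> by (simp add: \<A>_def)
        ultimately show ?thesis unfolding IU using ideal_in_simps(3)[of "R S" "I S" x y] by blast
      qed
      show "x * y \<in> I (\<Union>C)" if x: "x \<in> R (\<Union>C)"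
      proof -
        obtain S1 S2 where "S1 \<in> C" "S2 \<in> C" "x \<in> R S1" "y \<in> I S2" using y x unfolding IU RU by blast
        then obtain S where "S \<in> C" "x \<in> R S" "y \<in> I S" using two[of S1 S2] mono by blast
        moreover have "ideal_in (R S) (I S)" using sub \<open>S \<in> C\<close> by (simp add: \<A>_def)
        ultimately show ?thesis unfolding IU using ideal_in_simps(4)[of "R S" "I S" x y] by blast
      qed
    qed
    moreover have "A \<subseteq> R (\<Union>C)" "J \<subseteq> I (\<Union>C)" "1 \<notin> I (\<Union>C)" using C sub by (auto simp: IU RU \<A>_def)
    ultimately show "\<Union>C \<in> \<A>" by (simp add: \<A>_def)
  qed
  then obtain M where M: "M \<in> \<A>" and max: "\<And>X. X \<in> \<A> \<Longrightarrow> M \<subseteq> X \<Longrightarrow> X = M" by blast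
  have sR: "subring_set (R M)" and iI: "ideal_in (R M) (I M)" and n1: "1 \<notin> I M"
    and sub: "A \<subseteq> R M" "J \<subseteq> I M" using M by (auto simp: \<A>_def)
  have rel: "\<exists>n. relation_of_degree (I M) x n" if x: "x \<notin> R M" for x
  proof -
    define A1 where "A1 = {poly p x |p. \<forall>i. coeff p i \<in> R M}"
    define J1 where "J1 = {poly p x |p. \<forall>i. coeff p i \<in> I M}"
    note ad = adjoin_pair[OF sR iI, of x, folded A1_def J1_def]
    have "M \<subseteq> pair A1 J1"
    proof
      fix z assume z: "z \<in> M"
      obtain u b where ub: "z = (u, b)" by (cases z)
      show "z \<in> pair A1 J1"
      proof (cases b)
        case True
        then have "u \<in> R M" using z ub by (simp add: R_def)
        then show ?thesis using ad(3) ub True by (auto simp: pair_def)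
      next
        case False
        then have "u \<in> I M" using z ub by (simp add: I_def)
        then show ?thesis using ad(4) ub False by (auto simp: pair_def)
      qed
    qed
    moreover have "pair A1 J1 \<noteq> M"
    proof
      assume "pair A1 J1 = M"
      then have "R (pair A1 J1) = R M" by simp
      then show False using ad(5) x by simp
    qed
    ultimately have "pair A1 J1 \<notin> \<A>" using max by blast
    moreover have "A \<subseteq> A1" "J \<subseteq> J1" using ad(3,4) sub by blast+
    ultimately have "1 \<in> J1" using ad(1,2) by (simp add: \<A>_def)
    then obtain p where p: "\<forall>i. coeff p i \<in> I M" "1 = poly p x" unfolding J1_def by blast
    then have "relation_of_degree (I M) x (degree p)"
      unfolding relation_of_degree_def by (intro exI[of _ "coeff p"]) (simp flip: poly_altdef)
    then show ?thesis by blast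
  qed
  have "x \<in> R M \<or> inverse x \<in> R M" for x
  proof (cases "x = 0")
    case True
    then show ?thesis using subring_set_simps(1)[OF sR] by simp
  next
    case False
    then show ?thesis using no_two_relations[OF sR iI n1 False] rel[of x] rel[of "inverse x"] by metis
  qed
  moreover have "inverse x \<notin> R M" if "x \<in> J" "x \<noteq> 0" for x
  proof
    assume "inverse x \<in> R M"
    then have "inverse x * x \<in> I M" using ideal_in_simps(4)[OF iI] that(1) sub(2) by blast
    then show False using that(2) n1 by simp
  qed
  ultimately show ?thesis using sR sub(1) by (intro exI[of _ "R M"]) auto
qed

section \<open>Lattice points in thickened sumsets\<close>

text \<open>Vectors of length \<open>d\<close> are functions on all naturals that vanish from \<open>d\<close> on, which allows induction
on \<open>d\<close> within one type.\<close>
definition cube :: "nat \<Rightarrow> nat \<Rightarrow> (nat \<Rightarrow> int) set" where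
  "cube d M = {\<tau>. (\<forall>i<d. 0 \<le> \<tau> i \<and> \<tau> i \<le> int M) \<and> (\<forall>i\<ge>d. \<tau> i = 0)}"

text \<open>The sum of \<open>k\<close> copies of \<open>T\<close> and a cube. The cube fills the gaps: its side is the diameter of \<open>T\<close>
in the applications.\<close>
definition thick_sumset :: "nat \<Rightarrow> nat \<Rightarrow> nat \<Rightarrow> (nat \<Rightarrow> int) set \<Rightarrow> (nat \<Rightarrow> int) set" where
  "thick_sumset d M k T = {\<lambda>i. (\<Sum>j<k. \<tau> j i) + b i | \<tau> b. (\<forall>j<k. \<tau> j \<in> T) \<and> b \<in> cube d M}"

lemma thick_sumsetI:
  assumes "\<And>j. j < k \<Longrightarrow> \<tau> j \<in> T" "b \<in> cube d M" "x = (\<lambda>i. (\<Sum>j<k. \<tau> j i) + b i)"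
  shows "x \<in> thick_sumset d M k T"
  unfolding thick_sumset_def using assms by blast

lemma cube_Suc: "cube (Suc d) M = (\<lambda>(\<beta>, c). \<beta>(d := c)) ` (cube d M \<times> {0..int M})"
proof (intro equalityI subsetI)
  fix \<tau> assume "\<tau> \<in> cube (Suc d) M"
  then have "\<tau> = (\<lambda>(\<beta>, c). \<beta>(d := c)) (\<tau>(d := 0), \<tau> d)" "(\<tau>(d := 0), \<tau> d) \<in> cube d M \<times> {0..int M}"
    by (auto simp: cube_def)
  then show "\<tau> \<in> (\<lambda>(\<beta>, c). \<beta>(d := c)) ` (cube d M \<times> {0..int M})" by blast
qed (auto simp: cube_def less_Suc_eq)

lemma inj_on_upd_cube: "inj_on (\<lambda>(\<beta>, c). \<beta>(d := c)) ({\<beta> :: nat \<Rightarrow> int. \<beta> d = (0::int)} \<times> C)"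
proof (rule inj_onI, clarify)
  fix \<beta> \<beta>' :: "nat \<Rightarrow> int" and c c' :: int
  assume "\<beta> d = 0" "\<beta>' d = 0" and e: "\<beta>(d := c) = \<beta>'(d := c')"
  have "\<beta> i = \<beta>' i" for i using fun_cong[OF e, of i] \<open>\<beta> d = 0\<close> \<open>\<beta>' d = 0\<close> by (cases "i = d") auto
  then show "\<beta> = \<beta>' \<and> c = c'" using fun_cong[OF e, of d] by auto
qed

lemma finite_cube [simp]: "finite (cube d M)" and card_cube: "card (cube d M) = (M + 1) ^ d"
proof (induction d)
  case 0
  have e: "cube 0 M = {\<lambda>_. 0}" by (auto simp: cube_def)
  { case 1 show ?case by (simp add: e) }
  { case 2 show ?case by (simp add: e) }
next
  case (Suc d)
  { case 1 show ?case using Suc by (simp add: cube_Suc) }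
  { case 2
    have "inj_on (\<lambda>(\<beta>, c). \<beta>(d := c)) (cube d M \<times> {0..int M})"
      by (rule inj_on_subset[OF inj_on_upd_cube]) (auto simp: cube_def)
    then show ?case using Suc by (simp add: cube_Suc card_image card_cartesian_product nat_add_distrib) }
qed

lemma finite_thick_sumset:
  assumes "finite T" shows "finite (thick_sumset d M k T)"
proof -
  have "thick_sumset d M k T \<subseteq> (\<lambda>(\<tau>, b) i. (\<Sum>j<k. \<tau> j i) + b i) ` (PiE {..<k} (\<lambda>_. T) \<times> cube d M)"
  proof
    fix x assume "x \<in> thick_sumset d M k T"
    then obtain \<tau> b where "x = (\<lambda>i. (\<Sum>j<k. \<tau> j i) + b i)" "\<forall>j<k. \<tau> j \<in> T" "b \<in> cube d M"
      by (auto simp: thick_sumset_def)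
    then have "x = (\<lambda>(\<tau>, b) i. (\<Sum>j<k. \<tau> j i) + b i) (restrict \<tau> {..<k}, b)"
      "(restrict \<tau> {..<k}, b) \<in> PiE {..<k} (\<lambda>_. T) \<times> cube d M" by auto
    then show "x \<in> (\<lambda>(\<tau>, b) i. (\<Sum>j<k. \<tau> j i) + b i) ` (PiE {..<k} (\<lambda>_. T) \<times> cube d M)" by blast
  qed
  moreover have "finite (PiE {..<k} (\<lambda>_. T) \<times> cube d M)"
    using assms by (intro finite_cartesian_product finite_PiE) auto
  ultimately show ?thesis by (meson finite_imageI finite_subset)
qed

lemma steps_cover_interval:
  fixes c :: "nat \<Rightarrow> int"
  assumes "\<And>j. j < k \<Longrightarrow> c (Suc j) \<le> c j + M" "c 0 \<le> x" "x \<le> c k + M"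
  shows "\<exists>j\<le>k. c j \<le> x \<and> x \<le> c j + M"
  using assms
proof (induction k)
  case (Suc k)
  show ?case
  proof (cases "c (Suc k) \<le> x")
    case False
    then have "x \<le> c k + M" using Suc.prems(1)[of k] by simp
    then show ?thesis using Suc by (meson le_SucI less_SucI)
  qed (use Suc in auto)
qed auto

text \<open>Switch the last coordinates of the \<open>k\<close> summands one after the other from \<open>lo\<close> to \<open>hi\<close>. Their sum
moves from its least to its greatest value, a distance of at least \<open>k * s\<close>, in steps of length at most
\<open>M\<close>, and an interval of length \<open>M\<close> from the cube covers each step. So the fibre contains an
interval of \<open>k * s\<close> points.\<close>
lemma thick_sumset_fibre:
  assumes T': "\<And>\<alpha>. \<alpha> \<in> T' \<Longrightarrow> \<alpha>(d := lo \<alpha>) \<in> T \<and> \<alpha>(d := hi \<alpha>) \<in> T \<and> int s \<le> hi \<alpha> - lo \<alpha> \<and> hi \<alpha> - lo \<alpha> \<le> int M"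
    and \<beta>: "\<beta> \<in> thick_sumset d M k T'"
  obtains a where "\<And>x. a \<le> x \<Longrightarrow> x < a + int (k * s) \<Longrightarrow> \<beta>(d := x) \<in> thick_sumset (Suc d) M k T"
proof -
  obtain \<tau> b where \<tau>: "\<And>j. j < k \<Longrightarrow> \<tau> j \<in> T'" and b: "b \<in> cube d M" and \<beta>eq: "\<beta> = (\<lambda>i. (\<Sum>j<k. \<tau> j i) + b i)"
    using \<beta> by (auto simp: thick_sumset_def)
  (* the last coordinate of the sum after the first m switches *)
  define c where "c m = (\<Sum>j<k. if j < m then hi (\<tau> j) else lo (\<tau> j))" for m
  show thesis
  proof (rule that[of "c 0"])
    fix x assume x: "c 0 \<le> x" "x < c 0 + int (k * s)"
    have step: "c (Suc m) = c m + (hi (\<tau> m) - lo (\<tau> m))" if "m < k" for m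
    proof -
      have "c (Suc m) - c m = (\<Sum>j<k. (if j < Suc m then hi (\<tau> j) else lo (\<tau> j)) - (if j < m then hi (\<tau> j) else lo (\<tau> j)))"
        by (simp add: c_def sum_subtractf)
      also have "\<dots> = (\<Sum>j\<in>{m}. hi (\<tau> j) - lo (\<tau> j))"
        by (rule sum.mono_neutral_cong_right) (use that in auto)
      finally show ?thesis by simp
    qed
    have "c k - c 0 = (\<Sum>j<k. hi (\<tau> j) - lo (\<tau> j))" by (simp add: c_def sum_subtractf)
    also have "\<dots> \<ge> (\<Sum>j<k. int s)" using T' \<tau> by (intro sum_mono) auto
    finally have "x \<le> c k + int M" using x by simp
    moreover have "c (Suc m) \<le> c m + int M" if "m < k" for m using step[OF that] T'[OF \<tau>[OF that]] by auto
    ultimately obtain m where m: "m \<le> k" "c m \<le> x" "x \<le> c m + int M"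
      using steps_cover_interval[of k c "int M" x] x by auto
    let ?\<tau> = "\<lambda>j. (\<tau> j)(d := if j < m then hi (\<tau> j) else lo (\<tau> j))" and ?b = "b(d := x - c m)"
    have "\<beta>(d := x) = (\<lambda>i. (\<Sum>j<k. ?\<tau> j i) + ?b i)" by (auto simp: \<beta>eq c_def)
    moreover have "?\<tau> j \<in> T" if "j < k" for j using T' \<tau> that by auto
    moreover have "?b \<in> cube (Suc d) M" using b m by (auto simp: cube_def)
    ultimately show "\<beta>(d := x) \<in> thick_sumset (Suc d) M k T" using thick_sumsetI[of k ?\<tau> T ?b] by blast
  qed
qed

lemma card_filter: "finite S \<Longrightarrow> card {s\<in>S. P s} = (\<Sum>s\<in>S. if P s then 1 else 0)"
  by (simp only: card_eq_sum sum.inter_filter)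

text \<open>Induction on \<open>d\<close> by projecting along the last coordinate. Let \<open>L s\<close> be the set of points of the
projection \<open>T'\<close> whose fibre has length at least \<open>s\<close>. Replacing fibres of \<open>T\<close> by intervals gives
\<open>card T \<le> card T' + (\<Sum>s=1..M. card (L s))\<close>. Over the thickened sumset of \<open>L s\<close> the fibres have at
least \<open>k * s\<close> points by \<open>thick_sumset_fibre\<close>, so summing over \<open>s\<close> the thickened sumset of \<open>T\<close> has at
least \<open>k\<close> times as many points as the thickened sumsets of all \<open>L s\<close> together, to which the
induction hypothesis applies. The error is \<open>k ^ d\<close> times the number of points on \<open>d\<close> facets of the cube;
it matters later that the latter is of order \<open>M ^ (d - 1)\<close> only.\<close>
lemma card_thick_sumset:
  assumes "T \<subseteq> cube d M"
  shows "k ^ d * card T \<le> card (thick_sumset d M k T) + k ^ d * (d * (M + 1) ^ (d - 1))"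
  using assms
proof (induction d arbitrary: T)
  case 0
  show ?case
  proof (cases "T = {}")
    case False
    have c0: "cube 0 M = {\<lambda>_. 0}" by (auto simp: cube_def)
    then have "T = {\<lambda>_. 0}" using 0 False by auto
    moreover from this have "(\<lambda>_. 0) \<in> thick_sumset 0 M k T"
      by (intro thick_sumsetI[of k "\<lambda>_ _. 0" T "\<lambda>_. 0"]) (auto simp: c0)
    then have "card (thick_sumset 0 M k T) > 0"
      using finite_thick_sumset[of T 0 M k] \<open>T = {\<lambda>_. 0}\<close> by (subst card_gt_0_iff) auto
    ultimately show ?thesis by simp
  qed simp
next
  case (Suc d)
  have finT: "finite T" using Suc.prems finite_subset finite_cube by blast
  define F where "F \<alpha> = {\<tau> d |\<tau>. \<tau> \<in> T \<and> \<tau>(d := 0) = \<alpha>}" for \<alpha>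
  define T' where "T' = (\<lambda>\<tau>. \<tau>(d := 0)) ` T"
  define lo hi where "lo \<alpha> = Min (F \<alpha>)" and "hi \<alpha> = Max (F \<alpha>)" for \<alpha>
  define L where "L s = {\<alpha> \<in> T'. int s \<le> hi \<alpha> - lo \<alpha>}" for s
  define A where "A = thick_sumset (Suc d) M k T"
  define A' where "A' s = thick_sumset d M k (L s)" for s
  have finT': "finite T'" using finT by (simp add: T'_def)
  have finF: "finite (F \<alpha>)" for \<alpha> using finT by (simp add: F_def)
  have F_ne: "F \<alpha> \<noteq> {}" if "\<alpha> \<in> T'" for \<alpha> using that by (auto simp: F_def T'_def)
  have F_T: "\<alpha>(d := c) \<in> T" if "c \<in> F \<alpha>" for \<alpha> c using that by (auto simp: F_def fun_upd_idem)
  have F_M: "0 \<le> c \<and> c \<le> int M" if "c \<in> F \<alpha>" for \<alpha> c using that Suc.prems by (auto simp: F_def cube_def)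
  have lo_hi: "lo \<alpha> \<in> F \<alpha>" "hi \<alpha> \<in> F \<alpha>" if "\<alpha> \<in> T'" for \<alpha>
    using F_ne[OF that] finF by (auto simp: lo_def hi_def)
  have h: "0 \<le> hi \<alpha> - lo \<alpha>" "hi \<alpha> - lo \<alpha> \<le> int M" if "\<alpha> \<in> T'" for \<alpha>
    using F_M[OF lo_hi(1)[OF that]] F_M[OF lo_hi(2)[OF that]] Max_ge[OF finF lo_hi(1)[OF that]]
    by (auto simp: hi_def)
  have T'_cube: "T' \<subseteq> cube d M" using Suc.prems by (auto simp: T'_def cube_def)
  have card_T: "card T \<le> (M + 1) ^ d + (\<Sum>s\<in>{1..M}. card (L s))"
  proof -
    have "T \<subseteq> (\<lambda>(\<alpha>, c). \<alpha>(d := c)) ` (Sigma T' (\<lambda>\<alpha>. {lo \<alpha>..hi \<alpha>}))"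
    proof
      fix \<tau> assume \<tau>: "\<tau> \<in> T"
      then have "\<tau> d \<in> F (\<tau>(d := 0))" by (auto simp: F_def)
      then have m: "(\<tau>(d := 0), \<tau> d) \<in> Sigma T' (\<lambda>\<alpha>. {lo \<alpha>..hi \<alpha>})" using \<tau> finF by (auto simp: T'_def lo_def hi_def)
      have e: "\<tau> = (\<lambda>(\<alpha>, c). \<alpha>(d := c)) (\<tau>(d := 0), \<tau> d)" by simp
      show "\<tau> \<in> (\<lambda>(\<alpha>, c). \<alpha>(d := c)) ` (Sigma T' (\<lambda>\<alpha>. {lo \<alpha>..hi \<alpha>}))"
        using imageI[OF m, of "\<lambda>(\<alpha>, c). \<alpha>(d := c)"] by (simp only: e[symmetric])
    qed
    then have "card T \<le> card (Sigma T' (\<lambda>\<alpha>. {lo \<alpha>..hi \<alpha>}))"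
      using finT' by (meson surj_card_le finite_SigmaI finite_atLeastAtMost_int)
    also have "\<dots> = (\<Sum>\<alpha>\<in>T'. nat (hi \<alpha> - lo \<alpha> + 1))" using finT' by (simp add: card_SigmaI algebra_simps)
    also have "\<dots> = (\<Sum>\<alpha>\<in>T'. 1 + card {s\<in>{1..M}. int s \<le> hi \<alpha> - lo \<alpha>})"
    proof (rule sum.cong)
      fix \<alpha> assume "\<alpha> \<in> T'"
      then have "{s\<in>{1..M}. int s \<le> hi \<alpha> - lo \<alpha>} = {1..nat (hi \<alpha> - lo \<alpha>)}" using h[of \<alpha>] by auto
      then show "nat (hi \<alpha> - lo \<alpha> + 1) = 1 + card {s\<in>{1..M}. int s \<le> hi \<alpha> - lo \<alpha>}"
        using h[OF \<open>\<alpha> \<in> T'\<close>] by simp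
    qed simp
    also have "\<dots> = card T' + (\<Sum>\<alpha>\<in>T'. \<Sum>s\<in>{1..M}. if int s \<le> hi \<alpha> - lo \<alpha> then 1 else 0)"
      unfolding card_filter[OF finite_atLeastAtMost] by (subst sum.distrib) simp
    also have "\<dots> = card T' + (\<Sum>s\<in>{1..M}. card (L s))"
      unfolding L_def card_filter[OF finT'] by (subst sum.swap) (rule refl)
    finally show ?thesis using card_mono[OF finite_cube T'_cube] card_cube[of d M] by simp
  qed
  have finA: "finite A" using finite_thick_sumset[OF finT] by (simp add: A_def)
  have finA': "finite (A' s)" for s using finite_thick_sumset[of "L s"] finT' by (simp add: A'_def L_def)
  have A'0: "\<beta> d = 0" if "\<beta> \<in> A' s" for \<beta> s
    using that T'_cube by (fastforce simp: A'_def thick_sumset_def cube_def L_def intro!: sum.neutral)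
  define H where "H \<beta> = {x. \<beta>(d := x) \<in> A}" for \<beta>
  define U where "U = (\<Union>s\<in>{1..M}. A' s)"
  have finU: "finite U" using finA' by (simp add: U_def)
  have finH: "finite (H \<beta>)" for \<beta>
  proof -
    have "inj_on (\<lambda>x. \<beta>(d := x)) (H \<beta>)" by (auto intro!: inj_onI dest: fun_upd_eqD)
    moreover have "(\<lambda>x. \<beta>(d := x)) ` H \<beta> \<subseteq> A" by (auto simp: H_def)
    ultimately show ?thesis using finA inj_on_finite by blast
  qed
  have H: "k * s \<le> card (H \<beta>)" if \<beta>: "\<beta> \<in> A' s" for \<beta> s
  proof -
    obtain a where a: "\<And>x. a \<le> x \<Longrightarrow> x < a + int (k * s) \<Longrightarrow> \<beta>(d := x) \<in> thick_sumset (Suc d) M k T"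
    proof (rule thick_sumset_fibre[of "L s" d lo T hi s M \<beta> k])
      fix \<alpha> assume "\<alpha> \<in> L s"
      then show "\<alpha>(d := lo \<alpha>) \<in> T \<and> \<alpha>(d := hi \<alpha>) \<in> T \<and> int s \<le> hi \<alpha> - lo \<alpha> \<and> hi \<alpha> - lo \<alpha> \<le> int M"
        using h lo_hi F_T by (simp add: L_def)
    qed (use \<beta> in \<open>auto simp: A_def A'_def\<close>)
    have "{a..<a + int (k * s)} \<subseteq> H \<beta>" using a by (auto simp: H_def A_def)
    from card_mono[OF finH this] show ?thesis by (simp del: of_nat_mult)
  qed
  have "(\<Sum>s\<in>{1..M}. k * card (A' s)) \<le> card A"
  proof -
    have "(\<Sum>s\<in>{1..M}. k * card (A' s)) = (\<Sum>s\<in>{1..M}. \<Sum>\<beta>\<in>U. if \<beta> \<in> A' s then k else 0)"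
    proof (rule sum.cong)
      fix s assume "s \<in> {1..M}"
      then have "A' s = {\<beta>\<in>U. \<beta> \<in> A' s}" by (auto simp: U_def)
      then have "card (A' s) = (\<Sum>\<beta>\<in>U. if \<beta> \<in> A' s then 1 else 0)" using card_filter[OF finU] by metis
      then show "k * card (A' s) = (\<Sum>\<beta>\<in>U. if \<beta> \<in> A' s then k else 0)"
        by (simp add: sum_distrib_left if_distrib cong: if_cong)
    qed simp
    also have "\<dots> = (\<Sum>\<beta>\<in>U. k * card {s\<in>{1..M}. \<beta> \<in> A' s})"
      unfolding card_filter[OF finite_atLeastAtMost] sum_distrib_left
      by (subst sum.swap) (simp add: if_distrib cong: if_cong)
    also have "\<dots> \<le> (\<Sum>\<beta>\<in>U. card (H \<beta>))"
    proof (rule sum_mono)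
      fix \<beta> assume "\<beta> \<in> U"
      let ?S = "{s\<in>{1..M}. \<beta> \<in> A' s}"
      have "finite ?S" "?S \<noteq> {}" using \<open>\<beta> \<in> U\<close> by (auto simp: U_def)
      then have m: "Max ?S \<in> ?S" by (rule Max_in)
      have "?S \<subseteq> {1..Max ?S}" using \<open>finite ?S\<close> by auto
      then have "card ?S \<le> Max ?S" using card_mono[of "{1..Max ?S}" ?S] by simp
      then have "k * card ?S \<le> k * Max ?S" by simp
      also have "\<dots> \<le> card (H \<beta>)" using m by (intro H) auto
      finally show "k * card ?S \<le> card (H \<beta>)" .
    qed
    also have "\<dots> = card (Sigma U H)" using finU finH by (simp add: card_SigmaI)
    also have "\<dots> \<le> card A"
    proof (rule card_inj_on_le[OF _ _ finA])
      show "inj_on (\<lambda>(\<beta>, c). \<beta>(d := c)) (Sigma U H)"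
        by (rule inj_on_subset[OF inj_on_upd_cube[of d UNIV]]) (auto simp: U_def A'0)
      show "(\<lambda>(\<beta>, c). \<beta>(d := c)) ` Sigma U H \<subseteq> A" by (auto simp: H_def)
    qed
    finally show ?thesis .
  qed
  moreover have "k ^ Suc d * card (L s) \<le> k * card (A' s) + k ^ Suc d * (d * (M + 1) ^ (d - 1))" for s
  proof -
    have "L s \<subseteq> cube d M" using T'_cube by (auto simp: L_def)
    from mult_le_mono2[OF Suc.IH[OF this], of k] show ?thesis by (simp add: A'_def algebra_simps)
  qed
  then have "(\<Sum>s\<in>{1..M}. k ^ Suc d * card (L s)) \<le> (\<Sum>s\<in>{1..M}. k * card (A' s)) + M * (k ^ Suc d * (d * (M + 1) ^ (d - 1)))"
    using sum_mono[of "{1..M}" "\<lambda>s. k ^ Suc d * card (L s)" "\<lambda>s. k * card (A' s) + k ^ Suc d * (d * (M + 1) ^ (d - 1))"]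
    by (simp add: sum.distrib)
  moreover have "M * (d * (M + 1) ^ (d - 1)) \<le> d * (M + 1) ^ d" by (cases d) (auto simp: algebra_simps)
  then have "M * (k ^ Suc d * (d * (M + 1) ^ (d - 1))) \<le> k ^ Suc d * (d * (M + 1) ^ d)"
    using mult_le_mono2[of _ _ "k ^ Suc d"] by (metis mult.left_commute)
  ultimately have "k ^ Suc d * (\<Sum>s\<in>{1..M}. card (L s)) \<le> card A + k ^ Suc d * (d * (M + 1) ^ d)"
    by (simp only: sum_distrib_left)
  moreover have "k ^ Suc d * card T \<le> k ^ Suc d * (M + 1) ^ d + k ^ Suc d * (\<Sum>s\<in>{1..M}. card (L s))"
    using mult_le_mono2[OF card_T, of "k ^ Suc d"] by (simp add: distrib_left)
  ultimately show ?case by (simp add: A_def algebra_simps)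
qed

section \<open>The measure of a filtration\<close>

text \<open>The classical smooth functions that vanish on the negative half-line, with a polynomial factor so
that the family is closed under differentiation.\<close>
definition flat_exp :: "real poly \<Rightarrow> real \<Rightarrow> real" where
  "flat_exp p x = (if x > 0 then poly p (inverse x) * exp (- inverse x) else 0)"

lemma poly_times_exp_tendsto_0: "((\<lambda>y. poly p y * exp (- y)) \<longlongrightarrow> (0::real)) at_top"
proof -
  have "((\<lambda>y::real. \<Sum>i\<le>degree p. coeff p i * (y ^ i / exp y)) \<longlongrightarrow> (\<Sum>i\<le>degree p. coeff p i * 0)) at_top"
    by (intro tendsto_intros tendsto_power_div_exp_0)
  moreover have "(\<lambda>y::real. \<Sum>i\<le>degree p. coeff p i * (y ^ i / exp y)) = (\<lambda>y. poly p y * exp (- y))"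
    by (simp add: poly_altdef sum_distrib_right exp_minus divide_inverse mult.assoc)
  ultimately show ?thesis by simp
qed

lemma flat_exp_has_derivative:
  "(flat_exp p has_field_derivative flat_exp ([:0, 0, 1:] * (p - pderiv p)) x) (at x)"
proof -
  consider "x > 0" | "x < 0" | "x = 0" by linarith
  then show ?thesis
  proof cases
    case 1
    have "((\<lambda>x. poly p (inverse x) * exp (- inverse x)) has_field_derivative
        flat_exp ([:0, 0, 1:] * (p - pderiv p)) x) (at x)"
      using 1 by (auto intro!: derivative_eq_intros DERIV_chain2[OF poly_DERIV] simp: flat_exp_def power2_eq_square field_simps)
    moreover have "\<forall>\<^sub>F y in nhds x. flat_exp p y = poly p (inverse y) * exp (- inverse y)"
      using eventually_nhds_in_open[of "{0<..}" x] 1 by (auto simp: flat_exp_def elim!: eventually_mono)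
    ultimately show ?thesis by (subst DERIV_cong_ev[OF refl _ refl])
  next
    case 2
    have "((\<lambda>x. 0) has_field_derivative flat_exp ([:0, 0, 1:] * (p - pderiv p)) x) (at x)"
      using 2 by (auto simp: flat_exp_def)
    moreover have "\<forall>\<^sub>F y in nhds x. flat_exp p y = 0"
      using eventually_nhds_in_open[of "{..<0}" x] 2 by (auto simp: flat_exp_def elim!: eventually_mono)
    ultimately show ?thesis by (subst DERIV_cong_ev[OF refl _ refl])
  next
    case 3
    have "((\<lambda>h. flat_exp p h / h) \<longlongrightarrow> 0) (at_right 0)"
    proof -
      have "((\<lambda>h. poly (pCons 0 p) (inverse h) * exp (- inverse h)) \<longlongrightarrow> (0::real)) (at_right 0)"
        by (rule filterlim_compose[OF poly_times_exp_tendsto_0 filterlim_inverse_at_top_right])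
      moreover have "\<forall>\<^sub>F h in at_right 0. poly (pCons 0 p) (inverse h) * exp (- inverse h) = flat_exp p h / h"
        by (auto simp: flat_exp_def eventually_at_filter divide_inverse)
      ultimately show ?thesis by (rule Lim_transform_eventually)
    qed
    moreover have "((\<lambda>h. flat_exp p h / h) \<longlongrightarrow> 0) (at_left 0)"
      by (rule tendsto_eventually) (auto simp: flat_exp_def eventually_at_filter)
    ultimately have "((\<lambda>h. flat_exp p h / h) \<longlongrightarrow> 0) (at 0)" by (simp add: filterlim_split_at)
    then show ?thesis using 3 by (simp add: DERIV_def flat_exp_def)
  qed
qed

text \<open>For \<open>c > 0\<close> these are smooth functions supported in the interval from \<open>a\<close> to \<open>b\<close>. Products alone are not closed under
differentiation, so the set contains their linear combinations; closure gives smoothness of all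
members at once.\<close>
inductive_set cutoffs :: "real \<Rightarrow> real \<Rightarrow> real \<Rightarrow> (real \<Rightarrow> real) set" for c a b where
  base: "(\<lambda>x. flat_exp p (c * (x - a)) * flat_exp q (c * (b - x))) \<in> cutoffs c a b"
| add: "f \<in> cutoffs c a b \<Longrightarrow> g \<in> cutoffs c a b \<Longrightarrow> (\<lambda>x. f x + g x) \<in> cutoffs c a b"
| scale: "f \<in> cutoffs c a b \<Longrightarrow> (\<lambda>x. k * f x) \<in> cutoffs c a b"

lemma cutoffs_derivative:
  "f \<in> cutoffs c a b \<Longrightarrow> \<exists>f'\<in>cutoffs c a b. \<forall>x. (f has_field_derivative f' x) (at x)"
proof (induction rule: cutoffs.induct)
  case (base p q)
  let ?D = "\<lambda>p. [:0, 0, 1:] * (p - pderiv p)"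
  let ?f' = "\<lambda>x. c * (flat_exp (?D p) (c * (x - a)) * flat_exp q (c * (b - x)))
     + (- c) * (flat_exp p (c * (x - a)) * flat_exp (?D q) (c * (b - x)))"
  have "?f' \<in> cutoffs c a b" by (intro cutoffs.intros)
  moreover have "((\<lambda>x. flat_exp p (c * (x - a)) * flat_exp q (c * (b - x))) has_field_derivative ?f' x) (at x)" for x
    by (rule derivative_eq_intros DERIV_chain2[OF flat_exp_has_derivative] refl)+ (simp add: algebra_simps)
  ultimately show ?case by (intro bexI[of _ ?f']) simp_all
next
  case (add f g)
  then obtain f' g' where "f' \<in> cutoffs c a b" "g' \<in> cutoffs c a b"
    "\<forall>x. (f has_field_derivative f' x) (at x)" "\<forall>x. (g has_field_derivative g' x) (at x)" by blast
  then show ?case by (intro bexI[of _ "\<lambda>x. f' x + g' x"]) (auto intro: cutoffs.intros DERIV_add)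
next
  case (scale f k)
  then obtain f' where "f' \<in> cutoffs c a b" "\<forall>x. (f has_field_derivative f' x) (at x)" by blast
  then show ?case by (intro bexI[of _ "\<lambda>x. k * f' x"]) (auto intro: cutoffs.intros DERIV_cmult)
qed

lemma cutoffs_vanish: "f \<in> cutoffs c a b \<Longrightarrow> c > 0 \<Longrightarrow> x \<notin> {a..b} \<Longrightarrow> f x = 0"
  by (induction rule: cutoffs.induct) (auto simp: flat_exp_def zero_less_mult_iff)

lemma test_function_cutoff:
  assumes "f \<in> cutoffs c a b" "c > 0"
  shows "test_function f"
proof -
  have "(deriv ^^ k) f \<in> cutoffs c a b" for k
  proof (induction k)
    case (Suc k)
    obtain f' where f': "f' \<in> cutoffs c a b" "\<forall>x. ((deriv ^^ k) f has_field_derivative f' x) (at x)"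
      using cutoffs_derivative[OF Suc.IH] by blast
    then have "deriv ((deriv ^^ k) f) = f'" using DERIV_imp_deriv by blast
    then show ?case using f' by simp
  qed (use assms in simp)
  then have "(deriv ^^ k) f differentiable at x" for k x
    using cutoffs_derivative[of "(deriv ^^ k) f" c a b] unfolding real_differentiable_def by metis
  moreover have "{x. f x \<noteq> 0} \<subseteq> {a..b}" using cutoffs_vanish[OF assms] by blast
  then have "closure {x. f x \<noteq> 0} \<subseteq> {a..b}" by (rule closure_minimal) simp
  then have "bounded (closure {x. f x \<noteq> 0})" by (rule bounded_subset[OF bounded_closed_interval])
  then have "compactly_supported f" by (simp add: compactly_supported_def compact_eq_bounded_closed)
  ultimately show ?thesis by (simp add: test_function_def)
qed

text \<open>The cutoffs \<open>flat_exp 1 (c * (x - a)) * flat_exp 1 (c * (b - x))\<close> converge boundedly to the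
indicator of the open interval between \<open>a\<close> and \<open>b\<close> as \<open>c\<close> grows. So the test functions determine the
measures of intervals, and hence the distribution function.\<close>
lemma test_functions_determine_distribution:
  assumes M: "real_distribution M" and N: "real_distribution N"
    and eq: "\<And>\<phi>. test_function \<phi> \<Longrightarrow> (LINT x|M. \<phi> x) = (LINT x|N. \<phi> x)"
  shows "M = N"
proof -
  define \<phi> where "\<phi> a b n = (\<lambda>x. flat_exp 1 (real (Suc n) * (x - a)) * flat_exp 1 (real (Suc n) * (b - x)))" for a b n
  have test: "test_function (\<phi> a b n)" for a b n
    unfolding \<phi>_def by (rule test_function_cutoff[of _ "real (Suc n)" a b]) (auto intro: cutoffs.base)
  have lim1: "(\<lambda>n. flat_exp 1 (real (Suc n) * y)) \<longlonglongrightarrow> indicator {0<..} y" for y :: real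
  proof (cases "y > 0")
    case True
    have "(\<lambda>n. exp (- (inverse (real (Suc n)) * inverse y))) \<longlonglongrightarrow> exp (- (0 * inverse y))"
      by (intro tendsto_intros LIMSEQ_inverse_real_of_nat)
    then show ?thesis using True by (simp add: flat_exp_def)
  qed (simp add: flat_exp_def zero_less_mult_iff)
  have lim: "(\<lambda>n. \<phi> a b n x) \<longlonglongrightarrow> indicator {a<..<b} x" for a b x
  proof -
    have "(\<lambda>n. \<phi> a b n x) \<longlonglongrightarrow> indicator {0<..} (x - a) * indicator {0<..} (b - x)"
      unfolding \<phi>_def by (intro tendsto_mult lim1)
    moreover have "indicator {0<..} (x - a) * indicator {0<..} (b - x) = (indicator {a<..<b} x :: real)"
      by (auto simp: indicator_def)
    ultimately show ?thesis by simp
  qed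
  have cont: "continuous_on UNIV (flat_exp 1)"
    using flat_exp_has_derivative DERIV_isCont by (blast intro: continuous_at_imp_continuous_on)
  have bound: "norm (\<phi> a b n x) \<le> 1" for a b n x
  proof -
    have fl: "0 \<le> flat_exp 1 y" "flat_exp 1 y \<le> 1" for y by (auto simp: flat_exp_def)
    show ?thesis unfolding \<phi>_def using fl by (simp add: abs_mult mult_le_one)
  qed
  have interval: "(\<lambda>n. LINT x|P. \<phi> a b n x) \<longlonglongrightarrow> measure P {a<..<b}" if P: "real_distribution P" for P a b
  proof -
    interpret P: real_distribution P by (rule P)
    have [measurable]: "flat_exp 1 \<in> borel_measurable borel" using cont by (rule borel_measurable_continuous_onI)
    have [measurable]: "\<phi> a b n \<in> borel_measurable borel" for n
      unfolding \<phi>_def by measurable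
    have "(\<lambda>n. LINT x|P. \<phi> a b n x) \<longlonglongrightarrow> (LINT x|P. indicator {a<..<b} x)"
      by (rule integral_dominated_convergence[where w = "\<lambda>_. 1"]) (use lim bound in auto)
    then show ?thesis by simp
  qed
  have "(\<lambda>n. LINT x|M. \<phi> a b n x) \<longlonglongrightarrow> measure N {a<..<b}" for a b
    using interval[OF N] by (simp add: eq[OF test])
  then have same: "measure M {a<..<b} = measure N {a<..<b}" for a b
    using LIMSEQ_unique interval[OF M] by blast
  have ray: "(\<lambda>n. measure P {x<..<x + real n}) \<longlonglongrightarrow> measure P {x<..}" if P: "real_distribution P" for P x
  proof -
    interpret P: real_distribution P by (rule P)
    have "(\<lambda>n. measure P {x<..<x + real n}) \<longlonglongrightarrow> measure P (\<Union>n. {x<..<x + real n})"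
      by (rule P.finite_Lim_measure_incseq) (auto simp: incseq_def)
    moreover have "(\<Union>n. {x<..<x + real n}) = {x<..}"
    proof (intro equalityI subsetI)
      fix y assume "y \<in> {x<..}"
      then show "y \<in> (\<Union>n. {x<..<x + real n})" using reals_Archimedean2[of "y - x"] by (auto simp: algebra_simps)
    qed auto
    ultimately show ?thesis by simp
  qed
  have "(\<lambda>n. measure M {x<..<x + real n}) \<longlonglongrightarrow> measure N {x<..}" for x
    using ray[OF N] by (simp add: same)
  then have "measure M {x<..} = measure N {x<..}" for x
    using LIMSEQ_unique ray[OF M] by blast
  moreover have cdf: "cdf P x = 1 - measure P {x<..}" if P: "real_distribution P" for P x
  proof -
    interpret P: real_distribution P by (rule P)
    have "{x<..} = space P - {..x}" by auto
    then have "measure P {x<..} = 1 - measure P {..x}" using P.prob_compl[of "{..x}"] by simp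
    then show ?thesis by (simp add: cdf_def)
  qed
  ultimately have "cdf M = cdf N" by (intro ext) (simp only: cdf[OF M] cdf[OF N])
  then show ?thesis by (rule cdf_unique[OF M N])
qed

text \<open>The uniform measure on the points \<open>\<theta> 0, ..., \<theta> (r - 1)\<close>, counted with multiplicity.\<close>
definition jump_measure :: "nat \<Rightarrow> (nat \<Rightarrow> real) \<Rightarrow> real measure" where
  "jump_measure r \<theta> = distr (measure_pmf (pmf_of_set {..<r})) borel \<theta>"

lemma real_distribution_jump_measure: "real_distribution (jump_measure r \<theta>)"
proof -
  interpret prob_space "jump_measure r \<theta>" unfolding jump_measure_def
    by (rule measure_pmf.prob_space_distr) simp
  show ?thesis by standard (simp_all add: jump_measure_def)
qed

lemma integral_jump_measure:
  assumes "r > 0" "h \<in> borel_measurable borel"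
  shows "(LINT x|jump_measure r \<theta>. h x) = (\<Sum>i<r. h (\<theta> i)) / real r"
  using assms by (simp add: jump_measure_def integral_distr integral_pmf_of_set lessThan_empty_iff)

lemma measure_jump_measure:
  assumes "r > 0" "S \<in> sets borel"
  shows "measure (jump_measure r \<theta>) S = real (card {i\<in>{..<r}. \<theta> i \<in> S}) / real r"
proof -
  interpret real_distribution "jump_measure r \<theta>" by (rule real_distribution_jump_measure)
  have "measure (jump_measure r \<theta>) S = (LINT x|jump_measure r \<theta>. indicator S x)"
    using assms by simp
  also have "\<dots> = (\<Sum>i<r. indicator S (\<theta> i)) / real r"
    using assms by (intro integral_jump_measure) auto
  also have "(\<Sum>i<r. indicator S (\<theta> i)) = real (card {i\<in>{..<r}. \<theta> i \<in> S})"
    by (simp add: indicator_def sum.If_cases Int_def)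
  finally show ?thesis .
qed

text \<open>The fundamental theorem of calculus: the distributional derivative of minus the indicator of
\<open>{..a}\<close> is the unit mass at \<open>a\<close>.\<close>
lemma integral_deriv_lower_ray:
  assumes "test_function \<phi>"
  shows "integrable lborel (\<lambda>t. indicator {..a} t * deriv \<phi> t)"
    "(LINT t|lborel. indicator {..a} t * deriv \<phi> t) = \<phi> a"
proof -
  have d: "(deriv ^^ k) \<phi> differentiable at x" for k x using assms by (simp add: test_function_def)
  have D: "(\<phi> has_field_derivative deriv \<phi> x) (at x)" for x
    using d[of 0 x] DERIV_deriv_iff_real_differentiable by auto
  have cont: "isCont (deriv \<phi>) x" for x
    using d[of 1 x] differentiable_imp_continuous_within by auto
  have "bounded (closure {x. \<phi> x \<noteq> 0})"
    using assms by (simp add: test_function_def compactly_supported_def compact_imp_bounded)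
  then obtain R0 where "\<forall>x\<in>closure {x. \<phi> x \<noteq> 0}. norm x \<le> R0" by (auto simp: bounded_iff)
  then have R0: "\<bar>x\<bar> \<le> R0" if "\<phi> x \<noteq> 0" for x
    using that closure_subset[of "{x. \<phi> x \<noteq> 0}"] by (auto simp: subset_iff)
  define R where "R = max R0 \<bar>a\<bar> + 1"
  have "deriv \<phi> x = 0" if "x < - R0" for x
  proof -
    have "\<phi> y = 0" if "y < - R0" for y using R0[of y] that by fastforce
    then have "\<forall>\<^sub>F y in nhds x. \<phi> y = (\<lambda>_. 0) y"
      using eventually_nhds_in_open[of "{..<- R0}" x] that by (auto elim!: eventually_mono)
    then have "deriv \<phi> x = deriv (\<lambda>_. 0) x" by (intro deriv_cong_ev) auto
    then show ?thesis by simp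
  qed
  then have e: "indicator {..a} t * deriv \<phi> t = deriv \<phi> t * indicator {- R..a} t" for t
    by (auto simp: indicator_def R_def)
  have "- R \<le> a" by (auto simp: R_def)
  have "\<not> \<bar>- R\<bar> \<le> R0" unfolding R_def by linarith
  then have "\<phi> (- R) = 0" using R0[of "- R"] by metis
  then show "(LINT t|lborel. indicator {..a} t * deriv \<phi> t) = \<phi> a"
    unfolding e using integral_FTC_Icc_real[OF \<open>- R \<le> a\<close> D cont] by simp
  show "integrable lborel (\<lambda>t. indicator {..a} t * deriv \<phi> t)"
    unfolding e using borel_integrable_atLeastAtMost[of "- R" a "deriv \<phi>"] cont
    by (simp add: indicator_def if_distrib cong: if_cong)
qed

text \<open>Let \<open>\<theta> i\<close> be the supremum of the \<open>t\<close> with \<open>i < \<rho> t\<close>. Left continuity says that the supremum is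
attained, so \<open>i < \<rho> t\<close> is equivalent to \<open>t \<le> \<theta> i\<close>.\<close>
lemma rank_function_jumps:
  fixes \<rho> :: "real \<Rightarrow> nat"
  assumes anti: "\<And>s t. t \<le> s \<Longrightarrow> \<rho> s \<le> \<rho> t" and top: "\<forall>\<^sub>F t in at_top. \<rho> t = 0"
    and bot: "\<forall>\<^sub>F t in at_bot. \<rho> t = r" and left: "\<And>t. continuous (at_left t) (\<lambda>t. real (\<rho> t))"
  obtains \<theta> where "\<And>t. \<rho> t = card {i\<in>{..<r}. t \<le> \<theta> i}"
proof -
  obtain b where b: "\<And>t. t \<ge> b \<Longrightarrow> \<rho> t = 0" using top by (auto simp: eventually_at_top_linorder)
  obtain a where a: "\<And>t. t \<le> a \<Longrightarrow> \<rho> t = r" using bot by (auto simp: eventually_at_bot_linorder)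
  have le_r: "\<rho> t \<le> r" for t using anti[of "min a t" t] a[of "min a t"] by simp
  define S where "S i = {t. i < \<rho> t}" for i
  define \<theta> where "\<theta> i = Sup (S i)" for i
  have S: "i < \<rho> t \<longleftrightarrow> t \<le> \<theta> i" if "i < r" for i t
  proof
    have ne: "S i \<noteq> {}" using a[of a] that by (auto simp: S_def)
    have bdd: "bdd_above (S i)"
    proof (rule bdd_aboveI)
      fix t assume "t \<in> S i"
      then show "t \<le> b" using b[of t] by (force simp: S_def)
    qed
    show "t \<le> \<theta> i" if "i < \<rho> t" using that bdd unfolding \<theta>_def by (intro cSup_upper) (auto simp: S_def)
    assume t: "t \<le> \<theta> i"
    have "i < \<rho> s" if s: "s < \<theta> i" for s
    proof -
      obtain s' where "s' \<in> S i" "s < s'" using less_cSup_iff[OF ne bdd] s unfolding \<theta>_def by blast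
      then show ?thesis using anti[of s s'] by (auto simp: S_def)
    qed
    then have "real (Suc i) \<le> real (\<rho> s)" if "s < \<theta> i" for s using that by (meson Suc_le_eq of_nat_mono)
    then have "\<forall>\<^sub>F s in at_left (\<theta> i). real (Suc i) \<le> real (\<rho> s)"
      unfolding eventually_at_filter by (intro always_eventually) simp
    moreover have "((\<lambda>s. real (\<rho> s)) \<longlongrightarrow> real (\<rho> (\<theta> i))) (at_left (\<theta> i))"
      using left by (simp add: continuous_within)
    ultimately have "real (Suc i) \<le> real (\<rho> (\<theta> i))" by (intro tendsto_lowerbound) auto
    then show "i < \<rho> t" using anti[OF t] by simp
  qed
  have "\<rho> t = card {i\<in>{..<r}. t \<le> \<theta> i}" for t
  proof -
    have "i < r \<and> t \<le> \<theta> i \<longleftrightarrow> i < \<rho> t" for i using S[of i t] le_r[of t] by (cases "i < r") auto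
    then have "{i\<in>{..<r}. t \<le> \<theta> i} = {..<\<rho> t}" by auto
    then show ?thesis by simp
  qed
  then show thesis by (rule that)
qed

context vector_space
begin

lemma dim_zero_subspace: "dim {0} = 0"
  using dim_le_card[of "{0}" "{}"] by simp

lemma independent_card_le_fin_dim:
  assumes "fin_dim W" "independent X" "X \<subseteq> W"
  shows "finite X" "card X \<le> dim W"
proof -
  obtain S where S: "finite S" "span S = W" using assms by (auto simp: fin_dim_def)
  obtain Y where Y: "Y \<subseteq> W" "independent Y" "W \<subseteq> span Y" "card Y = dim W" using basis_exists by blast
  then have "finite Y" using independent_span_bound[OF S(1) Y(2)] S by blast
  then show "finite X" "card X \<le> dim W" using independent_span_bound[of Y X] assms Y by auto
qed

lemma fin_dim_basis:
  assumes "fin_dim W" "V \<subseteq> W"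
  obtains Y where "Y \<subseteq> V" "independent Y" "V \<subseteq> span Y" "card Y = dim V" "finite Y"
proof -
  obtain Y where Y: "Y \<subseteq> V" "independent Y" "V \<subseteq> span Y" "card Y = dim V" using basis_exists by blast
  then show thesis using that independent_card_le_fin_dim(1)[OF assms(1) Y(2)] assms by blast
qed

lemma fin_dim_dim_mono: "fin_dim W \<Longrightarrow> V \<subseteq> W \<Longrightarrow> dim V \<le> dim W"
  by (metis fin_dim_basis independent_card_le_fin_dim(2) subset_trans)

lemma fin_dim_subspace: 
  assumes "fin_dim W" "V \<subseteq> W" "subspace V" shows "fin_dim V"
  using fin_dim_basis[OF assms(1,2)] assms(3) by (metis fin_dim_def span_minimal subset_antisym)

lemma fin_dim_dim_eq_0: "fin_dim W \<Longrightarrow> subspace W \<Longrightarrow> dim W = 0 \<longleftrightarrow> W = {0}"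
proof
  assume W: "fin_dim W" "subspace W" "dim W = 0"
  obtain Y where "Y \<subseteq> W" "W \<subseteq> span Y" "card Y = dim W" "finite Y" using fin_dim_basis[OF W(1) order_refl] by metis
  then show "W = {0}" using W subspace_0 by fastforce
qed (simp add: dim_zero_subspace)

lemma R_filtration_simps:
  assumes "R_filtration W \<F>"
  shows "subspace (\<F> t)" "\<F> t \<subseteq> W" "t \<le> s \<Longrightarrow> \<F> s \<subseteq> \<F> t"
    "\<forall>\<^sub>F t in at_top. \<F> t = {0}" "\<forall>\<^sub>F t in at_bot. \<F> t = W"
    "continuous (at_left t) (\<lambda>t. real (dim (\<F> t)))"
  using assms by (auto simp: R_filtration_def)

text \<open>The rank function is the sum of the indicators of the rays \<open>{..\<theta> i}\<close>, so the uniform measure on the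
jumps is a distributional derivative of minus the normalised rank; uniqueness is
\<open>test_functions_determine_distribution\<close>.\<close>
lemma filt_measure_eq_jump_measure:
  assumes W: "fin_dim W" "subspace W" "W \<noteq> {0}" and \<F>: "R_filtration W \<F>"
  obtains \<theta> where "filt_measure W \<F> = jump_measure (dim W) \<theta>"
    "\<And>t. dim (\<F> t) = card {i\<in>{..<dim W}. t \<le> \<theta> i}"
proof -
  note F = R_filtration_simps[OF \<F>]
  have r: "dim W > 0" using fin_dim_dim_eq_0 W by blast
  obtain \<theta> where \<theta>: "\<And>t. dim (\<F> t) = card {i\<in>{..<dim W}. t \<le> \<theta> i}"
  proof (rule rank_function_jumps[of "\<lambda>t. dim (\<F> t)" "dim W"])
    show "dim (\<F> s) \<le> dim (\<F> t)" if ts: "t \<le> s" for s t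
      using fin_dim_dim_mono[OF fin_dim_subspace[OF W(1) F(2) F(1)] F(3)[OF ts]] .
    show "\<forall>\<^sub>F t in at_top. dim (\<F> t) = 0"
      using F(4) by (rule eventually_mono) (simp add: dim_zero_subspace)
    show "\<forall>\<^sub>F t in at_bot. dim (\<F> t) = dim W" using F(5) by (rule eventually_mono) simp
  qed (use F(6) in auto)
  let ?G = "\<lambda>t. - (real (dim (\<F> t)) / real (dim W))" and ?J = "jump_measure (dim W) \<theta>"
  have J: "is_distributional_derivative ?G ?J"
    unfolding is_distributional_derivative_def
  proof (intro allI impI)
    fix \<phi> assume \<phi>: "test_function \<phi>"
    have "(deriv ^^ 0) \<phi> differentiable at x" for x using \<phi> unfolding test_function_def by blast
    then have "continuous_on UNIV \<phi>"
      by (auto intro!: continuous_at_imp_continuous_on differentiable_imp_continuous_within)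
    then have m: "\<phi> \<in> borel_measurable borel" by (rule borel_measurable_continuous_onI)
    have "?G t * deriv \<phi> t = - ((\<Sum>i<dim W. indicator {..\<theta> i} t * deriv \<phi> t) / real (dim W))" for t
    proof -
      have "(\<Sum>i<dim W. indicator {..\<theta> i} t) = real (dim (\<F> t))"
        by (simp add: \<theta> indicator_def sum.If_cases Int_def)
      then show ?thesis by (simp flip: sum_distrib_right)
    qed
    then have "(LINT t|lborel. ?G t * deriv \<phi> t)
        = (LINT t|lborel. - ((\<Sum>i<dim W. indicator {..\<theta> i} t * deriv \<phi> t) / real (dim W)))"
      by presburger
    also have "\<dots> = - ((\<Sum>i<dim W. LINT t|lborel. indicator {..\<theta> i} t * deriv \<phi> t) / real (dim W))"
      by (subst integral_minus, subst integral_divide_zero, subst Bochner_Integration.integral_sum)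
        (rule integral_deriv_lower_ray(1)[OF \<phi>], rule refl)
    finally have "(LINT t|lborel. ?G t * deriv \<phi> t) = - ((\<Sum>i<dim W. LINT t|lborel. indicator {..\<theta> i} t * deriv \<phi> t) / real (dim W))" .
    then show "(LINT x|?J. \<phi> x) = - (LINT t|lborel. ?G t * deriv \<phi> t)"
      by (simp only: integral_jump_measure[OF r m] integral_deriv_lower_ray(2)[OF \<phi>] minus_minus)
  qed
  have "(THE M. real_distribution M \<and> is_distributional_derivative ?G M) = ?J"
  proof (rule the_equality)
    show "real_distribution ?J \<and> is_distributional_derivative ?G ?J"
      using real_distribution_jump_measure J by blast
    fix M assume M: "real_distribution M \<and> is_distributional_derivative ?G M"
    show "M = ?J"
    proof (rule test_functions_determine_distribution)
      show "(LINT x|M. \<phi> x) = (LINT x|?J. \<phi> x)" if "test_function \<phi>" for \<phi>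
        using J M that unfolding is_distributional_derivative_def by presburger
    qed (use M real_distribution_jump_measure in blast)+
  qed
  then have "filt_measure W \<F> = ?J" unfolding filt_measure_def using W(3) by presburger
  then show thesis using \<theta> by (rule that)
qed

lemma rescaled_filt_measure:
  assumes W: "fin_dim W" "subspace W" "W \<noteq> {0}" and \<F>: "R_filtration W \<F>" and c: "c > 0"
  shows "real_distribution (rescale_measure (1 / c) (filt_measure W \<F>))" (is "real_distribution ?M")
    and "measure (rescale_measure (1 / c) (filt_measure W \<F>)) {t..} = real (dim (\<F> (c * t))) / real (dim W)"
proof -
  obtain \<theta> where eq: "filt_measure W \<F> = jump_measure (dim W) \<theta>"
    and \<theta>: "\<And>t. dim (\<F> t) = card {i\<in>{..<dim W}. t \<le> \<theta> i}"
    using filt_measure_eq_jump_measure[OF W \<F>] by blast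
  have r: "dim W > 0" using fin_dim_dim_eq_0 W by blast
  interpret J: real_distribution "jump_measure (dim W) \<theta>" by (rule real_distribution_jump_measure)
  interpret prob_space ?M unfolding rescale_measure_def eq by (rule J.prob_space_distr) simp
  show "real_distribution ?M" by standard (simp_all add: rescale_measure_def)
  have "measure ?M {t..} = measure (jump_measure (dim W) \<theta>) ((\<lambda>x. 1 / c * x) -` {t..})"
    unfolding rescale_measure_def eq by (subst measure_distr) simp_all
  also have "(\<lambda>x. 1 / c * x) -` {t..} = {c * t..}" using c by (auto simp: field_simps)
  also have "measure (jump_measure (dim W) \<theta>) {c * t..} = real (dim (\<F> (c * t))) / real (dim W)"
    using measure_jump_measure[OF r] \<theta> by simp
  finally show "measure ?M {t..} = real (dim (\<F> (c * t))) / real (dim W)" .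
qed

end

section \<open>Algebraic dependence and growth of graded algebras\<close>

context vector_space
begin

lemma card_le_dim_of_independent_family:
  assumes fin: "finite I" and indep: "\<And>c. (\<Sum>i\<in>I. scale (c i) (g i)) = 0 \<Longrightarrow> \<forall>i\<in>I. c i = 0"
    and W: "fin_dim W" "g ` I \<subseteq> W"
  shows "card I \<le> dim W"
proof -
  have inj: "inj_on g I"
  proof (rule inj_onI, rule ccontr)
    fix i j assume ij: "i \<in> I" "j \<in> I" "g i = g j" "i \<noteq> j"
    let ?c = "\<lambda>l. if l = i then 1 else if l = j then -1 else 0"
    have "(\<Sum>l\<in>I. scale (?c l) (g l)) = (\<Sum>l\<in>{i, j}. scale (?c l) (g l))"
      using fin ij by (intro sum.mono_neutral_right) auto
    also have "\<dots> = 0" using ij by simp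
    finally show False using indep[of ?c] ij by auto
  qed
  have "independent (g ` I)"
  proof (rule independent_if_scalars_zero)
    fix c y assume s: "(\<Sum>y\<in>g ` I. scale (c y) y) = 0" and "y \<in> g ` I"
    then have "(\<Sum>i\<in>I. scale (c (g i)) (g i)) = 0" by (simp add: sum.reindex[OF inj])
    then show "c y = 0" using indep[of "\<lambda>i. c (g i)"] \<open>y \<in> g ` I\<close> by auto
  qed (use fin in simp)
  from independent_card_le_fin_dim(2)[OF W(1) this W(2)] show ?thesis by (simp add: card_image[OF inj])
qed

end

locale commutative_algebra = vector_space scale
  for scale :: "'k::field \<Rightarrow> 'b::comm_ring_1 \<Rightarrow> 'b" +
  assumes scale_mult: "scale r (u * w) = scale r u * w"
begin

lemma scale_mult_right: "scale k (u * w) = u * scale k w"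
  using scale_mult[of k w u] by (simp add: mult.commute)

lemma subspace_mult_vimage: "subspace Q \<Longrightarrow> subspace {u. u * w \<in> Q}"
  by (auto simp: subspace_def distrib_right simp flip: scale_mult)

lemma mult_span_subset:
  assumes Q: "subspace Q" and gen: "\<And>s t. s \<in> S \<Longrightarrow> t \<in> T \<Longrightarrow> s * t \<in> Q"
    and u: "u \<in> span S" and w: "w \<in> span T"
  shows "u * w \<in> Q"
proof -
  have "s * w \<in> Q" if "s \<in> S" for s
  proof -
    have "T \<subseteq> {w. w * s \<in> Q}" using gen[OF that] by (auto simp: mult.commute)
    then have "span T \<subseteq> {w. w * s \<in> Q}" using subspace_mult_vimage[OF Q] by (rule span_minimal)
    then show ?thesis using w by (auto simp: mult.commute)
  qed
  then have "S \<subseteq> {u. u * w \<in> Q}" by blast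
  then have "span S \<subseteq> {u. u * w \<in> Q}" using subspace_mult_vimage[OF Q] by (rule span_minimal)
  then show ?thesis using u by blast
qed

end

context integral_graded_algebra
begin

sublocale commutative_algebra scale by unfold_locales (rule scale_mult)

text \<open>The \<open>n\<close>-fold products of elements of \<open>S\<close>. Their span \<open>prods n S\<close> is the degree-\<open>n\<close> part of the algebra
generated by \<open>S\<close>, graded by the number of factors.\<close>
primrec nprods :: "'b set \<Rightarrow> nat \<Rightarrow> 'b set" where
  "nprods S 0 = {1}"
| "nprods S (Suc n) = {s * w |s w. s \<in> S \<and> w \<in> nprods S n}"

definition prods :: "nat \<Rightarrow> 'b set \<Rightarrow> 'b set" where "prods n S = span (nprods S n)"

lemma nprods_eq: "nprods S n = {\<Prod>i<n. z i |z. \<forall>i<n. z i \<in> S}"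
proof (induction n)
  case (Suc n)
  show ?case
  proof (intro equalityI subsetI)
    fix u assume "u \<in> nprods S (Suc n)"
    then obtain s z where "u = s * (\<Prod>i<n. z i)" "s \<in> S" "\<forall>i<n. z i \<in> S" using Suc by auto
    then have "u = (\<Prod>i<Suc n. (z(n := s)) i)" "\<forall>i<Suc n. (z(n := s)) i \<in> S" by (auto simp: less_Suc_eq)
    then show "u \<in> {\<Prod>i<Suc n. z i |z. \<forall>i<Suc n. z i \<in> S}" by blast
  next
    fix u assume "u \<in> {\<Prod>i<Suc n. z i |z. \<forall>i<Suc n. z i \<in> S}"
    then obtain z where "u = z n * (\<Prod>i<n. z i)" "\<forall>i<Suc n. z i \<in> S" by (auto simp: mult.commute)
    moreover from this have "z n \<in> S" "(\<Prod>i<n. z i) \<in> nprods S n" using Suc by auto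
    ultimately show "u \<in> nprods S (Suc n)" by auto
  qed
qed auto

lemma sym_image_eq_prods: "sym_image n p = prods n (B p)"
  by (simp add: sym_image_def prods_def nprods_eq)

lemma subspace_prods [simp]: "subspace (prods n S)" by (simp add: prods_def)

lemma nprods_mult: "u \<in> nprods S m \<Longrightarrow> w \<in> nprods S n \<Longrightarrow> u * w \<in> nprods S (m + n)"
proof (induction m arbitrary: u)
  case (Suc m)
  then obtain s v where "u = s * v" "s \<in> S" "v \<in> nprods S m" by auto
  then show ?case using Suc by (auto simp: mult.assoc)
qed auto

lemma prods_mult: "u \<in> prods m S \<Longrightarrow> w \<in> prods n S \<Longrightarrow> u * w \<in> prods (m + n) S"
  unfolding prods_def by (rule mult_span_subset) (auto intro: span_base nprods_mult)

lemma prods_base: "s \<in> S \<Longrightarrow> s \<in> prods 1 S"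
  unfolding prods_def by (rule span_base) auto

lemma one_in_prods: "1 \<in> prods 0 S" unfolding prods_def by (rule span_base) auto

lemma prods_power: "s \<in> S \<Longrightarrow> s ^ k \<in> prods k S"
proof (induction k)
  case (Suc k)
  then show ?case using prods_mult[OF prods_base[of s S], of "s ^ k" k] by simp
qed (simp add: one_in_prods)

lemma nprods_mono: "S \<subseteq> T \<Longrightarrow> nprods S n \<subseteq> nprods T n"
proof (induction n)
  case (Suc n)
  then have "nprods S n \<subseteq> nprods T n" by blast
  then show ?case using Suc.prems by auto
qed simp

lemma prods_mono: "S \<subseteq> T \<Longrightarrow> prods n S \<subseteq> prods n T"
  unfolding prods_def by (intro span_mono nprods_mono)

lemma prods_span: "prods n (span S) = prods n S"
proof
  have "nprods (span S) n \<subseteq> span (nprods S n)"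
  proof (induction n)
    case (Suc n)
    have "s * w \<in> span (nprods S (Suc n))" if s: "s \<in> span S" and w: "w \<in> nprods (span S) n" for s w
    proof (rule mult_span_subset[OF subspace_span _ s])
      show "w \<in> span (nprods S n)" using w Suc by blast
      show "s * t \<in> span (nprods S (Suc n))" if "s \<in> S" "t \<in> nprods S n" for s t
        by (rule span_base) (use that in auto)
    qed
    then show ?case by auto
  qed (simp add: span_base)
  then show "prods n (span S) \<subseteq> prods n S" unfolding prods_def by (intro span_minimal) auto
  show "prods n S \<subseteq> prods n (span S)" by (intro prods_mono) (auto intro: span_base)
qed

lemma fin_dim_prods: "finite S \<Longrightarrow> fin_dim (prods n S)"
proof -
  assume S: "finite S"
  have "finite (nprods S n)"
  proof (induction n)
    case (Suc n)
    have "nprods S (Suc n) = (\<lambda>(s, w). s * w) ` (S \<times> nprods S n)" by auto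
    then show ?case using Suc S by simp
  qed simp
  then show ?thesis unfolding fin_dim_def prods_def by blast
qed

text \<open>The homogeneous part of degree \<open>k - j\<close> that vanishes, instead of being truncated to degree \<open>0\<close>, when
\<open>j > k\<close>. It contains the coefficients of \<open>s ^ j\<close> in a homogeneous polynomial of total degree \<open>k\<close>.\<close>
definition gprods :: "nat \<Rightarrow> nat \<Rightarrow> 'b set \<Rightarrow> 'b set" where
  "gprods k j S = (if j \<le> k then prods (k - j) S else {0})"

lemma subspace_gprods [simp]: "subspace (gprods k j S)" by (simp add: gprods_def)

lemma gprods_mult: 
  assumes "u \<in> prods l S" "w \<in> gprods k j S" shows "u * w \<in> gprods (k + l) j S"
proof (cases "j \<le> k")
  case True
  then show ?thesis using prods_mult[OF assms(1), of w "k - j"] assms(2)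
    by (simp add: gprods_def add.commute[of l])
next
  case False
  then have "w = 0" using assms(2) by (simp add: gprods_def)
  then show ?thesis using subspace_0[OF subspace_gprods] by simp
qed

text \<open>Homogeneous expressions of total degree \<open>k\<close> that have degree less than \<open>M\<close> in \<open>s\<close>.\<close>
definition pols :: "nat \<Rightarrow> nat \<Rightarrow> 'b \<Rightarrow> 'b set \<Rightarrow> 'b set" where
  "pols k M s S = {\<Sum>j<M. c j * s ^ j |c. \<forall>j<M. c j \<in> gprods k j S}"

lemma polsI: "(\<And>j. j < M \<Longrightarrow> c j \<in> gprods k j S) \<Longrightarrow> z = (\<Sum>j<M. c j * s ^ j) \<Longrightarrow> z \<in> pols k M s S"
  unfolding pols_def by blast

lemma polsE:
  assumes "z \<in> pols k M s S"
  obtains c where "\<And>j. j < M \<Longrightarrow> c j \<in> gprods k j S" "z = (\<Sum>j<M. c j * s ^ j)"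
  using assms unfolding pols_def by blast

lemma subspace_pols: "subspace (pols k M s S)"
  unfolding subspace_def
proof (intro conjI ballI allI)
  show "0 \<in> pols k M s S" by (rule polsI[of _ "\<lambda>_. 0"]) (auto intro: subspace_0)
  fix u assume "u \<in> pols k M s S"
  then obtain c where c: "\<And>j. j < M \<Longrightarrow> c j \<in> gprods k j S" "u = (\<Sum>j<M. c j * s ^ j)" by (rule polsE) blast
  show "scale r u \<in> pols k M s S" for r
    by (rule polsI[of _ "\<lambda>j. scale r (c j)"]) (use c in \<open>auto intro: subspace_scale simp: scale_sum_right scale_mult\<close>)
  fix w assume "w \<in> pols k M s S"
  then obtain c' where c': "\<And>j. j < M \<Longrightarrow> c' j \<in> gprods k j S" "w = (\<Sum>j<M. c' j * s ^ j)" by (rule polsE) blast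
  show "u + w \<in> pols k M s S"
    by (rule polsI[of _ "\<lambda>j. c j + c' j"]) (use c c' in \<open>auto intro: subspace_add simp: sum.distrib distrib_right\<close>)
qed

lemma pols_mult:
  assumes "u \<in> prods l S" "z \<in> pols k M s S" shows "u * z \<in> pols (k + l) M s S"
proof -
  obtain c where c: "\<And>j. j < M \<Longrightarrow> c j \<in> gprods k j S" "z = (\<Sum>j<M. c j * s ^ j)" using assms(2) by (rule polsE) blast
  show ?thesis
    by (rule polsI[of _ "\<lambda>j. u * c j"]) (use c gprods_mult[OF assms(1)] in \<open>auto simp: sum_distrib_left mult.assoc\<close>)
qed

lemma pols_shift:
  assumes "z \<in> pols k M s S" shows "s * z \<in> pols (Suc k) (Suc M) s S"
proof -
  obtain c where c: "\<And>j. j < M \<Longrightarrow> c j \<in> gprods k j S" "z = (\<Sum>j<M. c j * s ^ j)" using assms by (rule polsE) blast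
  show ?thesis
  proof (rule polsI[of _ "\<lambda>j. case j of 0 \<Rightarrow> 0 | Suc i \<Rightarrow> c i"])
    show "(case j of 0 \<Rightarrow> 0 | Suc i \<Rightarrow> c i) \<in> gprods (Suc k) j S" if "j < Suc M" for j
    proof (cases j)
      case 0
      then show ?thesis by (simp add: subspace_0)
    next
      case (Suc i)
      then have "c i \<in> gprods k i S" using that c(1)[of i] by simp
      moreover have "gprods (Suc k) (Suc i) S = gprods k i S" by (simp add: gprods_def)
      ultimately show ?thesis by (simp add: Suc)
    qed
    show "s * z = (\<Sum>j<Suc M. (case j of 0 \<Rightarrow> 0 | Suc i \<Rightarrow> c i) * s ^ j)"
      by (subst sum.lessThan_Suc_shift) (simp add: c(2) sum_distrib_left mult_ac)
  qed
qed

lemma pols_widen: 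
  assumes "M \<le> M'" shows "pols k M s S \<subseteq> pols k M' s S"
proof
  fix z assume "z \<in> pols k M s S"
  then obtain c where c: "\<And>j. j < M \<Longrightarrow> c j \<in> gprods k j S" "z = (\<Sum>j<M. c j * s ^ j)" by (rule polsE) blast
  show "z \<in> pols k M' s S"
  proof (rule polsI[of _ "\<lambda>j. if j < M then c j else 0"])
    show "z = (\<Sum>j<M'. (if j < M then c j else 0) * s ^ j)"
      unfolding c(2) by (rule sum.mono_neutral_cong_left) (use assms in auto)
  qed (use c in \<open>auto intro: subspace_0\<close>)
qed

lemma one_in_pols: "0 < M \<Longrightarrow> 1 \<in> pols 0 M s S"
  by (rule subsetD[OF pols_widen[of 1]], simp) (rule polsI[of _ "\<lambda>_. 1"], auto simp: gprods_def one_in_prods)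

lemma prods_insert_subset: "prods n (insert s S) \<subseteq> pols n (Suc n) s S"
proof -
  have "nprods (insert s S) n \<subseteq> pols n (Suc n) s S"
  proof (induction n)
    case (Suc n)
    have "t * w \<in> pols (Suc n) (Suc (Suc n)) s S" if tw: "t \<in> insert s S" "w \<in> nprods (insert s S) n" for t w
    proof (cases "t = s")
      case True
      then show ?thesis using pols_shift[of w n "Suc n" s S] Suc tw(2) by auto
    next
      case False
      then have "t \<in> S" using tw(1) by simp
      moreover have "w \<in> pols n (Suc n) s S" using Suc tw(2) by (rule subsetD)
      ultimately have "t * w \<in> pols (n + 1) (Suc n) s S" by (intro pols_mult prods_base)
      then show ?thesis using pols_widen[of "Suc n" "Suc (Suc n)"] by auto
    qed
    then show ?case by auto
  qed (simp add: one_in_pols)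
  then show ?thesis unfolding prods_def by (intro span_minimal subspace_pols)
qed

text \<open>The element \<open>s\<close> satisfies a homogeneous algebraic equation over the algebra generated by \<open>S\<close>, with
leading coefficient \<open>c\<close>. Keeping track of the number of factors makes the equation compatible with
the growth of \<open>prods n S\<close>.\<close>
definition algebraic :: "'b \<Rightarrow> 'b set \<Rightarrow> bool" where
  "algebraic s S \<longleftrightarrow> (\<exists>m l c. c \<in> prods l S \<and> c \<noteq> 0 \<and> c * s ^ m \<in> pols (l + m) m s S)"

lemma algebraic_mono: 
  assumes "algebraic s S" "S \<subseteq> T" shows "algebraic s T"
proof -
  have "gprods k j S \<subseteq> gprods k j T" for k j using prods_mono[OF assms(2)] by (auto simp: gprods_def)
  then have "pols k M s S \<subseteq> pols k M s T" for k M unfolding pols_def by blast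
  then show ?thesis using assms prods_mono unfolding algebraic_def by (meson subsetD)
qed

text \<open>A vanishing combination with nonzero coefficients would, solved for its top power of \<open>s\<close>, be an
algebraic equation.\<close>
lemma not_algebraic_coeffs_zero:
  assumes alg: "\<not> algebraic s S" and c: "\<And>j. j \<le> n \<Longrightarrow> c j \<in> prods (n - j) S"
    and sum: "(\<Sum>j\<le>n. c j * s ^ j) = 0" and j: "j \<le> n"
  shows "c j = 0"
proof (rule ccontr)
  assume "c j \<noteq> 0"
  define m where "m = Max {i. i \<le> n \<and> c i \<noteq> 0}"
  have "m \<in> {i. i \<le> n \<and> c i \<noteq> 0}" unfolding m_def using j \<open>c j \<noteq> 0\<close> by (intro Max_in) auto
  then have m: "m \<le> n" "c m \<noteq> 0" by auto
  have zero: "c i = 0" if "m < i" "i \<le> n" for i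
    using Max_ge[of "{i. i \<le> n \<and> c i \<noteq> 0}" i] that unfolding m_def[symmetric] by fastforce
  have "(\<Sum>j\<le>n. c j * s ^ j) = (\<Sum>j<Suc m. c j * s ^ j)"
    using m(1) zero by (intro sum.mono_neutral_right) auto
  then have "c m * s ^ m = - (\<Sum>j<m. c j * s ^ j)" using sum by (simp add: eq_neg_iff_add_eq_0 add.commute)
  moreover have "(\<Sum>j<m. c j * s ^ j) \<in> pols (n - m + m) m s S"
    by (rule polsI[of _ c]) (use c m in \<open>auto simp: gprods_def\<close>)
  ultimately have "c m * s ^ m \<in> pols (n - m + m) m s S"
    using subspace_neg[OF subspace_pols] by metis
  then have "algebraic s S" unfolding algebraic_def using c[OF m(1)] m(2) by blast
  with alg show False ..
qed

text \<open>Multiplying by the leading coefficient \<open>c\<close> once for every factor \<open>s\<close> allows each power \<open>s ^ m\<close> to be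
replaced by lower powers, so the degree in \<open>s\<close> stays below the fixed bound \<open>m\<close>.\<close>
lemma prods_insert_algebraic:
  assumes alg: "algebraic s S"
  obtains m l c where "c \<noteq> 0" "\<And>n z. z \<in> prods n (insert s S) \<Longrightarrow> c ^ n * z \<in> pols (n * (l + 1)) m s S"
proof -
  obtain m l c where c: "c \<in> prods l S" "c \<noteq> 0" "c * s ^ m \<in> pols (l + m) m s S"
    using alg by (auto simp: algebraic_def)
  have "m \<noteq> 0"
  proof
    assume "m = 0"
    then have "c = 0" using c(3) by (auto elim: polsE)
    with c(2) show False ..
  qed
  then obtain m' where m': "m = Suc m'" using not0_implies_Suc by blast
  have step: "c * s * z \<in> pols (k + (l + 1)) m s S" if z: "z \<in> pols k m s S" for z k
  proof -
    obtain b where b: "\<And>j. j < m \<Longrightarrow> b j \<in> gprods k j S" "z = (\<Sum>j<m. b j * s ^ j)" using z by (rule polsE) blast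
    define z' where "z' = (\<Sum>j<m'. b j * s ^ j)"
    have z': "z' \<in> pols k m' s S" unfolding z'_def by (rule polsI[of _ b]) (use b m' in auto)
    have "c * s * z = s * (c * z') + b m' * (c * s ^ m)" by (simp add: b(2) z'_def m' algebra_simps)
    moreover have "s * (c * z') \<in> pols (k + (l + 1)) m s S"
      using pols_shift[OF pols_mult[OF c(1) z']] by (simp add: m')
    moreover have "b m' * (c * s ^ m) \<in> pols (k + (l + 1)) m s S"
    proof (cases "m' \<le> k")
      case True
      then have "b m' \<in> prods (k - m') S" using b(1)[of m'] by (simp add: m' gprods_def)
      from pols_mult[OF this c(3)] show ?thesis using True by (simp add: m' add.commute add.left_commute)
    next
      case False
      then have "b m' = 0" using b(1)[of m'] by (simp add: m' gprods_def)
      then show ?thesis by (simp add: subspace_0 subspace_pols)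
    qed
    ultimately show ?thesis using subspace_add[OF subspace_pols] by metis
  qed
  have mon: "c ^ n * z \<in> pols (n * (l + 1)) m s S" if "z \<in> nprods (insert s S) n" for n z
    using that
  proof (induction n arbitrary: z)
    case 0
    then show ?case using one_in_pols[of m s S] m' by simp
  next
    case (Suc n)
    then obtain t w where tw: "z = t * w" "t \<in> insert s S" "w \<in> nprods (insert s S) n" by auto
    have "c * t * (c ^ n * w) \<in> pols (n * (l + 1) + (l + 1)) m s S"
    proof (cases "t = s")
      case True
      then show ?thesis using step[OF Suc.IH[OF tw(3)]] by simp
    next
      case False
      then have "t \<in> S" using tw(2) by simp
      from pols_mult[OF prods_mult[OF c(1) prods_base[OF this]] Suc.IH[OF tw(3)]] show ?thesis .
    qed
    then show ?case by (simp add: tw(1) algebra_simps)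
  qed
  have "c ^ n * z \<in> pols (n * (l + 1)) m s S" if "z \<in> prods n (insert s S)" for n z
  proof -
    have "nprods (insert s S) n \<subseteq> {z. z * c ^ n \<in> pols (n * (l + 1)) m s S}"
    proof
      fix w assume "w \<in> nprods (insert s S) n"
      then show "w \<in> {z. z * c ^ n \<in> pols (n * (l + 1)) m s S}"
        using mon[of w n] by (simp only: mem_Collect_eq mult.commute[of w])
    qed
    then have "prods n (insert s S) \<subseteq> {z. z * c ^ n \<in> pols (n * (l + 1)) m s S}"
      unfolding prods_def by (intro span_minimal subspace_mult_vimage subspace_pols)
    then have "z * c ^ n \<in> pols (n * (l + 1)) m s S" using that by blast
    then show ?thesis by (simp only: mult.commute[of z])
  qed
  then show thesis using that c(2) by blast
qed

text \<open>Multiplication by a nonzero element of a domain is injective.\<close>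
lemma dim_le_of_mult:
  assumes c: "c \<noteq> 0" and Q: "fin_dim Q" and Z: "\<And>z. z \<in> Z \<Longrightarrow> c * z \<in> Q"
  shows "dim Z \<le> dim Q"
proof -
  obtain X where X: "X \<subseteq> Z" "independent X" "Z \<subseteq> span X" "card X = dim Z" using basis_exists by blast
  show ?thesis
  proof (cases "finite X")
    case True
    have "card X \<le> dim Q"
    proof (rule card_le_dim_of_independent_family[OF True, of "\<lambda>z. c * z"])
      fix k assume "(\<Sum>z\<in>X. scale (k z) (c * z)) = 0"
      then have "c * (\<Sum>z\<in>X. scale (k z) z) = 0" by (simp add: sum_distrib_left scale_mult_right)
      then have "(\<Sum>z\<in>X. scale (k z) z) = 0" using c by simp
      then show "\<forall>z\<in>X. k z = 0" using independentD[OF X(2) True order_refl] by blast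
    qed (use Q Z X in auto)
    then show ?thesis using X by simp
  qed (use X in simp)
qed

lemma dim_pols_le:
  assumes S: "finite S"
  shows "fin_dim (pols k M s S)" "dim (pols k M s S) \<le> (\<Sum>j<M. dim (gprods k j S))"
proof -
  have "\<exists>Y. Y \<subseteq> gprods k j S \<and> gprods k j S \<subseteq> span Y \<and> card Y = dim (gprods k j S) \<and> finite Y" for j
  proof -
    have "fin_dim (gprods k j S)"
      using fin_dim_prods[OF S] by (auto simp: gprods_def fin_dim_def intro!: exI[of _ "{}"])
    then show ?thesis by (meson fin_dim_basis order_refl)
  qed
  then obtain Y where Y: "\<And>j. Y j \<subseteq> gprods k j S" "\<And>j. gprods k j S \<subseteq> span (Y j)"
    "\<And>j. card (Y j) = dim (gprods k j S)" "\<And>j. finite (Y j)" by metis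
  define G where "G = (\<Union>j<M. (\<lambda>y. y * s ^ j) ` Y j)"
  have fin: "finite G" using Y by (simp add: G_def)
  have sub: "pols k M s S \<subseteq> span G"
  proof
    fix z assume "z \<in> pols k M s S"
    then obtain c where c: "\<And>j. j < M \<Longrightarrow> c j \<in> gprods k j S" "z = (\<Sum>j<M. c j * s ^ j)" by (rule polsE) blast
    have "c j * s ^ j \<in> span G" if "j < M" for j
    proof -
      have "Y j \<subseteq> {y. y * s ^ j \<in> span G}" using that by (auto simp: G_def intro!: span_base)
      then have "span (Y j) \<subseteq> {y. y * s ^ j \<in> span G}" by (intro span_minimal subspace_mult_vimage) auto
      then show ?thesis using c(1)[OF that] Y(2) by blast
    qed
    then show "z \<in> span G" unfolding c(2) by (intro span_sum) auto
  qed
  have fd: "fin_dim (span G)" using fin by (auto simp: fin_dim_def)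
  show "fin_dim (pols k M s S)" using fin_dim_subspace[OF fd sub subspace_pols] .
  have "dim (pols k M s S) \<le> card G" using sub fin by (rule dim_le_card)
  also have "\<dots> \<le> (\<Sum>j<M. card ((\<lambda>y. y * s ^ j) ` Y j))" unfolding G_def by (rule card_UN_le) simp
  also have "\<dots> \<le> (\<Sum>j<M. dim (gprods k j S))" using Y by (intro sum_mono) (metis card_image_le)
  finally show "dim (pols k M s S) \<le> (\<Sum>j<M. dim (gprods k j S))" .
qed

definition growth :: "'b set \<Rightarrow> nat \<Rightarrow> bool" where
  "growth S d \<longleftrightarrow> (\<exists>C. \<forall>n. dim (prods n S) \<le> C * (n + 1) ^ d)"

lemma dim_pols_growth:
  assumes "finite S" "\<And>n. dim (prods n S) \<le> C * (n + 1) ^ d"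
  shows "dim (pols k M s S) \<le> M * (C * (k + 1) ^ d)"
proof -
  have "dim (gprods k j S) \<le> C * (k + 1) ^ d" for j
  proof (cases "j \<le> k")
    case True
    have "dim (prods (k - j) S) \<le> C * (k - j + 1) ^ d" by (rule assms)
    also have "\<dots> \<le> C * (k + 1) ^ d" by (intro mult_le_mono2 power_mono) auto
    finally show ?thesis using True by (simp add: gprods_def)
  qed (simp add: gprods_def dim_zero_subspace)
  then have "(\<Sum>j<M. dim (gprods k j S)) \<le> (\<Sum>j<M. C * (k + 1) ^ d)" by (intro sum_mono)
  then show ?thesis using dim_pols_le(2)[OF assms(1), of k M s] by simp
qed

text \<open>An element of \<open>prods n (insert s S)\<close> has at most \<open>n + 1\<close> coefficients in \<open>s\<close>, which costs one power
of \<open>n\<close>.\<close>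
lemma growth_insert:
  assumes S: "finite S" and g: "growth S d"
  shows "growth (insert s S) (Suc d)"
proof -
  obtain C where C: "\<And>n. dim (prods n S) \<le> C * (n + 1) ^ d" using g by (auto simp: growth_def)
  have "dim (prods n (insert s S)) \<le> C * (n + 1) ^ Suc d" for n
  proof -
    have "dim (prods n (insert s S)) \<le> dim (pols n (Suc n) s S)"
      by (rule fin_dim_dim_mono[OF dim_pols_le(1)[OF S] prods_insert_subset])
    also have "\<dots> \<le> Suc n * (C * (n + 1) ^ d)" by (rule dim_pols_growth[OF S C])
    finally show ?thesis by (simp add: algebra_simps)
  qed
  then show ?thesis unfolding growth_def by blast
qed

text \<open>Up to multiplication by \<open>c ^ n\<close> an element of \<open>prods n (insert s S)\<close> has only \<open>m\<close> coefficients, with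
\<open>m\<close> independent of \<open>n\<close>, so the exponent does not change.\<close>
lemma growth_insert_algebraic:
  assumes S: "finite S" and g: "growth S d" and alg: "algebraic s S"
  shows "growth (insert s S) d"
proof -
  obtain C where C: "\<And>n. dim (prods n S) \<le> C * (n + 1) ^ d" using g by (auto simp: growth_def)
  obtain m l c where c: "c \<noteq> 0" "\<And>n z. z \<in> prods n (insert s S) \<Longrightarrow> c ^ n * z \<in> pols (n * (l + 1)) m s S"
    by (rule prods_insert_algebraic[OF alg]) blast
  have "dim (prods n (insert s S)) \<le> (m * C * (l + 1) ^ d) * (n + 1) ^ d" for n
  proof -
    have "dim (prods n (insert s S)) \<le> dim (pols (n * (l + 1)) m s S)"
      using c by (intro dim_le_of_mult[of "c ^ n"] dim_pols_le(1)[OF S]) auto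
    also have "\<dots> \<le> m * (C * (n * (l + 1) + 1) ^ d)" by (rule dim_pols_growth[OF S C])
    also have "\<dots> \<le> m * (C * ((l + 1) * (n + 1)) ^ d)"
      by (intro mult_le_mono2 power_mono) (auto simp: algebra_simps)
    finally show ?thesis by (simp only: power_mult_distrib mult_ac)
  qed
  then show ?thesis unfolding growth_def by blast
qed

text \<open>Run through the generators and keep those that are not algebraic over the ones kept before; only
these increase the growth exponent. The first one does not, because the powers of a single element
span spaces of rank one; so \<open>d + 1\<close> elements belong to the exponent \<open>d\<close>.\<close>
lemma transcendence_basis:
  assumes "finite S" "S \<noteq> {}" "0 \<notin> S"
  shows "\<exists>x d. (\<forall>i\<le>d. x i \<in> S \<and> \<not> algebraic (x i) (x ` {..<i})) \<and> growth S d"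
  using assms
proof (induction S rule: finite_ne_induct)
  case (singleton s)
  have "nprods {s} n = {s ^ n}" for n by (induction n) auto
  then have "dim (prods n {s}) \<le> 1 * (n + 1) ^ 0" for n
    unfolding prods_def using dim_le_card[of "span {s ^ n}" "{s ^ n}"] by simp
  then have "growth {s} 0" unfolding growth_def by blast
  moreover have "\<not> algebraic s {}"
  proof
    assume "algebraic s {}"
    then obtain m l c where c: "c \<in> prods l {}" "c \<noteq> 0" "c * s ^ m \<in> pols (l + m) m s {}" by (auto simp: algebraic_def)
    have zero: "prods n {} = {0}" if "n > 0" for n using that by (cases n) (auto simp: prods_def)
    obtain b where b: "\<And>j. j < m \<Longrightarrow> b j \<in> gprods (l + m) j {}" "c * s ^ m = (\<Sum>j<m. b j * s ^ j)" using c(3) by (rule polsE) blast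
    have "b j = 0" if "j < m" for j using b(1)[OF that] that zero by (simp add: gprods_def)
    then have "c * s ^ m = 0" unfolding b(2) by simp
    then show False using c(2) singleton by simp
  qed
  ultimately show ?case by (intro exI[of _ "\<lambda>_. s"] exI[of _ 0]) simp
next
  case (insert s S)
  then obtain x d where x: "\<And>i. i \<le> d \<Longrightarrow> x i \<in> S \<and> \<not> algebraic (x i) (x ` {..<i})" and g: "growth S d" by auto
  show ?case
  proof (cases "algebraic s (x ` {..<Suc d})")
    case True
    have "x ` {..<Suc d} \<subseteq> S" using x by auto
    from growth_insert_algebraic[OF insert.hyps(1) g algebraic_mono[OF True this]]
    show ?thesis using x by blast
  next
    case False
    have "x(Suc d := s) ` {..<i} = x ` {..<i}" if "i \<le> Suc d" for i using that by auto
    then have "(x(Suc d := s)) i \<in> insert s S \<and> \<not> algebraic ((x(Suc d := s)) i) ((x(Suc d := s)) ` {..<i})"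
      if "i \<le> Suc d" for i using that x False by (cases "i = Suc d") auto
    then show ?thesis using growth_insert[OF insert.hyps(1) g] by blast
  qed
qed

lemma monomial_in_prods:
  fixes d :: nat
  shows "(\<Prod>i<d. x i ^ \<beta> i) \<in> prods (\<Sum>i<d. \<beta> i) (x ` {..<d})"
proof (induction d)
  case (Suc d)
  have "(\<Prod>i<d. x i ^ \<beta> i) \<in> prods (\<Sum>i<d. \<beta> i) (x ` {..<Suc d})"
    by (rule subsetD[OF prods_mono Suc]) auto
  from prods_mult[OF this prods_power[of "x d"]] show ?case by simp
qed (simp add: one_in_prods)

text \<open>Induction on the number of variables: collecting the terms according to the exponent of the last
variable gives a vanishing polynomial in that variable, whose coefficients are zero by
\<open>not_algebraic_coeffs_zero\<close>.\<close>
lemma monomials_independent: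
  fixes d :: nat and \<beta> :: "nat \<Rightarrow> nat"
  assumes "\<And>i. i < d \<Longrightarrow> \<not> algebraic (x i) (x ` {..<i})"
    and "finite A" "\<And>\<beta>. \<beta> \<in> A \<Longrightarrow> (\<Sum>i<d. \<beta> i) = D \<and> (\<forall>i\<ge>d. \<beta> i = 0)"
    and "(\<Sum>\<beta>\<in>A. scale (c \<beta>) (\<Prod>i<d. x i ^ \<beta> i)) = 0" and "\<beta> \<in> A"
  shows "c \<beta> = 0"
  using assms
proof (induction d arbitrary: A D c \<beta>)
  case 0
  have "\<gamma> = (\<lambda>_. 0)" if "\<gamma> \<in> A" for \<gamma> using 0(3)[OF that] by auto
  then have "A = {\<beta>}" using 0(5) by auto
  then show ?case using 0(4) by simp
next
  case (Suc d)
  define A' where "A' j = {\<beta> \<in> A. \<beta> d = j}" for j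
  define a where "a j = (\<Sum>\<beta>\<in>A' j. scale (c \<beta>) (\<Prod>i<d. x i ^ \<beta> i))" for j
  have fin: "finite (A' j)" for j using Suc.prems(2) by (simp add: A'_def)
  have deg: "(\<Sum>i<d. \<beta> i) = D - j \<and> j \<le> D" if "\<beta> \<in> A' j" for \<beta> j
    using Suc.prems(3)[of \<beta>] that by (auto simp: A'_def)
  have "a j = 0" if "j \<le> D" for j
  proof (rule not_algebraic_coeffs_zero[OF Suc.prems(1)[of d] _ _ that])
    show "a j \<in> prods (D - j) (x ` {..<d})" for j
      unfolding a_def
    proof (intro subspace_sum subspace_scale subspace_prods)
      fix \<beta> assume "\<beta> \<in> A' j"
      then have "(\<Sum>i<d. \<beta> i) = D - j" using deg by blast
      then show "(\<Prod>i<d. x i ^ \<beta> i) \<in> prods (D - j) (x ` {..<d})" using monomial_in_prods[of x \<beta> d] by simp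
    qed
    have "(\<Sum>j\<le>D. a j * x d ^ j) = (\<Sum>j\<le>D. \<Sum>\<beta>\<in>A' j. scale (c \<beta>) (\<Prod>i<Suc d. x i ^ \<beta> i))"
      unfolding a_def sum_distrib_right by (intro sum.cong refl) (simp add: scale_mult A'_def)
    also have "\<dots> = (\<Sum>\<beta>\<in>(\<Union>j\<le>D. A' j). scale (c \<beta>) (\<Prod>i<Suc d. x i ^ \<beta> i))"
      using fin by (intro sum.UNION_disjoint[symmetric]) (auto simp: A'_def)
    also have "(\<Union>j\<le>D. A' j) = A" using deg by (auto simp: A'_def)
    finally show "(\<Sum>j\<le>D. a j * x d ^ j) = 0" using Suc.prems(4) by simp
  qed simp
  moreover have \<beta>: "\<beta> \<in> A' (\<beta> d)" using Suc.prems by (simp add: A'_def)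
  ultimately have a0: "a (\<beta> d) = 0" using deg by blast
  let ?j = "\<beta> d" and ?\<pi> = "\<lambda>\<beta>. \<beta>(d := 0)"
  have inj: "inj_on ?\<pi> (A' ?j)"
  proof (rule inj_onI)
    fix \<gamma> \<delta> assume "\<gamma> \<in> A' ?j" "\<delta> \<in> A' ?j" and eq: "?\<pi> \<gamma> = ?\<pi> \<delta>"
    have "\<gamma> i = \<delta> i" for i using fun_cong[OF eq, of i] \<open>\<gamma> \<in> A' ?j\<close> \<open>\<delta> \<in> A' ?j\<close> by (cases "i = d") (auto simp: A'_def)
    then show "\<gamma> = \<delta>" by (rule ext)
  qed
  have sum0: "(\<Sum>\<gamma>\<in>?\<pi> ` A' ?j. scale (c (\<gamma>(d := ?j))) (\<Prod>i<d. x i ^ \<gamma> i)) = 0"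
  proof -
    have "(\<Sum>\<gamma>\<in>?\<pi> ` A' ?j. scale (c (\<gamma>(d := ?j))) (\<Prod>i<d. x i ^ \<gamma> i))
        = (\<Sum>\<gamma>\<in>A' ?j. scale (c \<gamma>) (\<Prod>i<d. x i ^ \<gamma> i))"
      unfolding sum.reindex[OF inj] by (rule sum.cong) (auto simp: A'_def fun_upd_idem)
    then show ?thesis using a0 by (simp add: a_def)
  qed
  have deg': "(\<Sum>i<d. \<gamma> i) = D - ?j \<and> (\<forall>i\<ge>d. \<gamma> i = 0)" if \<gamma>: "\<gamma> \<in> ?\<pi> ` A' ?j" for \<gamma>
  proof -
    obtain \<delta> where \<delta>: "\<delta> \<in> A' ?j" "\<gamma> = ?\<pi> \<delta>" using \<gamma> by blast
    then have "(\<Sum>i<d. \<gamma> i) = (\<Sum>i<d. \<delta> i)" by (intro sum.cong) auto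
    moreover have "\<delta> \<in> A" using \<delta> by (simp add: A'_def)
    then have "\<forall>i\<ge>d. \<gamma> i = 0" using Suc.prems(3)[of \<delta>] \<delta>(2) by auto
    ultimately show ?thesis using deg[OF \<delta>(1)] by simp
  qed
  have "c ((?\<pi> \<beta>)(d := ?j)) = 0"
    by (rule Suc.IH[where A = "?\<pi> ` A' ?j" and D = "D - ?j" and c = "\<lambda>\<gamma>. c (\<gamma>(d := ?j))", OF _ _ deg' sum0 imageI[OF \<beta>]])
      (use Suc.prems(1) fin in auto)
  then show ?case by (simp add: fun_upd_idem)
qed

end

section \<open>Valuations that separate monomials\<close>

text \<open>The valuation is only used through the preorder \<open>vle a b\<close>, to be read as: the value of \<open>a\<close> is at
most the value of \<open>b\<close>. The value group itself is never formed.\<close>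
locale valuation_ring =
  fixes V :: "'f::field set"
  assumes subring: "subring_set V" and total: "x \<in> V \<or> inverse x \<in> V"
begin

definition vle :: "'f \<Rightarrow> 'f \<Rightarrow> bool" where "vle a b \<longleftrightarrow> (\<exists>r\<in>V. b = a * r)"
definition veq :: "'f \<Rightarrow> 'f \<Rightarrow> bool" where "veq a b \<longleftrightarrow> vle a b \<and> vle b a"

lemma vle_refl [simp]: "vle a a"
  unfolding vle_def using subring_set_simps(2)[OF subring] by (intro bexI[of _ 1]) auto

lemma vle_trans: "vle a b \<Longrightarrow> vle b c \<Longrightarrow> vle a c"
  unfolding vle_def using subring_set_simps(6)[OF subring] by (metis mult.assoc)

lemma vle_0 [simp]: "vle a 0"
  unfolding vle_def using subring_set_simps(1)[OF subring] by (intro bexI[of _ 0]) auto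

lemma vle_0_left: "vle 0 a \<longleftrightarrow> a = 0"
  unfolding vle_def using subring_set_simps(1)[OF subring] by auto

lemma vle_linear: "vle a b \<or> vle b a"
proof (cases "a = 0 \<or> b = 0")
  case False
  show ?thesis
  proof (cases "b / a \<in> V")
    case True
    then show ?thesis using False unfolding vle_def by (intro disjI1 bexI[of _ "b / a"]) auto
  next
    case F: False
    then have "a / b \<in> V" using total[of "b / a"] by simp
    then show ?thesis using False unfolding vle_def by (intro disjI2 bexI[of _ "a / b"]) auto
  qed
qed auto

lemma vle_mult: "vle a b \<Longrightarrow> vle (c * a) (c * b)"
  unfolding vle_def by (auto simp: mult.assoc)

lemma vle_mult_cancel: "c \<noteq> 0 \<Longrightarrow> vle (c * a) (c * b) \<longleftrightarrow> vle a b"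
  using vle_mult[of a b c] vle_mult[of "c * a" "c * b" "inverse c"] by (auto simp: mult.assoc[symmetric])

lemma vle_add: "vle a b \<Longrightarrow> vle a c \<Longrightarrow> vle a (b + c)"
  unfolding vle_def using subring_set_simps(4)[OF subring] by (metis distrib_left)

lemma vle_uminus [simp]: "vle a (- b) \<longleftrightarrow> vle a b"
  unfolding vle_def using subring_set_simps(3)[OF subring]
  by (metis minus_minus mult_minus_right)

lemma vle_uminus_left [simp]: "vle (- a) b \<longleftrightarrow> vle a b"
proof -
  have "vle a (- a)" "vle (- a) a" using vle_uminus[of a a] vle_uminus[of "- a" a] by simp_all
  then show ?thesis using vle_trans by blast
qed

lemma vlt_add: 
  assumes "\<not> vle b a" "\<not> vle c a" shows "\<not> vle (b + c) a"
proof
  assume h: "vle (b + c) a"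
  have "vle b (b + c) \<or> vle c (b + c)" using vle_linear[of b c] by (auto intro: vle_add)
  then show False using h vle_trans assms by blast
qed

lemma vlt_sum: "a \<noteq> 0 \<Longrightarrow> (\<And>i. i \<in> I \<Longrightarrow> \<not> vle (g i) a) \<Longrightarrow> \<not> vle (sum g I) a"
proof (induction I rule: infinite_finite_induct)
  case (insert y F)
  then show ?case using vlt_add[of "g y" a "sum g F"] by simp
qed (auto simp: vle_0_left)

lemma veq_refl [simp]: "veq a a" by (simp add: veq_def)
lemma veq_sym: "veq a b \<Longrightarrow> veq b a" by (simp add: veq_def)
lemma veq_trans: "veq a b \<Longrightarrow> veq b c \<Longrightarrow> veq a c" by (auto simp: veq_def intro: vle_trans)
lemma veq_mult: "veq a b \<Longrightarrow> veq (c * a) (c * b)" by (auto simp: veq_def intro: vle_mult)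
lemma veq_mult_cancel: "c \<noteq> 0 \<Longrightarrow> veq (c * a) (c * b) \<longleftrightarrow> veq a b" by (auto simp: veq_def vle_mult_cancel)

lemma veq_mult2: "veq a b \<Longrightarrow> veq c d \<Longrightarrow> veq (a * c) (b * d)"
  using veq_mult[of a b c] veq_mult[of c d b] veq_trans by (metis mult.commute)

lemma veq_prod: "(\<And>i. i \<in> I \<Longrightarrow> veq (g i) (h i)) \<Longrightarrow> veq (prod g I) (prod h I)"
  by (induction I rule: infinite_finite_induct) (auto intro: veq_mult2)

text \<open>The term of least value cannot be cancelled by the others.\<close>
lemma sum_nonzero_of_distinct_values:
  assumes "finite I" "I \<noteq> {}" "\<And>i. i \<in> I \<Longrightarrow> g i \<noteq> 0"
    and "\<And>i j. i \<in> I \<Longrightarrow> j \<in> I \<Longrightarrow> veq (g i) (g j) \<Longrightarrow> i = j"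
  shows "sum g I \<noteq> 0"
proof -
  have "\<exists>i\<in>I. \<forall>j\<in>I. vle (g i) (g j)"
    using assms(1,2)
  proof (induction I rule: finite_ne_induct)
    case (insert x F)
    then obtain i where i: "i \<in> F" "\<forall>j\<in>F. vle (g i) (g j)" by blast
    show ?case
    proof (cases "vle (g x) (g i)")
      case True
      then show ?thesis using i vle_trans by (intro bexI[of _ x]) auto
    next
      case False
      then show ?thesis using i vle_linear by (intro bexI[of _ i]) auto
    qed
  qed auto
  then obtain i where i: "i \<in> I" "\<And>j. j \<in> I \<Longrightarrow> vle (g i) (g j)" by blast
  have "\<not> vle (g j) (g i)" if "j \<in> I - {i}" for j using that i assms(4)[of i j] by (auto simp: veq_def)
  then have "\<not> vle (sum g (I - {i})) (g i)" using assms(3)[OF i(1)] by (intro vlt_sum)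
  moreover have "sum g I = g i + sum g (I - {i})" using assms(1) i by (simp add: sum.remove)
  moreover have "vle (- g i) (g i)" using vle_uminus[of "- g i" "g i"] by simp
  ultimately show ?thesis by (metis add_eq_0_iff)
qed

end

text \<open>Think of \<open>\<rho> x\<close> as the coset and of \<open>\<alpha> x\<close> as the position in the coset of an element \<open>x\<close>. In every
coset keep the elements at the most frequent position. A coset with \<open>m\<close> positions loses at most a
factor of \<open>m\<close>, and \<open>r\<close> is a coset with the largest number of positions.\<close>
lemma uniform_selection:
  assumes "finite X" "X \<noteq> {}"
  obtains U r where "U \<subseteq> X" "r \<in> \<rho> ` X" "\<And>x y. x \<in> U \<Longrightarrow> y \<in> U \<Longrightarrow> \<rho> x = \<rho> y \<Longrightarrow> \<alpha> x = \<alpha> y"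
    "card X \<le> card U * card (\<alpha> ` {x\<in>X. \<rho> x = r})"
proof -
  define cell where "cell r = {x\<in>X. \<rho> x = r}" for r
  define fib where "fib r a = {x\<in>cell r. \<alpha> x = a}" for r a
  define best where "best r = (ARG_MAX (\<lambda>a. card (fib r a)) a. a \<in> \<alpha> ` cell r)" for r
  have fin: "finite (cell r)" "finite (fib r a)" for r a using assms by (auto simp: cell_def fib_def)
  have best: "card (fib r a) \<le> card (fib r (best r))" if "a \<in> \<alpha> ` cell r" for r a
  proof -
    have "finite ((\<lambda>a. card (fib r a)) ` (\<alpha> ` cell r))" using fin by blast
    then obtain m where "\<forall>a. a \<in> \<alpha> ` cell r \<longrightarrow> card (fib r a) \<le> m" by (auto simp: finite_nat_set_iff_bounded_le)
    then show ?thesis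
      unfolding best_def using that
      by (intro arg_max_nat_lemma[THEN conjunct2, rule_format, of "\<lambda>a. a \<in> \<alpha> ` cell r" a _ "Suc m"]) (auto simp: less_Suc_eq_le)
  qed
  define U where "U = (\<Union>r\<in>\<rho> ` X. fib r (best r))"
  define m where "m = Max ((\<lambda>r. card (\<alpha> ` cell r)) ` \<rho> ` X)"
  have "m \<in> (\<lambda>r. card (\<alpha> ` cell r)) ` \<rho> ` X" unfolding m_def using assms by (intro Max_in) auto
  then obtain r where r: "r \<in> \<rho> ` X" "m = card (\<alpha> ` cell r)" by auto
  have le_m: "card (\<alpha> ` cell s) \<le> m" if "s \<in> \<rho> ` X" for s unfolding m_def using assms that by (intro Max_ge) auto
  have "X = (\<Union>s\<in>\<rho> ` X. cell s)" by (auto simp: cell_def)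
  then have "card X \<le> (\<Sum>s\<in>\<rho> ` X. card (cell s))" using card_UN_le[of "\<rho> ` X" cell] assms by simp
  also have "\<dots> \<le> (\<Sum>s\<in>\<rho> ` X. m * card (fib s (best s)))"
  proof (rule sum_mono)
    fix s assume s: "s \<in> \<rho> ` X"
    have "cell s = (\<Union>a\<in>\<alpha> ` cell s. fib s a)" by (auto simp: fib_def)
    then have "card (cell s) \<le> (\<Sum>a\<in>\<alpha> ` cell s. card (fib s a))"
      using card_UN_le[of "\<alpha> ` cell s" "fib s"] fin by simp
    also have "\<dots> \<le> (\<Sum>a\<in>\<alpha> ` cell s. card (fib s (best s)))" using best by (intro sum_mono)
    also have "\<dots> \<le> m * card (fib s (best s))" using le_m[OF s] by simp
    finally show "card (cell s) \<le> m * card (fib s (best s))" .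
  qed
  also have "\<dots> = m * card U"
    unfolding U_def using assms fin
    by (subst card_UN_disjoint) (auto simp: sum_distrib_left fib_def cell_def)
  finally have "card X \<le> card U * card (\<alpha> ` {x\<in>X. \<rho> x = r})" by (simp add: r(2) cell_def mult.commute)
  moreover have "U \<subseteq> X" by (auto simp: U_def fib_def cell_def)
  moreover have "\<alpha> x = \<alpha> y" if "x \<in> U" "y \<in> U" "\<rho> x = \<rho> y" for x y
    using that by (auto simp: U_def fib_def cell_def)
  ultimately show thesis using that r(1) by blast
qed

text \<open>An algebra with an embedding into a field and \<open>d + 1\<close> homogeneous elements of the same degree, so
that their ratios are elements of degree zero of the field.\<close>
locale embedded_algebra = integral_graded_algebra scale B
  for scale :: "'k::field \<Rightarrow> 'b::idom \<Rightarrow> 'b" and B :: "nat \<Rightarrow> 'b set" +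
  fixes e :: "'b \<Rightarrow> 'f::field" and x :: "nat \<Rightarrow> 'b" and d a :: nat
  assumes e_add: "e (u + w) = e u + e w" and e_mult: "e (u * w) = e u * e w"
    and e_eq_0_iff: "e u = 0 \<longleftrightarrow> u = 0"
    and x_mem: "i \<le> d \<Longrightarrow> x i \<in> B a" and x_nonzero: "i \<le> d \<Longrightarrow> x i \<noteq> 0"
begin

definition Y :: "(nat \<Rightarrow> int) \<Rightarrow> 'f" where
  "Y \<alpha> = (\<Prod>i<d. (e (x (Suc i)) / e (x 0)) powi \<alpha> i)"

lemma Y_nonzero [simp]: "Y \<alpha> \<noteq> 0"
  using x_nonzero by (auto simp: Y_def e_eq_0_iff)

lemma Y_add: "Y (\<lambda>i. \<alpha> i + \<beta> i) = Y \<alpha> * Y \<beta>"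
  using x_nonzero by (simp add: Y_def e_eq_0_iff power_int_add prod.distrib)

lemma Y_diff: "Y (\<lambda>i. \<alpha> i - \<beta> i) = Y \<alpha> / Y \<beta>"
  using x_nonzero by (simp add: Y_def e_eq_0_iff power_int_diff prod_dividef)

lemma Y_0: "Y (\<lambda>i. 0) = 1" by (simp add: Y_def)

lemma Y_sum: "Y (\<lambda>i. \<Sum>j\<in>J. \<tau> j i) = (\<Prod>j\<in>J. Y (\<tau> j))"
  by (induction J rule: infinite_finite_induct) (auto simp: Y_0 Y_add)

lemma e_0 [simp]: "e 0 = 0" by (simp add: e_eq_0_iff)
lemma e_1 [simp]: "e 1 = 1" using e_mult[of 1 1] e_eq_0_iff[of 1] by simp
lemma e_minus: "e (u - w) = e u - e w" using e_add[of "u - w" w] by simp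
lemma e_uminus: "e (- w) = - e w" using e_minus[of 0 w] by simp
lemma e_sum: "e (sum g I) = (\<Sum>i\<in>I. e (g i))"
  by (induction I rule: infinite_finite_induct) (auto simp: e_add)
lemma e_prod: "e (prod g I) = (\<Prod>i\<in>I. e (g i))"
  by (induction I rule: infinite_finite_induct) (auto simp: e_mult)
lemma e_power: "e (u ^ n) = e u ^ n" by (induction n) (auto simp: e_mult)

lemma e_scale: "e (scale k u) = e u * e (scale k 1)"
  using scale_mult[of k 1 u] by (metis e_mult mult.commute mult_1)

text \<open>The monomial of degree \<open>D\<close> in the \<open>x i\<close> whose image is \<open>e (x 0) ^ D * Y \<alpha>\<close>: the element \<open>x 0\<close>
makes the degree independent of \<open>\<alpha>\<close>.\<close>
definition mon :: "nat \<Rightarrow> (nat \<Rightarrow> int) \<Rightarrow> 'b" where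
  "mon D \<alpha> = x 0 ^ (D - (\<Sum>i<d. nat (\<alpha> i))) * (\<Prod>i<d. x (Suc i) ^ nat (\<alpha> i))"

lemma e_mon:
  assumes "\<And>i. i < d \<Longrightarrow> 0 \<le> \<alpha> i" "(\<Sum>i<d. nat (\<alpha> i)) \<le> D"
  shows "e (mon D \<alpha>) = e (x 0) ^ D * Y \<alpha>"
proof -
  have "Y \<alpha> = (\<Prod>i<d. e (x (Suc i)) ^ nat (\<alpha> i) / e (x 0) ^ nat (\<alpha> i))"
    unfolding Y_def using assms(1) by (intro prod.cong refl) (simp add: power_int_def power_divide)
  also have "\<dots> = (\<Prod>i<d. e (x (Suc i)) ^ nat (\<alpha> i)) / e (x 0) ^ (\<Sum>i<d. nat (\<alpha> i))"
    by (simp add: prod_dividef power_sum)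
  finally show ?thesis
    using assms(2) x_nonzero[of 0]
    by (simp add: mon_def e_mult e_prod e_power e_eq_0_iff power_diff)
qed

lemma power_mem: "u \<in> B n \<Longrightarrow> u ^ k \<in> B (k * n)"
  by (induction k) (auto simp: one_mem intro: mult_mem)

lemma prod_mem: "(\<And>i. i < m \<Longrightarrow> u i \<in> B (n i)) \<Longrightarrow> (\<Prod>i<m. u i) \<in> B (\<Sum>i<(m::nat). n i)"
  by (induction m) (auto simp: one_mem intro: mult_mem)

lemma mon_mem:
  assumes "(\<Sum>i<d. nat (\<alpha> i)) \<le> D" shows "mon D \<alpha> \<in> B (D * a)"
proof -
  have "(\<Prod>i<d. x (Suc i) ^ nat (\<alpha> i)) \<in> B (\<Sum>i<d. nat (\<alpha> i) * a)"
    by (intro prod_mem power_mem x_mem) auto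
  from mult_mem[OF power_mem[OF x_mem[of 0]] this, of "D - (\<Sum>i<d. nat (\<alpha> i))"]
  show ?thesis using assms by (simp add: mon_def sum_distrib_right[symmetric] add_mult_distrib[symmetric])
qed

text \<open>Multiplying by a high power of all \<open>x i\<close> turns Laurent monomials in the ratios into monomials of a
common degree in \<open>x 0, ..., x d\<close>, which are independent.\<close>
lemma laurent_independent:
  assumes alg: "\<And>i. i \<le> d \<Longrightarrow> \<not> algebraic (x i) (x ` {..<i})"
    and S: "finite S" "\<And>\<alpha>. \<alpha> \<in> S \<Longrightarrow> \<forall>i\<ge>d. \<alpha> i = 0"
    and sum: "(\<Sum>\<alpha>\<in>S. e (scale (c \<alpha>) 1) * Y \<alpha>) = 0" and \<alpha>: "\<alpha> \<in> S"
  shows "c \<alpha> = 0"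
proof -
  define M where "M = (\<Sum>\<alpha>\<in>S. \<Sum>i<d. nat \<bar>\<alpha> i\<bar>)"
  have M: "\<bar>\<alpha> i\<bar> \<le> int M" if "\<alpha> \<in> S" "i < d" for \<alpha> i
  proof -
    have "nat \<bar>\<alpha> i\<bar> \<le> (\<Sum>i<d. nat \<bar>\<alpha> i\<bar>)" using that by (intro member_le_sum) auto
    also have "\<dots> \<le> M" unfolding M_def using that S by (intro member_le_sum[of \<alpha> S "\<lambda>\<alpha>. \<Sum>i<d. nat \<bar>\<alpha> i\<bar>"]) auto
    finally show ?thesis by linarith
  qed
  define D where "D = d * (2 * M)"
  define sh where "sh \<alpha> = (\<lambda>i. \<alpha> i + int M)" for \<alpha> :: "nat \<Rightarrow> int"
  define \<beta> where "\<beta> \<alpha> = (\<lambda>i. if i = 0 then D - (\<Sum>i<d. nat (sh \<alpha> i)) else if i \<le> d then nat (sh \<alpha> (i - 1)) else 0)"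
    for \<alpha> :: "nat \<Rightarrow> int"
  have pos: "0 \<le> sh \<alpha> i" "nat (sh \<alpha> i) \<le> 2 * M" if "\<alpha> \<in> S" "i < d" for \<alpha> i
    using M[OF that] by (auto simp: sh_def)
  have le_D: "(\<Sum>i<d. nat (sh \<alpha> i)) \<le> D" if "\<alpha> \<in> S" for \<alpha>
    using sum_mono[of "{..<d}" "\<lambda>i. nat (sh \<alpha> i)" "\<lambda>_. 2 * M"] pos(2)[OF that] by (simp add: D_def)
  have \<beta>_prod: "(\<Prod>i<Suc d. x i ^ \<beta> \<alpha> i) = mon D (sh \<alpha>)" for \<alpha>
    unfolding mon_def by (subst prod.lessThan_Suc_shift) (simp add: \<beta>_def)
  have \<beta>_sum: "(\<Sum>i<Suc d. \<beta> \<alpha> i) = D" if "\<alpha> \<in> S" for \<alpha>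
    using le_D[OF that] by (subst sum.lessThan_Suc_shift) (simp add: \<beta>_def)
  have inj: "inj_on \<beta> S"
  proof (rule inj_onI)
    fix \<alpha> \<gamma> assume h: "\<alpha> \<in> S" "\<gamma> \<in> S" "\<beta> \<alpha> = \<beta> \<gamma>"
    have "\<alpha> i = \<gamma> i" for i
    proof (cases "i < d")
      case True
      then have "nat (sh \<alpha> i) = nat (sh \<gamma> i)" using fun_cong[OF h(3), of "Suc i"] by (simp add: \<beta>_def)
      then show ?thesis using pos(1)[OF h(1) True] pos(1)[OF h(2) True] by (simp add: sh_def)
    next
      case False
      then show ?thesis using S(2)[OF h(1)] S(2)[OF h(2)] by simp
    qed
    then show "\<alpha> = \<gamma>" by (rule ext)
  qed
  define c' where "c' = (\<lambda>\<gamma>. c (the_inv_into S \<beta> \<gamma>))"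
  have c': "c' (\<beta> \<alpha>) = c \<alpha>" if "\<alpha> \<in> S" for \<alpha> using the_inv_into_f_f[OF inj that] by (simp add: c'_def)
  have "(\<Sum>\<alpha>\<in>S. scale (c \<alpha>) (mon D (sh \<alpha>))) = 0"
  proof -
    have Ysh: "Y (sh \<alpha>) = Y \<alpha> * Y (\<lambda>_. int M)" for \<alpha> unfolding sh_def by (rule Y_add)
    have "e (\<Sum>\<alpha>\<in>S. scale (c \<alpha>) (mon D (sh \<alpha>)))
        = (\<Sum>\<alpha>\<in>S. e (x 0) ^ D * Y (\<lambda>_. int M) * (e (scale (c \<alpha>) 1) * Y \<alpha>))"
      unfolding e_sum
    proof (rule sum.cong[OF refl])
      fix \<alpha> assume "\<alpha> \<in> S"
      then have "e (mon D (sh \<alpha>)) = e (x 0) ^ D * Y (sh \<alpha>)" using pos le_D by (intro e_mon) auto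
      then show "e (scale (c \<alpha>) (mon D (sh \<alpha>))) = e (x 0) ^ D * Y (\<lambda>_. int M) * (e (scale (c \<alpha>) 1) * Y \<alpha>)"
        by (simp only: e_scale[of "c \<alpha>" "mon D (sh \<alpha>)"] Ysh mult_ac)
    qed
    also have "\<dots> = 0" by (simp only: sum_distrib_left[symmetric] sum mult_zero_right)
    finally show ?thesis by (simp only: e_eq_0_iff)
  qed
  then have sum': "(\<Sum>\<gamma>\<in>\<beta> ` S. scale (c' \<gamma>) (\<Prod>i<Suc d. x i ^ \<gamma> i)) = 0"
    unfolding sum.reindex[OF inj] by (simp add: c' \<beta>_prod del: prod.lessThan_Suc)
  have "c' (\<beta> \<alpha>) = 0"
  proof (rule monomials_independent[OF _ _ _ sum'])
    show "\<not> algebraic (x i) (x ` {..<i})" if "i < Suc d" for i using alg that by simp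
    show "(\<Sum>i<Suc d. \<gamma> i) = D \<and> (\<forall>i\<ge>Suc d. \<gamma> i = 0)" if \<gamma>: "\<gamma> \<in> \<beta> ` S" for \<gamma>
    proof -
      obtain \<alpha> where "\<alpha> \<in> S" "\<gamma> = \<beta> \<alpha>" using \<gamma> by blast
      then show ?thesis using \<beta>_sum[of \<alpha>] by (simp add: \<beta>_def del: sum.lessThan_Suc)
    qed
  qed (use S \<alpha> in auto)
  then show ?thesis using c'[OF \<alpha>] by simp
qed

end

text \<open>Constants have value zero, and the values of the Laurent monomials \<open>Y \<alpha>\<close> form a copy of the
lattice of integer vectors of length \<open>d\<close>.\<close>
locale valued_algebra = embedded_algebra scale B e x d a + valuation_ring V
  for scale :: "'k::field \<Rightarrow> 'b::idom \<Rightarrow> 'b" and B :: "nat \<Rightarrow> 'b set"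
    and e :: "'b \<Rightarrow> 'f::field" and x :: "nat \<Rightarrow> 'b" and d a :: nat and V :: "'f set" +
  assumes e_const: "e (scale k 1) \<in> V"
    and monomials_distinct_values: "veq (Y \<alpha>) 1 \<Longrightarrow> j < d \<Longrightarrow> \<alpha> j = 0"
begin

lemma Y_inject: "veq (g * Y \<alpha>) (g * Y \<beta>) \<Longrightarrow> g \<noteq> 0 \<Longrightarrow> j < d \<Longrightarrow> \<alpha> j = \<beta> j"
proof -
  assume h: "veq (g * Y \<alpha>) (g * Y \<beta>)" "g \<noteq> 0" "j < d"
  then have "veq (Y \<alpha>) (Y \<beta>)" by (simp add: veq_mult_cancel)
  then have "veq (inverse (Y \<beta>) * Y \<alpha>) (inverse (Y \<beta>) * Y \<beta>)" by (rule veq_mult)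
  then have "veq (Y (\<lambda>i. \<alpha> i - \<beta> i)) 1" by (simp add: Y_diff field_simps)
  from monomials_distinct_values[OF this h(3)] show ?thesis by simp
qed

lemma vle_scale: "vle b (e u) \<Longrightarrow> vle b (e (scale k u))"
  using vle_trans[of b "e u" "e (scale k u)"] e_const[of k] e_scale[of k u] by (auto simp: vle_def)

lemma veq_scale: "k \<noteq> 0 \<Longrightarrow> veq (e (scale k u)) (e u)"
  using vle_scale[of "e u" u k] vle_scale[of "e (scale k u)" "scale k u" "inverse k"]
  by (simp add: veq_def)

text \<open>Valuation independence: the value of a combination is the least value of its terms. Distinct members
may have the same value, since the residue field may be larger than the field of scalars.\<close>
definition vind :: "'b set \<Rightarrow> bool" where
  "vind X \<longleftrightarrow> (\<forall>c. \<forall>u\<in>X. c u \<noteq> 0 \<longrightarrow> vle (e (\<Sum>z\<in>X. scale (c z) z)) (e u))"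

lemma vind_value:
  assumes "finite X" "0 \<notin> X" "vind X" "u \<in> X" "c u \<noteq> 0"
  obtains w where "w \<in> X" "veq (e (\<Sum>z\<in>X. scale (c z) z)) (e w)" "(\<Sum>z\<in>X. scale (c z) z) \<noteq> 0"
proof -
  let ?s = "\<Sum>z\<in>X. scale (c z) z"
  have le: "vle (e ?s) (e w)" if "w \<in> X" "c w \<noteq> 0" for w using assms that by (auto simp: vind_def)
  have nz: "?s \<noteq> 0"
  proof
    assume "?s = 0"
    then have "vle 0 (e u)" using le[of u] assms by simp
    then show False using assms by (auto simp: vle_0_left e_eq_0_iff)
  qed
  have "\<exists>w\<in>X. c w \<noteq> 0 \<and> vle (e w) (e ?s)"
  proof (rule ccontr)
    assume c: "\<not> (\<exists>w\<in>X. c w \<noteq> 0 \<and> vle (e w) (e ?s))"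
    have "\<not> vle (e (scale (c w) w)) (e ?s)" if "w \<in> X" for w
    proof (cases "c w = 0")
      case True
      then show ?thesis using nz by (simp add: vle_0_left e_eq_0_iff)
    next
      case False
      then show ?thesis using c that veq_scale[OF False, of w] vle_trans unfolding veq_def by blast
    qed
    then have "\<not> vle (\<Sum>w\<in>X. e (scale (c w) w)) (e ?s)" using nz by (intro vlt_sum) (auto simp: e_eq_0_iff)
    then show False by (simp add: e_sum)
  qed
  then show thesis using that le nz by (auto simp: veq_def)
qed

lemma vind_independent:
  assumes "finite X" "0 \<notin> X" "vind X" shows "independent X"
proof (rule independent_if_scalars_zero[OF assms(1)])
  fix c u assume "(\<Sum>z\<in>X. scale (c z) z) = 0" "u \<in> X"
  then show "c u = 0" using vind_value[OF assms, of u c] by metis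
qed

text \<open>If adding elements of \<open>span X\<close> cannot increase the value of \<open>w\<close>, then \<open>w\<close> cannot take part in any
cancellation.\<close>
lemma vind_insert:
  assumes X: "finite X" "0 \<notin> X" "vind X" and w: "w \<notin> X"
    and max: "\<And>s. s \<in> span X \<Longrightarrow> vle (e (w + s)) (e w)"
  shows "vind (insert w X)"
  unfolding vind_def
proof (intro allI ballI impI)
  fix c u assume u: "u \<in> insert w X" and cu: "c u \<noteq> (0 :: 'k)"
  define s where "s = (\<Sum>z\<in>X. scale (c z) z)"
  let ?t = "\<Sum>z\<in>insert w X. scale (c z) z"
  have t: "?t = scale (c w) w + s" using X w by (simp add: s_def)
  have s: "s \<in> span X" unfolding s_def by (intro span_sum span_scale span_base)
  show "vle (e ?t) (e u)"
  proof (cases "c w = 0")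
    case True
    then have "u \<in> X" using u cu by auto
    then show ?thesis using X(3) cu True by (simp add: t s_def vind_def)
  next
    case False
    have "vle (e (w + scale (inverse (c w)) s)) (e w)" using max s span_scale by blast
    moreover have "?t = scale (c w) (w + scale (inverse (c w)) s)" using False by (simp add: t scale_right_distrib)
    ultimately have tw: "vle (e ?t) (e w)" using veq_scale[OF False] vle_trans unfolding veq_def by metis
    show ?thesis
    proof (cases "u = w")
      case False
      then have "u \<in> X" using u by simp
      then have su: "vle (e s) (e u)" using X(3) cu by (simp add: s_def vind_def)
      have "vle (e ?t) (e ?t - e (scale (c w) w))"
        using vle_add[of "e ?t" "e ?t" "- e (scale (c w) w)"] vle_scale[OF tw, of "c w"] by simp
      moreover have "e s = e ?t - e (scale (c w) w)" by (simp add: t e_add)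
      ultimately show ?thesis using su vle_trans by metis
    qed (use tw in simp)
  qed
qed

text \<open>A maximal valuation independent set \<open>X\<close> spans. Otherwise consider \<open>w0 + span X\<close> for some \<open>w0\<close>
outside the span, and in it an element \<open>w\<close> whose value is exceeded or attained by as few members of
\<open>X\<close> as possible. If \<open>w + s\<close> had a larger value, \<open>s\<close> would have the same value as \<open>w\<close>, which is the
value of a member of \<open>X\<close>; that member would not be counted for \<open>w + s\<close>. So \<open>w\<close> has maximal value and
can be added to \<open>X\<close>.\<close>
lemma vind_basis_exists:
  assumes W: "fin_dim W" "subspace W"
  obtains X where "X \<subseteq> W" "finite X" "0 \<notin> X" "vind X" "card X = dim W"
proof -
  define P where "P X \<longleftrightarrow> X \<subseteq> W \<and> finite X \<and> 0 \<notin> X \<and> vind X" for X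
  have le: "card X \<le> dim W" if "P X" for X
    using that independent_card_le_fin_dim(2)[OF W(1) vind_independent] by (auto simp: P_def)
  have "P {}" by (auto simp: P_def vind_def)
  then have "P (arg_max card P)" and max: "\<And>Z. P Z \<Longrightarrow> card Z \<le> card (arg_max card P)"
    using arg_max_nat_lemma[of P "{}" card "Suc (dim W)"] le by (auto simp: less_Suc_eq_le)
  then obtain X where X: "P X" "\<And>Z. P Z \<Longrightarrow> card Z \<le> card X" by blast
  then have PX: "X \<subseteq> W" "finite X" "0 \<notin> X" "vind X" by (auto simp: P_def)
  have "W \<subseteq> span X"
  proof (rule ccontr)
    assume "\<not> W \<subseteq> span X"
    then obtain w0 where w0: "w0 \<in> W" "w0 \<notin> span X" by blast
    define Q where "Q w \<longleftrightarrow> (\<exists>s\<in>span X. w = w0 + s)" for w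
    define N where "N w = card {z\<in>X. vle (e w) (e z)}" for w
    have "Q w0" unfolding Q_def using span_zero by (intro bexI[of _ 0]) auto
    then obtain w where w: "Q w" "\<And>w'. Q w' \<Longrightarrow> N w \<le> N w'"
      using ex_has_least_nat[of Q w0 N] by blast
    then obtain s0 where s0: "s0 \<in> span X" "w = w0 + s0" by (auto simp: Q_def)
    have wX: "w \<notin> span X" using s0 w0 span_diff[of w X s0] by auto
    have wW: "w \<in> W" using s0 w0 W(2) PX span_minimal[of X W] by (auto intro: subspace_add)
    have "vle (e (w + s)) (e w)" if s: "s \<in> span X" for s
    proof (rule ccontr)
      assume lt: "\<not> vle (e (w + s)) (e w)"
      then have le_w: "vle (e w) (e (w + s))" using vle_linear by blast
      have "vle (e w) (e s)"
        using vle_add[OF le_w, of "- e w"] by (simp add: e_add)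
      moreover have "vle (e s) (e w)"
      proof (rule ccontr)
        assume "\<not> vle (e s) (e w)"
        then have "\<not> vle (e (w + s) + (- e s)) (e w)"
          using lt by (intro vlt_add) simp_all
        then show False by (simp add: e_add)
      qed
      ultimately have sw: "veq (e s) (e w)" by (simp add: veq_def)
      obtain c where c: "s = (\<Sum>z\<in>X. scale (c z) z)" using s PX by (auto simp: span_finite)
      have "s \<noteq> 0" using lt by auto
      have "\<exists>u\<in>X. c u \<noteq> 0"
      proof (rule ccontr)
        assume "\<not> (\<exists>u\<in>X. c u \<noteq> 0)"
        then have "s = 0" unfolding c by (intro sum.neutral) simp
        with \<open>s \<noteq> 0\<close> show False ..
      qed
      then obtain u where u: "u \<in> X" "c u \<noteq> 0" by blast
      obtain z where z: "z \<in> X" "veq (e s) (e z)"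
        by (rule vind_value[where c = c, OF PX(2-4) u]) (simp only: c[symmetric])
      have wz: "vle (e w) (e z)" "vle (e z) (e w)"
        using z(2) sw vle_trans[of "e w" "e s" "e z"] vle_trans[of "e z" "e s" "e w"] by (auto simp: veq_def)
      have "{z\<in>X. vle (e (w + s)) (e z)} \<subset> {z\<in>X. vle (e w) (e z)}"
      proof
        show "{z\<in>X. vle (e (w + s)) (e z)} \<subseteq> {z\<in>X. vle (e w) (e z)}" by (auto intro: vle_trans[OF le_w])
        have "z \<in> {z\<in>X. vle (e w) (e z)}" using z(1) wz(1) by simp
        moreover have "z \<notin> {z\<in>X. vle (e (w + s)) (e z)}"
          using lt vle_trans[of "e (w + s)" "e z" "e w"] wz(2) by blast
        ultimately show "{z\<in>X. vle (e (w + s)) (e z)} \<noteq> {z\<in>X. vle (e w) (e z)}" by blast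
      qed
      then have "N (w + s) < N w" unfolding N_def using PX by (intro psubset_card_mono) auto
      moreover have "Q (w + s)" using s0 s unfolding Q_def by (intro bexI[of _ "s0 + s"]) (auto intro: span_add simp: add.assoc)
      ultimately show False using w(2) by (simp add: not_less[symmetric])
    qed
    moreover have "w \<notin> X" using wX span_base[of w X] by auto
    ultimately have "vind (insert w X)" using vind_insert[OF PX(2-4)] by simp
    moreover have "w \<noteq> 0" using wX span_zero by auto
    ultimately have "P (insert w X)" using PX wW by (simp add: P_def)
    then have "card (insert w X) \<le> card X" by (rule X(2))
    then show False using PX \<open>w \<notin> X\<close> by simp
  qed
  then have "dim W \<le> card X" using PX by (intro dim_le_card) auto
  then show thesis using that PX le[OF X(1)] by simp
qed

text \<open>In every coset of the lattice of monomial values the set has at most one value.\<close>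
definition reduced :: "'b set \<Rightarrow> bool" where
  "reduced X \<longleftrightarrow> (\<forall>u\<in>X. \<forall>w\<in>X. \<forall>\<alpha>. veq (e u) (e w * Y \<alpha>) \<longrightarrow> veq (e u) (e w))"

text \<open>Apply \<open>uniform_selection\<close> to a valuation independent basis of \<open>W\<close>. The selected set is reduced
because in every coset only one position is kept, and \<open>T\<close> is the set of positions in the richest coset.\<close>
lemma coset_with_many_values:
  assumes W: "fin_dim W" "subspace W" "W \<noteq> {0}"
  obtains U w0 T where "U \<subseteq> W" "finite U" "0 \<notin> U" "vind U" "reduced U" "w0 \<in> W" "w0 \<noteq> 0"
    "finite T" "T \<noteq> {}" "\<And>\<alpha>. \<alpha> \<in> T \<Longrightarrow> (\<forall>i\<ge>d. \<alpha> i = 0) \<and> (\<exists>w\<in>W. w \<noteq> 0 \<and> veq (e w) (e w0 * Y \<alpha>))"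
    "dim W \<le> card U * card T"
proof -
  obtain X where X: "X \<subseteq> W" "finite X" "0 \<notin> X" "vind X" "card X = dim W"
    using vind_basis_exists[OF W(1,2)] .
  have "X \<noteq> {}" using X W fin_dim_dim_eq_0 by fastforce
  define rel where "rel u w \<longleftrightarrow> (\<exists>\<alpha>. veq (e u) (e w * Y \<alpha>))" for u w
  have rel_sym: "rel w u" if uw: "rel u w" for u w
  proof -
    obtain \<alpha> where "veq (e u) (e w * Y \<alpha>)" using uw by (auto simp: rel_def)
    then have "veq (inverse (Y \<alpha>) * (e w * Y \<alpha>)) (inverse (Y \<alpha>) * e u)" using veq_sym veq_mult by blast
    moreover have "inverse (Y \<alpha>) * e u = e u * Y (\<lambda>i. 0 - \<alpha> i)" using Y_diff[of "\<lambda>_. 0" \<alpha>] by (simp add: Y_0 field_simps)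
    moreover have "inverse (Y \<alpha>) * (e w * Y \<alpha>) = e w" by simp
    ultimately have "veq (e w) (e u * Y (\<lambda>i. 0 - \<alpha> i))" by (simp only:)
    then show ?thesis unfolding rel_def by blast
  qed
  have rel_trans: "rel u z" if uw: "rel u w" and wz: "rel w z" for u w z
  proof -
    obtain \<alpha> where \<alpha>: "veq (e u) (e w * Y \<alpha>)" using uw by (auto simp: rel_def)
    obtain \<beta> where \<beta>: "veq (e w) (e z * Y \<beta>)" using wz by (auto simp: rel_def)
    have "veq (e u) (e z * Y \<beta> * Y \<alpha>)" using veq_trans[OF \<alpha> veq_mult2[OF \<beta> veq_refl]] .
    then have "veq (e u) (e z * Y (\<lambda>i. \<beta> i + \<alpha> i))" by (simp add: Y_add mult.assoc)
    then show ?thesis unfolding rel_def by blast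
  qed
  define \<rho> where "\<rho> u = (SOME w. w \<in> X \<and> rel u w)" for u
  have rel_refl: "rel u u" for u unfolding rel_def by (intro exI[of _ "\<lambda>_. 0"]) (simp add: Y_0)
  have \<rho>: "\<rho> u \<in> X" "rel u (\<rho> u)" if "u \<in> X" for u
    using someI[of "\<lambda>w. w \<in> X \<and> rel u w" u] that rel_refl by (auto simp: \<rho>_def)
  have \<rho>_eq: "\<rho> u = \<rho> w" if "rel u w" for u w
  proof -
    have "rel u z \<longleftrightarrow> rel w z" for z using that rel_sym rel_trans by blast
    then show ?thesis by (simp add: \<rho>_def)
  qed
  define \<alpha> where "\<alpha> u = (SOME \<alpha>. (\<forall>i\<ge>d. \<alpha> i = 0) \<and> veq (e u) (e (\<rho> u) * Y \<alpha>))" for u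
  have \<alpha>: "(\<forall>i\<ge>d. \<alpha> u i = 0) \<and> veq (e u) (e (\<rho> u) * Y (\<alpha> u))" if u: "u \<in> X" for u
  proof -
    obtain \<beta> where \<beta>: "veq (e u) (e (\<rho> u) * Y \<beta>)" using \<rho>(2)[OF u] by (auto simp: rel_def)
    have "Y (\<lambda>i. if i < d then \<beta> i else 0) = Y \<beta>" by (simp add: Y_def)
    then have "\<exists>\<alpha>. (\<forall>i\<ge>d. \<alpha> i = 0) \<and> veq (e u) (e (\<rho> u) * Y \<alpha>)" using \<beta>
      by (intro exI[of _ "\<lambda>i. if i < d then \<beta> i else 0"]) simp
    then show ?thesis unfolding \<alpha>_def by (rule someI_ex)
  qed
  obtain U r where U: "U \<subseteq> X" "r \<in> \<rho> ` X" "\<And>u w. u \<in> U \<Longrightarrow> w \<in> U \<Longrightarrow> \<rho> u = \<rho> w \<Longrightarrow> \<alpha> u = \<alpha> w"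
    "card X \<le> card U * card (\<alpha> ` {u\<in>X. \<rho> u = r})"
    by (rule uniform_selection[OF X(2) \<open>X \<noteq> {}\<close>, of \<rho> \<alpha>]) blast
  have "vind U"
    unfolding vind_def
  proof (intro allI ballI impI)
    fix c u assume "u \<in> U" "c u \<noteq> (0::'k)"
    let ?c = "\<lambda>z. if z \<in> U then c z else 0"
    have "(\<Sum>z\<in>X. scale (?c z) z) = (\<Sum>z\<in>U. scale (c z) z)"
      using X(2) U(1) by (intro sum.mono_neutral_cong_right) auto
    moreover have "vle (e (\<Sum>z\<in>X. scale (?c z) z)) (e u)"
      using X(4) \<open>u \<in> U\<close> \<open>c u \<noteq> 0\<close> U(1) unfolding vind_def by (auto dest!: spec[of _ ?c])
    ultimately show "vle (e (\<Sum>z\<in>U. scale (c z) z)) (e u)" by simp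
  qed
  moreover have "reduced U"
    unfolding reduced_def
  proof (intro ballI allI impI)
    fix u w \<beta> assume uw: "u \<in> U" "w \<in> U" "veq (e u) (e w * Y \<beta>)"
    then have "rel u w" unfolding rel_def by (intro exI)
    then have rho: "\<rho> u = \<rho> w" by (rule \<rho>_eq)
    have "\<alpha> u = \<alpha> w" by (rule U(3)[OF uw(1,2) rho])
    with rho have "e (\<rho> u) * Y (\<alpha> u) = e (\<rho> w) * Y (\<alpha> w)" by (simp only:)
    moreover have "veq (e u) (e (\<rho> u) * Y (\<alpha> u))" "veq (e w) (e (\<rho> w) * Y (\<alpha> w))"
      using \<alpha>[of u] \<alpha>[of w] uw U(1) by blast+
    ultimately show "veq (e u) (e w)" using veq_trans veq_sym by metis
  qed
  moreover have "r \<in> X" using U(2) \<rho>(1) by auto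
  moreover have "(\<forall>i\<ge>d. \<beta> i = 0) \<and> (\<exists>w\<in>W. w \<noteq> 0 \<and> veq (e w) (e r * Y \<beta>))" if \<beta>: "\<beta> \<in> \<alpha> ` {u\<in>X. \<rho> u = r}" for \<beta>
  proof -
    obtain u where u: "u \<in> X" "\<rho> u = r" "\<beta> = \<alpha> u" using \<beta> by blast
    moreover have "u \<in> W" "u \<noteq> 0" using u(1) X by auto
    ultimately show ?thesis using \<alpha>[of u] by blast
  qed
  moreover have "\<alpha> ` {u\<in>X. \<rho> u = r} \<noteq> {}" using U(2) by auto
  moreover have "finite U" using U(1) X(2) finite_subset by blast
  moreover have "U \<subseteq> W" "r \<in> W" "0 \<notin> U" "r \<noteq> 0" using U(1) X \<open>r \<in> X\<close> by auto
  moreover have "finite (\<alpha> ` {u\<in>X. \<rho> u = r})" using X(2) by simp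
  ultimately show thesis using that[of U r "\<alpha> ` {u\<in>X. \<rho> u = r}"] U(4)[unfolded X(5)] by blast
qed

text \<open>The products \<open>z \<beta> * u\<close> are independent. For fixed \<open>\<beta>\<close>, valuation independence of \<open>U\<close> gives a
combination of the \<open>z \<beta> * u\<close> the value of one of them, and for different \<open>\<beta>\<close> these values differ:
if they were equal, the values of the two members of \<open>U\<close> would lie in one coset, so they would be
equal, and then the values of the monomials would agree.\<close>
lemma product_dim_bound:
  assumes U: "finite U" "0 \<notin> U" "vind U" "reduced U" and A: "finite A" "\<And>\<beta>. \<beta> \<in> A \<Longrightarrow> \<forall>i\<ge>d. \<beta> i = 0"
    and g: "g \<noteq> 0" "\<And>\<beta>. \<beta> \<in> A \<Longrightarrow> veq (e (z \<beta>)) (g * Y \<beta>)"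
    and Z: "fin_dim Z" "\<And>\<beta> u. \<beta> \<in> A \<Longrightarrow> u \<in> U \<Longrightarrow> z \<beta> * u \<in> Z"
  shows "card A * card U \<le> dim Z"
proof -
  have "card (A \<times> U) \<le> dim Z"
  proof (rule card_le_dim_of_independent_family[of _ "\<lambda>(\<beta>, u). z \<beta> * u"])
    fix c assume eq: "(\<Sum>i\<in>A \<times> U. scale (c i) (case i of (\<beta>, u) \<Rightarrow> z \<beta> * u)) = 0"
    define s where "s \<beta> = (\<Sum>u\<in>U. scale (c (\<beta>, u)) u)" for \<beta>
    define A' where "A' = {\<beta>\<in>A. \<exists>u\<in>U. c (\<beta>, u) \<noteq> 0}"
    have "(\<Sum>i\<in>A \<times> U. scale (c i) (case i of (\<beta>, u) \<Rightarrow> z \<beta> * u)) = (\<Sum>\<beta>\<in>A. \<Sum>u\<in>U. scale (c (\<beta>, u)) (z \<beta> * u))"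
      by (subst sum.cartesian_product) (rule sum.cong, auto)
    also have "\<dots> = (\<Sum>\<beta>\<in>A. z \<beta> * s \<beta>)"
      unfolding s_def sum_distrib_left
      by (intro sum.cong refl) (simp only: mult.commute[of "z _"] scale_mult)
    also have "\<dots> = (\<Sum>\<beta>\<in>A'. z \<beta> * s \<beta>)"
      using A(1) by (intro sum.mono_neutral_right) (auto simp: A'_def s_def intro!: sum.neutral)
    finally have "(\<Sum>\<beta>\<in>A'. z \<beta> * s \<beta>) = 0" using eq by (simp only:)
    then have sum0: "(\<Sum>\<beta>\<in>A'. e (z \<beta> * s \<beta>)) = 0" by (simp only: e_sum[symmetric] e_0)
    have "\<exists>w. w \<in> U \<and> veq (e (s \<beta>)) (e w) \<and> s \<beta> \<noteq> 0" if \<beta>: "\<beta> \<in> A'" for \<beta>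
    proof -
      obtain u where "u \<in> U" "c (\<beta>, u) \<noteq> 0" using \<beta> by (auto simp: A'_def)
      then show ?thesis
        using vind_value[where c = "\<lambda>u. c (\<beta>, u)" and u = u, OF U(1-3), folded s_def] by metis
    qed
    then obtain w where w: "\<And>\<beta>. \<beta> \<in> A' \<Longrightarrow> w \<beta> \<in> U \<and> veq (e (s \<beta>)) (e (w \<beta>)) \<and> s \<beta> \<noteq> 0" by metis
    have val: "veq (e (z \<beta> * s \<beta>)) (g * Y \<beta> * e (w \<beta>))" if "\<beta> \<in> A'" for \<beta>
      using w[OF that] g(2)[of \<beta>] that by (auto simp: e_mult A'_def intro: veq_mult2)
    have "A' = {}"
    proof (rule ccontr)
      assume "A' \<noteq> {}"
      have "(\<Sum>\<beta>\<in>A'. e (z \<beta> * s \<beta>)) \<noteq> 0"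
      proof (rule sum_nonzero_of_distinct_values)
        show "finite A'" "A' \<noteq> {}" using A \<open>A' \<noteq> {}\<close> by (auto simp: A'_def)
        fix \<beta> assume \<beta>: "\<beta> \<in> A'"
        have "z \<beta> \<noteq> 0"
        proof
          assume "z \<beta> = 0"
          then have "veq 0 (g * Y \<beta>)" using g(2)[of \<beta>] \<beta> by (simp add: A'_def)
          then show False using g(1) by (simp add: veq_def vle_0_left)
        qed
        then show "e (z \<beta> * s \<beta>) \<noteq> 0" using w[OF \<beta>] by (simp add: e_eq_0_iff)
        fix \<beta>' assume \<beta>': "\<beta>' \<in> A'" and "veq (e (z \<beta> * s \<beta>)) (e (z \<beta>' * s \<beta>'))"
        then have eq: "veq (g * Y \<beta> * e (w \<beta>)) (g * Y \<beta>' * e (w \<beta>'))"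
          using val[OF \<beta>] val[OF \<beta>'] veq_sym veq_trans by blast
        have "veq (e (w \<beta>)) (e (w \<beta>') * Y (\<lambda>i. \<beta>' i - \<beta> i))"
          using veq_mult[OF eq, of "inverse (g * Y \<beta>)"] g(1) by (simp add: Y_diff field_simps)
        then have "veq (e (w \<beta>)) (e (w \<beta>'))" using U(4) w \<beta> \<beta>' unfolding reduced_def by blast
        then have "veq (g * Y \<beta>' * e (w \<beta>)) (g * Y \<beta>' * e (w \<beta>'))" by (rule veq_mult)
        then have "veq (g * Y \<beta> * e (w \<beta>)) (g * Y \<beta>' * e (w \<beta>))"
          using eq veq_sym veq_trans by blast
        then have "veq ((g * e (w \<beta>)) * Y \<beta>) ((g * e (w \<beta>)) * Y \<beta>')" by (simp add: mult_ac)
        moreover have "g * e (w \<beta>) \<noteq> 0" using g(1) w[OF \<beta>] U(2) by (auto simp: e_eq_0_iff)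
        ultimately have small: "\<beta> i = \<beta>' i" if "i < d" for i using Y_inject[OF _ _ that] by blast
        have "\<forall>i\<ge>d. \<beta> i = 0" "\<forall>i\<ge>d. \<beta>' i = 0" using A(2) \<beta> \<beta>' by (auto simp: A'_def)
        then have "\<beta> i = \<beta>' i" for i using small[of i] by (cases "i < d") auto
        then show "\<beta> = \<beta>'" by (rule ext)
      qed
      then show False using sum0 by simp
    qed
    then show "\<forall>i\<in>A \<times> U. c i = 0" by (auto simp: A'_def)
  qed (use U A Z in auto)
  then show ?thesis by (simp add: card_cartesian_product)
qed

end

section \<open>Rank estimates in graded algebras of polynomial growth\<close>

definition to_frac :: "'b::idom \<Rightarrow> 'b fract" where "to_frac u = Fraction_Field.Fract u 1"

lemma to_frac_simps:
  "to_frac (u + w) = to_frac u + to_frac w" "to_frac (u * w) = to_frac u * to_frac w"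
  "to_frac u = 0 \<longleftrightarrow> u = 0"
  by (simp_all add: to_frac_def eq_fract Zero_fract_def)

context integral_graded_algebra
begin

text \<open>Order Laurent monomials lexicographically. Let \<open>A\<close> be the span of the monomials with exponent zero
or positive and \<open>J\<close> the ideal spanned by those with positive exponent. It is proper because Laurent
monomials are independent. In a valuation ring given by \<open>exists_valuation_ring\<close> every positive
monomial has positive value, so no monomial other than \<open>1\<close> has the value of \<open>1\<close>.\<close>
lemma exists_valued_algebra:
  assumes alg: "\<And>i. i \<le> d \<Longrightarrow> \<not> algebraic (x i) (x ` {..<i})"
    and x: "\<And>i. i \<le> d \<Longrightarrow> x i \<in> B a" "\<And>i. i \<le> d \<Longrightarrow> x i \<noteq> 0"
  shows "\<exists>V. valued_algebra scale B to_frac x d a V"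
proof -
  have "embedded_algebra scale B to_frac x d a"
    by (intro embedded_algebra.intro integral_graded_algebra_axioms embedded_algebra_axioms.intro)
      (rule to_frac_simps | erule x)+
  then interpret embedded_algebra scale B to_frac x d a .
  let ?e = "to_frac :: 'b \<Rightarrow> 'b fract"
  define sF where "sF k f = ?e (scale k 1) * f" for k f
  have sK: "?e (scale (k * l) 1) = ?e (scale k 1) * ?e (scale l 1)" for k l
  proof -
    have "scale (k * l) 1 = scale k 1 * scale l 1" using scale_mult[of k 1 "scale l 1"] by (simp only: mult_1 scale_scale)
    then show ?thesis by (simp only: e_mult)
  qed
  interpret F: commutative_algebra sF
    by unfold_locales (simp_all add: sF_def distrib_left distrib_right scale_left_distrib e_add sK mult.assoc)
  define lexpos where "lexpos \<alpha> \<longleftrightarrow> (\<exists>i<d. 0 < \<alpha> i \<and> (\<forall>j<i. \<alpha> j = 0))" for \<alpha> :: "nat \<Rightarrow> int"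
  define supp where "supp \<alpha> \<longleftrightarrow> (\<forall>i\<ge>d. \<alpha> i = 0)" for \<alpha> :: "nat \<Rightarrow> int"
  have lex_add: "lexpos (\<lambda>i. \<alpha> i + \<beta> i)" if \<alpha>: "lexpos \<alpha>" and \<beta>: "lexpos \<beta>" for \<alpha> \<beta>
  proof -
    obtain i j where i: "i < d" "0 < \<alpha> i" "\<forall>l<i. \<alpha> l = 0" and j: "j < d" "0 < \<beta> j" "\<forall>l<j. \<beta> l = 0"
      using \<alpha> \<beta> by (auto simp: lexpos_def)
    consider "i < j" | "j < i" | "i = j" by linarith
    then have "0 < \<alpha> (min i j) + \<beta> (min i j)" by cases (use i j in auto)
    moreover have "\<forall>l<min i j. \<alpha> l + \<beta> l = 0" using i(3) j(3) by simp
    moreover have "min i j < d" using i(1) by simp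
    ultimately show ?thesis unfolding lexpos_def by blast
  qed
  have lex_total: "lexpos \<alpha> \<or> lexpos (\<lambda>i. 0 - \<alpha> i)" if j: "j < d" "\<alpha> j \<noteq> 0" for \<alpha> j
  proof -
    define i where "i = (LEAST i. \<alpha> i \<noteq> 0)"
    have i: "\<alpha> i \<noteq> 0" "i \<le> j"
      unfolding i_def using j(2) by (rule LeastI[of "\<lambda>i. \<alpha> i \<noteq> 0"], rule Least_le[of "\<lambda>i. \<alpha> i \<noteq> 0"])
    have "\<alpha> l = 0" if "l < i" for l
      using not_less_Least[of l "\<lambda>i. \<alpha> i \<noteq> 0"] that by (simp add: i_def)
    moreover have "i < d" using i(2) j(1) by simp
    moreover have "0 < \<alpha> i \<or> 0 < 0 - \<alpha> i" using i(1) by linarith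
    ultimately show ?thesis unfolding lexpos_def by (metis diff_self)
  qed
  define P1 where "P1 = {\<alpha>. supp \<alpha> \<and> lexpos \<alpha>}"
  define P0 where "P0 = insert (\<lambda>_. 0) P1"
  define A where "A = F.span (Y ` P0)"
  define J where "J = F.span (Y ` P1)"
  have P1_add: "(\<lambda>i. \<alpha> i + \<beta> i) \<in> P1" if "\<alpha> \<in> P0" "\<beta> \<in> P1" for \<alpha> \<beta>
    using that lex_add by (auto simp: P0_def P1_def supp_def)
  have AJ: "u * w \<in> J" if "u \<in> A" "w \<in> J" for u w
    unfolding J_def
  proof (rule F.mult_span_subset)
    show "s * t \<in> F.span (Y ` P1)" if st: "s \<in> Y ` P0" "t \<in> Y ` P1" for s t
    proof -
      obtain \<alpha> \<beta> where "\<alpha> \<in> P0" "\<beta> \<in> P1" "s = Y \<alpha>" "t = Y \<beta>" using st by blast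
      then have "s * t = Y (\<lambda>i. \<alpha> i + \<beta> i)" "(\<lambda>i. \<alpha> i + \<beta> i) \<in> P1" using P1_add by (simp_all add: Y_add)
      then show ?thesis by (auto intro: F.span_base)
    qed
  qed (use that in \<open>auto simp: A_def J_def\<close>)
  have JA: "J \<subseteq> A" unfolding A_def J_def by (intro F.span_mono) (auto simp: P0_def)
  have Y0: "1 \<in> Y ` P0" using Y_0 unfolding P0_def by (metis image_eqI insertI1)
  have AA: "u * w \<in> A" if "u \<in> A" "w \<in> A" for u w
    unfolding A_def
  proof (rule F.mult_span_subset)
    show "s * t \<in> F.span (Y ` P0)" if st: "s \<in> Y ` P0" "t \<in> Y ` P0" for s t
    proof (cases "t \<in> Y ` P1")
      case True
      then have "s * t \<in> J" using AJ[of s t] st by (auto simp: A_def J_def intro: F.span_base)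
      then show ?thesis using JA by (auto simp: A_def)
    next
      case False
      then have "t = 1" using st by (auto simp: P0_def Y_0)
      then show ?thesis using st by (auto intro: F.span_base)
    qed
  qed (use that in \<open>auto simp: A_def\<close>)
  have ringA: "subring_set A"
    unfolding subring_set_def using AA Y0 by (auto simp: A_def intro: F.span_base F.span_diff)
  have idealJ: "ideal_in A J"
    unfolding ideal_in_def using AJ JA by (auto simp: J_def intro: F.span_zero F.span_add)
  have properJ: "1 \<notin> J"
  proof
    assume "1 \<in> J"
    then obtain t r where t: "finite t" "t \<subseteq> Y ` P1" "1 = (\<Sum>f\<in>t. sF (r f) f)"
      unfolding J_def F.span_explicit by blast
    then obtain S where S: "S \<subseteq> P1" "inj_on Y S" "t = Y ` S" by (auto simp: subset_image_inj)
    have finS: "finite S" using t(1) S finite_image_iff by blast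
    have nS: "(\<lambda>_. 0) \<notin> S" using S(1) by (auto simp: P1_def lexpos_def)
    define c where "c \<alpha> = (if \<alpha> = (\<lambda>_. 0) then - 1 else r (Y \<alpha>))" for \<alpha>
    have "(\<Sum>\<alpha>\<in>S. ?e (scale (c \<alpha>) 1) * Y \<alpha>) = 1"
      unfolding t(3) S(3) sum.reindex[OF S(2)] by (rule sum.cong) (use nS in \<open>auto simp: c_def sF_def\<close>)
    moreover have "?e (scale (- 1) 1) = - 1" using e_uminus[of 1] e_1 by (simp del: e_1)
    ultimately have "(\<Sum>\<alpha>\<in>insert (\<lambda>_. 0) S. ?e (scale (c \<alpha>) 1) * Y \<alpha>) = 0"
      using finS nS by (simp add: c_def Y_0)
    note sum0 = this
    have supp_S: "\<forall>i\<ge>d. \<alpha> i = 0" if "\<alpha> \<in> insert (\<lambda>_. 0) S" for \<alpha>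
      using that S(1) by (auto simp: P1_def supp_def)
    have "c (\<lambda>_. 0) = 0"
      by (rule laurent_independent[OF alg _ supp_S sum0]) (simp_all add: finS)
    then show False by (simp add: c_def)
  qed
  from exists_valuation_ring[OF ringA idealJ properJ] obtain V where V: "subring_set V" "A \<subseteq> V" "\<forall>f. f \<in> V \<or> inverse f \<in> V"
    "\<forall>f\<in>J. f \<noteq> 0 \<longrightarrow> inverse f \<notin> V"
    by (elim exE conjE)
  interpret valuation_ring V by unfold_locales (use V(1,3) in auto)
  have pos: "\<not> veq (Y \<alpha>) 1" if "lexpos \<alpha>" for \<alpha>
  proof
    assume "veq (Y \<alpha>) 1"
    then obtain r where r: "r \<in> V" "1 = Y \<alpha> * r" by (auto simp: veq_def vle_def)
    define \<alpha>' where "\<alpha>' i = (if i < d then \<alpha> i else 0)" for i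
    have "Y \<alpha>' = Y \<alpha>" by (simp add: Y_def \<alpha>'_def)
    moreover have "\<alpha>' \<in> P1" using that by (auto simp: P1_def supp_def \<alpha>'_def lexpos_def)
    ultimately have "Y \<alpha> \<in> J" unfolding J_def by (metis F.span_base imageI)
    then have "inverse (Y \<alpha>) \<notin> V" using V(4) Y_nonzero by blast
    moreover have "inverse (Y \<alpha>) = r" using r(2) by (metis inverse_unique)
    ultimately show False using r(1) by simp
  qed
  have "valued_algebra scale B to_frac x d a V"
  proof unfold_locales
    show "?e (scale k 1) \<in> V" for k
    proof -
      have "sF k 1 \<in> A" unfolding A_def by (intro F.span_scale F.span_base Y0)
      then show ?thesis using V(2) by (auto simp: sF_def)
    qed
    show "\<alpha> j = 0" if h: "veq (Y \<alpha>) 1" "j < d" for \<alpha> j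
    proof (rule ccontr)
      assume "\<alpha> j \<noteq> 0"
      then have "lexpos \<alpha> \<or> lexpos (\<lambda>i. 0 - \<alpha> i)" using lex_total h by blast
      moreover have "veq (Y (\<lambda>i. 0 - \<alpha> i)) 1"
        using veq_mult[OF veq_sym[OF h(1)], of "inverse (Y \<alpha>)"] by (simp only: Y_diff Y_0) (simp add: field_simps)
      ultimately show False using pos h(1) by blast
    qed
  qed
  then show ?thesis by blast
qed

end

text \<open>The growth exponent equals the rank \<open>d\<close> of the lattice of monomial values; all estimates below play
the number of monomials in a cube off against this bound.\<close>
locale bounded_valued_algebra = valued_algebra scale B e x d a V
  for scale :: "'k::field \<Rightarrow> 'b::idom \<Rightarrow> 'b" and B :: "nat \<Rightarrow> 'b set"
    and e :: "'b \<Rightarrow> 'f::field" and x :: "nat \<Rightarrow> 'b" and d a :: nat and V :: "'f set" +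
  fixes C :: nat
  assumes fin_dim_B: "fin_dim (B n)" and growth_B: "n \<ge> 1 \<Longrightarrow> dim (B n) \<le> C * n ^ d"
    and a_pos: "a \<ge> 1"
begin

text \<open>The constants are chosen for \<open>dim_B_le\<close>. The degrees \<open>d * N + 1\<close> of monomials have the summand \<open>1\<close> to
be positive for \<open>d = 0\<close> or \<open>N = 0\<close> as well; the growth bound does not cover degree \<open>0\<close>.\<close>
definition K :: nat where "K = 1 + (d + 1) * a"
definition L :: nat where "L = C * K ^ d"

lemma cube_degree:
  assumes "\<beta> \<in> cube d N" shows "(\<Sum>i<d. nat (\<beta> i)) \<le> d * N + 1"
proof -
  have "(\<Sum>i<d. nat (\<beta> i)) \<le> (\<Sum>i<d. N)" using assms by (intro sum_mono) (auto simp: cube_def nat_le_iff)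
  then show ?thesis by simp
qed

lemma e_mon_cube: "\<beta> \<in> cube d N \<Longrightarrow> e (mon (d * N + 1) \<beta>) = e (x 0) ^ (d * N + 1) * Y \<beta>"
  by (rule e_mon) (use cube_degree in \<open>auto simp: cube_def\<close>)

lemma mon_cube_mem: "\<beta> \<in> cube d N \<Longrightarrow> mon (d * N + 1) \<beta> \<in> B ((d * N + 1) * a)"
  by (rule mon_mem) (rule cube_degree)

lemma dim_B_le:
  assumes "n \<le> N + 1" shows "dim (B (n + (d * N + 1) * a)) \<le> L * (N + 1) ^ d"
proof -
  have "dim (B (n + (d * N + 1) * a)) \<le> C * (n + (d * N + 1) * a) ^ d"
    by (rule growth_B) (use a_pos in auto)
  also have "n + (d * N + 1) * a \<le> (N + 1) * K"
    using assms by (simp add: K_def algebra_simps)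
  then have "C * (n + (d * N + 1) * a) ^ d \<le> C * ((N + 1) * K) ^ d" by (intro mult_le_mono2 power_mono) auto
  also have "\<dots> = L * (N + 1) ^ d" by (simp only: L_def power_mult_distrib mult_ac)
  finally show ?thesis .
qed

text \<open>Multiplying \<open>U\<close> by all monomials with exponents in a cube of side \<open>n\<close> gives
\<open>(n + 1) ^ d * card U\<close> independent elements of a degree proportional to \<open>n + 1\<close>.\<close>
lemma reduced_card_le:
  assumes U: "U \<subseteq> B n" "finite U" "0 \<notin> U" "vind U" "reduced U"
  shows "card U \<le> L"
proof -
  have "card (cube d n) * card U \<le> dim (B (n + (d * n + 1) * a))"
  proof (rule product_dim_bound[OF U(2-5) finite_cube])
    show "e (x 0) ^ (d * n + 1) \<noteq> 0" using x_nonzero by (simp add: e_eq_0_iff)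
    show "veq (e (mon (d * n + 1) \<beta>)) (e (x 0) ^ (d * n + 1) * Y \<beta>)" if "\<beta> \<in> cube d n" for \<beta>
      using e_mon_cube[OF that] by simp
    show "mon (d * n + 1) \<beta> * u \<in> B (n + (d * n + 1) * a)" if \<beta>: "\<beta> \<in> cube d n" and u: "u \<in> U" for \<beta> u
      using mult_mem[OF mon_cube_mem[OF \<beta>], of u n] u U(1) by (simp add: add.commute subset_iff)
  qed (use fin_dim_B in \<open>auto simp: cube_def\<close>)
  also have "\<dots> \<le> L * (n + 1) ^ d" by (rule dim_B_le) simp
  finally show ?thesis by (simp add: card_cube mult.commute)
qed

lemma singleton_reduced: "vind {1}" "reduced {1}"
  using veq_scale[of _ 1] by (auto simp: vind_def reduced_def veq_def)

text \<open>The case of \<open>product_dim_bound\<close> for the reduced set that consists of \<open>1\<close>: different values in one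
coset belong to independent elements.\<close>
lemma card_values_le_dim:
  assumes A: "finite A" "\<And>\<gamma>. \<gamma> \<in> A \<Longrightarrow> \<forall>i\<ge>d. \<gamma> i = 0" and g: "g \<noteq> 0"
    and Z: "fin_dim Z" "\<And>\<gamma>. \<gamma> \<in> A \<Longrightarrow> \<exists>z\<in>Z. veq (e z) (g * Y \<gamma>)"
  shows "card A \<le> dim Z"
proof -
  obtain z where z: "\<And>\<gamma>. \<gamma> \<in> A \<Longrightarrow> z \<gamma> \<in> Z \<and> veq (e (z \<gamma>)) (g * Y \<gamma>)" using Z(2) by metis
  have "card A * card {1::'b} \<le> dim Z"
    by (rule product_dim_bound[OF _ _ singleton_reduced A g, where z = z]) (use z Z(1) in auto)
  then show ?thesis by simp
qed

lemma Y_scale: "Y (\<lambda>i. int q * \<alpha> i) = Y \<alpha> ^ q"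
proof (induction q)
  case (Suc q)
  have "Y (\<lambda>i. int (Suc q) * \<alpha> i) = Y (\<lambda>i. \<alpha> i + int q * \<alpha> i)" by (simp add: algebra_simps)
  then show ?case by (simp only: Y_add Suc power_Suc)
qed (simp add: Y_0)

lemma veq_power: "veq u w \<Longrightarrow> veq (u ^ q) (w ^ q)"
  by (induction q) (auto intro: veq_mult2)

text \<open>Write \<open>l = \<alpha> i\<close> and \<open>N = l * n\<close>. The products \<open>w ^ q * w' ^ (l - q)\<close> for \<open>q \<le> l\<close> have degree \<open>N\<close>,
and their values differ by the multiples \<open>q * \<alpha>\<close>. Multiplied by monomials whose exponents run
through a slab of a cube of side \<open>N\<close>, with the \<open>i\<close>-th exponent below \<open>l\<close>, they give different values
for different choices, since the \<open>i\<close>-th coordinate determines \<open>q\<close> and the exponent by division with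
remainder. These are about \<open>l ^ 2 * N ^ (d - 1)\<close> values in a degree proportional to \<open>N\<close>, and comparison
with the growth bound \<open>N ^ d = l * n * N ^ (d - 1)\<close> up to constants gives a bound for \<open>l\<close> that is
linear in \<open>n\<close>.\<close>
lemma value_difference_le_pos:
  assumes w: "w \<in> B n" "w' \<in> B n" "w \<noteq> 0" "w' \<noteq> 0" and n: "n \<ge> 1"
    and rel: "veq (e w) (e w' * Y \<alpha>)" and supp: "\<forall>i\<ge>d. \<alpha> i = 0" and i: "i < d" "0 < \<alpha> i"
  shows "\<alpha> i \<le> int (L * n)"
proof -
  define l where "l = nat (\<alpha> i)"
  have l: "l \<ge> 1" "\<alpha> i = int l" using i by (auto simp: l_def)
  define N where "N = l * n"
  define R where "R = {\<beta> \<in> cube d N. \<beta> i = 0}"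
  have finR: "finite R" by (simp add: R_def)
  have lN: "l \<le> N" using n by (simp add: N_def)
  have "cube d N \<subseteq> (\<lambda>(\<beta>, c). \<beta>(i := c)) ` (R \<times> {0..int N})"
  proof
    fix \<beta> assume "\<beta> \<in> cube d N"
    then have "(\<beta>(i := 0), \<beta> i) \<in> R \<times> {0..int N}" using i by (auto simp: R_def cube_def)
    from imageI[OF this, of "\<lambda>(\<beta>, c). \<beta>(i := c)"] show "\<beta> \<in> (\<lambda>(\<beta>, c). \<beta>(i := c)) ` (R \<times> {0..int N})" by simp
  qed
  then have "card (cube d N) \<le> card (R \<times> {0..int N})" using finR by (intro surj_card_le) auto
  then have R: "(N + 1) ^ d \<le> card R * (N + 1)" by (simp add: card_cube card_cartesian_product nat_add_distrib)
  define \<phi> where "\<phi> = (\<lambda>(q, c, \<beta>) j. int q * \<alpha> j + (\<beta>(i := int c)) j)"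
  let ?D = "{..l} \<times> {..<l} \<times> R"
  have inj: "inj_on \<phi> ?D"
  proof (rule inj_onI)
    fix s t assume st: "s \<in> ?D" "t \<in> ?D" "\<phi> s = \<phi> t"
    obtain q c \<beta> where s: "s = (q, c, \<beta>)" by (cases s)
    obtain q' c' \<beta>' where t: "t = (q', c', \<beta>')" by (cases t)
    have h: "\<phi> (q, c, \<beta>) = \<phi> (q', c', \<beta>')" "q \<le> l" "c < l" "\<beta> \<in> R" "q' \<le> l" "c' < l" "\<beta>' \<in> R"
      using st by (auto simp: s t)
    have "int q * int l + int c = int q' * int l + int c'" using fun_cong[OF h(1), of i] by (simp add: \<phi>_def l)
    then have eq: "q * l + c = q' * l + c'" by (metis of_nat_add of_nat_eq_iff of_nat_mult)
    then have "(q * l + c) div l = (q' * l + c') div l" by simp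
    then have q: "q = q'" using h by simp
    then have c: "c = c'" using eq by simp
    have "\<beta> j = \<beta>' j" for j
      using fun_cong[OF h(1), of j] h(4,7) q c by (cases "j = i") (auto simp: \<phi>_def R_def)
    then show "s = t" using q c by (auto simp: s t)
  qed
  define g where "g = e w' ^ l * e (x 0) ^ (d * N + 1)"
  have "card (\<phi> ` ?D) \<le> dim (B (N + (d * N + 1) * a))"
  proof (rule card_values_le_dim[OF _ _ _ fin_dim_B])
    show "finite (\<phi> ` ?D)" using finR by simp
    show "g \<noteq> 0" using w x_nonzero by (simp add: g_def e_eq_0_iff)
    fix \<gamma> assume "\<gamma> \<in> \<phi> ` ?D"
    then obtain q c \<beta> where qc: "q \<le> l" "c < l" "\<beta> \<in> R" "\<gamma> = \<phi> (q, c, \<beta>)" by auto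
    define \<beta>' where "\<beta>' = \<beta>(i := int c)"
    have \<beta>': "\<beta>' \<in> cube d N" using qc i lN by (auto simp: \<beta>'_def R_def cube_def)
    have \<gamma>: "\<gamma> = (\<lambda>j. int q * \<alpha> j + \<beta>' j)" by (simp add: qc \<phi>_def \<beta>'_def)
    show "\<forall>i\<ge>d. \<gamma> i = 0" using supp \<beta>' by (simp add: \<gamma> cube_def)
    let ?z = "(w ^ q * w' ^ (l - q)) * mon (d * N + 1) \<beta>'"
    have "w ^ q * w' ^ (l - q) \<in> B (q * n + (l - q) * n)" using w by (intro mult_mem power_mem)
    moreover have "q * n + (l - q) * n = N" using qc(1) by (simp add: N_def add_mult_distrib[symmetric])
    ultimately have "?z \<in> B (N + (d * N + 1) * a)" using mult_mem mon_cube_mem[OF \<beta>'] by metis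
    moreover have "veq (e ?z) (g * Y \<gamma>)"
    proof -
      have "veq (e w ^ q * (e w' ^ (l - q) * (e (x 0) ^ (d * N + 1) * Y \<beta>')))
          ((e w' * Y \<alpha>) ^ q * (e w' ^ (l - q) * (e (x 0) ^ (d * N + 1) * Y \<beta>')))"
        by (intro veq_mult2 veq_power rel veq_refl)
      moreover have "(e w' * Y \<alpha>) ^ q * (e w' ^ (l - q) * (e (x 0) ^ (d * N + 1) * Y \<beta>')) = g * Y \<gamma>"
      proof -
        have "e w' ^ l = e w' ^ q * e w' ^ (l - q)" using qc(1) by (simp flip: power_add)
        then show ?thesis unfolding g_def \<gamma> Y_add Y_scale power_mult_distrib by (simp only: mult_ac)
      qed
      moreover have "e ?z = e w ^ q * (e w' ^ (l - q) * (e (x 0) ^ (d * N + 1) * Y \<beta>'))"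
        by (simp only: e_mult e_power e_mon_cube[OF \<beta>'] mult.assoc)
      ultimately show ?thesis by (simp only:)
    qed
    ultimately show "\<exists>z\<in>B (N + (d * N + 1) * a). veq (e z) (g * Y \<gamma>)" by blast
  qed
  also have "\<dots> \<le> L * (N + 1) ^ d" by (rule dim_B_le) simp
  finally have "(l + 1) * l * card R \<le> L * (N + 1) ^ d"
    by (simp add: card_image[OF inj] card_cartesian_product algebra_simps)
  then have "(l + 1) * l * card R * (N + 1) \<le> L * (N + 1) ^ d * (N + 1)" by (rule mult_le_mono1)
  moreover have "(l + 1) * l * (N + 1) ^ d \<le> (l + 1) * l * (card R * (N + 1))" using R by (rule mult_le_mono2)
  ultimately have "(N + 1) ^ d * ((l + 1) * l) \<le> (N + 1) ^ d * (L * (N + 1))" by (simp only: mult_ac)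
  then have "(l + 1) * l \<le> L * (N + 1)" by simp
  also have "\<dots> \<le> L * ((l + 1) * n)" using n by (intro mult_le_mono2) (simp add: N_def algebra_simps)
  finally have "(l + 1) * l \<le> (l + 1) * (L * n)" by (simp only: mult_ac)
  from mult_left_le_imp_le[OF this] have "l \<le> L * n" by simp
  then show ?thesis unfolding l(2) by (simp only: of_nat_le_iff)
qed

lemma value_difference_le:
  assumes w: "w \<in> B n" "w' \<in> B n" "w \<noteq> 0" "w' \<noteq> 0" and n: "n \<ge> 1"
    and rel: "veq (e w) (e w' * Y \<alpha>)" and supp: "\<forall>i\<ge>d. \<alpha> i = 0"
  shows "\<bar>\<alpha> i\<bar> \<le> int (L * n)"
proof -
  have "veq (inverse (Y \<alpha>) * (e w' * Y \<alpha>)) (inverse (Y \<alpha>) * e w)" using rel veq_sym veq_mult by blast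
  moreover have "inverse (Y \<alpha>) * (e w' * Y \<alpha>) = e w'" by simp
  moreover have "inverse (Y \<alpha>) * e w = e w * Y (\<lambda>i. 0 - \<alpha> i)" by (simp only: Y_diff Y_0) (simp add: field_simps)
  ultimately have rel': "veq (e w') (e w * Y (\<lambda>i. 0 - \<alpha> i))" by (simp only:)
  show ?thesis
  proof (cases "i < d")
    case True
    then show ?thesis
      using value_difference_le_pos[OF w n rel supp True]
        value_difference_le_pos[OF w(2,1,4,3) n rel' _ True] supp by (cases "\<alpha> i > 0"; cases "\<alpha> i = 0") auto
  qed (use supp in auto)
qed

text \<open>The size of \<open>U\<close> is the multiplicity with which \<open>B\<close> fills the lattice of values; it is the same
constant for all degrees.\<close>
lemma max_reduced_set:
  obtains U m where "U \<subseteq> B m" "finite U" "0 \<notin> U" "vind U" "reduced U"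
    "\<And>U' m'. U' \<subseteq> B m' \<Longrightarrow> finite U' \<Longrightarrow> 0 \<notin> U' \<Longrightarrow> vind U' \<Longrightarrow> reduced U' \<Longrightarrow> card U' \<le> card U"
proof -
  define P where "P U \<longleftrightarrow> (\<exists>m. U \<subseteq> B m) \<and> finite U \<and> 0 \<notin> U \<and> vind U \<and> reduced U" for U
  have "P {1}" using one_mem singleton_reduced by (auto simp: P_def)
  moreover have "\<forall>U. P U \<longrightarrow> card U < Suc L" using reduced_card_le by (auto simp: P_def less_Suc_eq_le)
  ultimately have am: "P (arg_max card P) \<and> (\<forall>U. P U \<longrightarrow> card U \<le> card (arg_max card P))"
    by (rule arg_max_nat_lemma)
  define U where "U = arg_max card P"
  have PU: "P U" and max: "\<And>U'. P U' \<Longrightarrow> card U' \<le> card U" using am by (simp_all add: U_def)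
  obtain m where "U \<subseteq> B m" using PU unfolding P_def by blast
  moreover have "card U' \<le> card U" if "U' \<subseteq> B m'" "finite U'" "0 \<notin> U'" "vind U'" "reduced U'" for U' m'
    by (rule max) (use that in \<open>auto simp: P_def\<close>)
  ultimately show thesis using that[of U m] PU unfolding P_def by blast
qed

text \<open>Let \<open>T\<close> be the set of values of \<open>W\<close> in its richest coset, translated into a cube of side
\<open>N = L * p\<close>. The values of products of \<open>k\<close> elements of \<open>W\<close>, a monomial with exponents in this
cube and \<open>h\<close> form a translate of the thickened sumset of \<open>T\<close>. Multiplying by \<open>U\<close> one stays in \<open>Z\<close>,
so \<open>dim Z\<close> is at least \<open>card U\<close> times the size of the sumset, while \<open>dim W \<le> card U * card T\<close> by the
maximality of \<open>U\<close>: the multiplicity is the same on both sides. The element \<open>h\<close> serves to adjust the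
degree.\<close>
lemma key_inequality:
  assumes U: "U \<subseteq> B m" "finite U" "0 \<notin> U" "vind U" "reduced U"
    and max: "\<And>U' m'. U' \<subseteq> B m' \<Longrightarrow> finite U' \<Longrightarrow> 0 \<notin> U' \<Longrightarrow> vind U' \<Longrightarrow> reduced U' \<Longrightarrow> card U' \<le> card U"
    and W: "subspace W" "W \<subseteq> B p" and p: "p \<ge> 1" and h: "h \<in> B q" "h \<noteq> 0"
    and Z: "fin_dim Z" "\<And>w b. (\<And>j. j < k \<Longrightarrow> w j \<in> W) \<Longrightarrow> b \<in> B ((d * (L * p) + 1) * a + m + q) \<Longrightarrow> (\<Prod>j<k. w j) * b \<in> Z"
  shows "k ^ d * dim W \<le> dim Z + k ^ d * (card U * (d * (L + 1) ^ (d - 1)) * p ^ (d - 1))"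
proof (cases "W = {0}")
  case True
  then show ?thesis by (simp add: dim_zero_subspace)
next
  case False
  have fdW: "fin_dim W" using fin_dim_subspace[OF fin_dim_B W(2,1)] .
  obtain U' w0 T where U': "U' \<subseteq> W" "finite U'" "0 \<notin> U'" "vind U'" "reduced U'" and w0: "w0 \<in> W" "w0 \<noteq> 0"
    and T: "finite T" "T \<noteq> {}" "\<And>\<alpha>. \<alpha> \<in> T \<Longrightarrow> (\<forall>i\<ge>d. \<alpha> i = 0) \<and> (\<exists>w\<in>W. w \<noteq> 0 \<and> veq (e w) (e w0 * Y \<alpha>))"
    and dimW: "dim W \<le> card U' * card T"
    by (rule coset_with_many_values[OF fdW W(1) False]) blast
  define N where "N = L * p"
  (* the coset multiplicity of W is at most the maximal one *)
  have "card U' \<le> card U" using max[of U' p] U' W by auto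
  then have dimW': "dim W \<le> card U * card T" using dimW by (meson le_trans mult_le_mono1)
  have diff: "\<bar>\<alpha> i - \<beta> i\<bar> \<le> int N" if \<alpha>: "\<alpha> \<in> T" and \<beta>: "\<beta> \<in> T" for \<alpha> \<beta> i
  proof -
    obtain w where w: "w \<in> W" "w \<noteq> 0" "veq (e w) (e w0 * Y \<alpha>)" using T(3)[OF \<alpha>] by blast
    obtain w' where w': "w' \<in> W" "w' \<noteq> 0" "veq (e w') (e w0 * Y \<beta>)" using T(3)[OF \<beta>] by blast
    have "Y (\<lambda>i. \<alpha> i - \<beta> i) * (e w0 * Y \<beta>) = e w0 * Y \<alpha>" by (simp add: Y_diff)
    then have "veq (e w0 * Y \<alpha>) (e w' * Y (\<lambda>i. \<alpha> i - \<beta> i))"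
      using veq_mult[OF veq_sym[OF w'(3)], of "Y (\<lambda>i. \<alpha> i - \<beta> i)"]
      by (simp only: mult.commute[of _ "e w'"])
    then have ww': "veq (e w) (e w' * Y (\<lambda>i. \<alpha> i - \<beta> i))" by (rule veq_trans[OF w(3)])
    have "w \<in> B p" "w' \<in> B p" using w(1) w'(1) W(2) by auto
    moreover have "\<forall>i\<ge>d. \<alpha> i - \<beta> i = 0" using T(3)[OF \<alpha>] T(3)[OF \<beta>] by simp
    ultimately show ?thesis unfolding N_def using value_difference_le[OF _ _ w(2) w'(2) p ww'] by blast
  qed
  (* the corner of the least box that contains T *)
  define \<tau>0 where "\<tau>0 i = Min ((\<lambda>\<alpha>. \<alpha> i) ` T)" for i
  have \<tau>0_le: "\<tau>0 i \<le> \<alpha> i" if "\<alpha> \<in> T" for \<alpha> i unfolding \<tau>0_def using T(1) that by (intro Min_le) auto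
  have \<tau>0_in: "\<exists>\<beta>\<in>T. \<tau>0 i = \<beta> i" for i
  proof -
    have "\<tau>0 i \<in> (\<lambda>\<alpha>. \<alpha> i) ` T" unfolding \<tau>0_def using T(1,2) by (intro Min_in) auto
    then show ?thesis by blast
  qed
  define T' where "T' = (\<lambda>\<alpha> i. \<alpha> i - \<tau>0 i) ` T"
  have "inj_on (\<lambda>\<alpha> i. \<alpha> i - \<tau>0 i) T"
  proof (rule inj_onI)
    fix \<alpha> \<beta> assume eq: "(\<lambda>i. \<alpha> i - \<tau>0 i) = (\<lambda>i. \<beta> i - \<tau>0 i)"
    show "\<alpha> = \<beta>" using fun_cong[OF eq] by auto
  qed
  then have card_T': "card T' = card T" unfolding T'_def by (rule card_image)
  have T'_cube: "T' \<subseteq> cube d N"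
  proof
    fix \<gamma> assume "\<gamma> \<in> T'"
    then obtain \<alpha> where \<alpha>: "\<alpha> \<in> T" "\<gamma> = (\<lambda>i. \<alpha> i - \<tau>0 i)" by (auto simp: T'_def)
    have "0 \<le> \<gamma> i \<and> \<gamma> i \<le> int N" for i
    proof -
      obtain \<beta> where "\<beta> \<in> T" "\<tau>0 i = \<beta> i" using \<tau>0_in by blast
      then show ?thesis using diff[OF \<alpha>(1), of \<beta> i] \<tau>0_le[OF \<alpha>(1), of i] by (simp add: \<alpha>(2))
    qed
    moreover have "\<gamma> i = 0" if "i \<ge> d" for i
    proof -
      obtain \<beta> where "\<beta> \<in> T" "\<tau>0 i = \<beta> i" using \<tau>0_in by blast
      then show ?thesis using T(3)[of \<beta>] T(3)[OF \<alpha>(1)] that by (simp add: \<alpha>(2))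
    qed
    ultimately show "\<gamma> \<in> cube d N" by (simp add: cube_def)
  qed
  define g0 where "g0 = e w0 * Y \<tau>0"
  have T'_value: "\<exists>w. w \<in> W \<and> veq (e w) (g0 * Y \<gamma>)" if \<gamma>T: "\<gamma> \<in> T'" for \<gamma>
  proof -
    obtain \<alpha> where \<alpha>: "\<alpha> \<in> T" "\<gamma> = (\<lambda>i. \<alpha> i - \<tau>0 i)" using \<gamma>T by (auto simp: T'_def)
    have "g0 * Y \<gamma> = e w0 * Y \<alpha>" by (simp add: g0_def \<alpha>(2) Y_diff)
    then show ?thesis using T(3)[OF \<alpha>(1)] by auto
  qed
  define \<omega> where "\<omega> \<gamma> = (SOME w. w \<in> W \<and> veq (e w) (g0 * Y \<gamma>))" for \<gamma>
  have \<omega>: "\<omega> \<gamma> \<in> W \<and> veq (e (\<omega> \<gamma>)) (g0 * Y \<gamma>)" if "\<gamma> \<in> T'" for \<gamma>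
    unfolding \<omega>_def by (rule someI_ex[OF T'_value[OF that]])
  define A where "A = thick_sumset d N k T'"
  define g where "g = g0 ^ k * (e (x 0) ^ (d * N + 1) * e h)"
  have A: "\<exists>\<tau> b. (\<forall>j<k. \<tau> j \<in> T') \<and> b \<in> cube d N \<and> \<gamma> = (\<lambda>i. (\<Sum>j<k. \<tau> j i) + b i)" if "\<gamma> \<in> A" for \<gamma>
    using that by (auto simp: A_def thick_sumset_def)
  have A_value: "\<exists>z. veq (e z) (g * Y \<gamma>) \<and> (\<forall>u\<in>U. z * u \<in> Z)" if \<gamma>A: "\<gamma> \<in> A" for \<gamma>
  proof -
    obtain \<tau> b where \<tau>: "\<forall>j<k. \<tau> j \<in> T'" and b: "b \<in> cube d N" and \<gamma>: "\<gamma> = (\<lambda>i. (\<Sum>j<k. \<tau> j i) + b i)"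
      using A[OF \<gamma>A] by blast
    let ?z = "(\<Prod>j<k. \<omega> (\<tau> j)) * (mon (d * N + 1) b * h)"
    have "veq (\<Prod>j<k. e (\<omega> (\<tau> j))) (\<Prod>j<k. g0 * Y (\<tau> j))" using \<omega> \<tau> by (intro veq_prod) auto
    then have "veq (e ?z) ((\<Prod>j<k. g0 * Y (\<tau> j)) * (e (x 0) ^ (d * N + 1) * Y b * e h))"
      unfolding e_mult e_prod e_mon_cube[OF b] by (intro veq_mult2 veq_refl)
    moreover have "(\<Prod>j<k. g0 * Y (\<tau> j)) * (e (x 0) ^ (d * N + 1) * Y b * e h) = g * Y \<gamma>"
      unfolding g_def \<gamma> Y_add Y_sum prod.distrib by (simp only: prod_constant card_lessThan mult_ac)
    moreover have "?z * u \<in> Z" if "u \<in> U" for u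
    proof -
      have "mon (d * N + 1) b * h * u \<in> B ((d * N + 1) * a + q + m)"
        using that U(1) h by (intro mult_mem mon_cube_mem b) auto
      then have "mon (d * N + 1) b * h * u \<in> B ((d * (L * p) + 1) * a + m + q)" by (simp add: N_def ac_simps)
      then have "(\<Prod>j<k. \<omega> (\<tau> j)) * (mon (d * N + 1) b * h * u) \<in> Z" using \<omega> \<tau> by (intro Z(2)) auto
      then show ?thesis by (simp only: mult.assoc)
    qed
    ultimately show ?thesis by (intro exI[of _ ?z]) (simp only:, blast)
  qed
  define z where "z \<gamma> = (SOME z. veq (e z) (g * Y \<gamma>) \<and> (\<forall>u\<in>U. z * u \<in> Z))" for \<gamma>
  have z: "veq (e (z \<gamma>)) (g * Y \<gamma>) \<and> (\<forall>u\<in>U. z \<gamma> * u \<in> Z)" if "\<gamma> \<in> A" for \<gamma>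
    unfolding z_def by (rule someI_ex[OF A_value[OF that]])
  have "card A * card U \<le> dim Z"
  proof (rule product_dim_bound[OF U(2-5), where z = z and g = g])
    show "finite A" unfolding A_def using T(1) by (intro finite_thick_sumset) (simp add: T'_def)
    show "\<forall>i\<ge>d. \<gamma> i = 0" if "\<gamma> \<in> A" for \<gamma>
    proof (intro allI impI)
      fix i assume i: "d \<le> i"
      obtain \<tau> b where \<tau>: "\<forall>j<k. \<tau> j \<in> T'" "b \<in> cube d N" "\<gamma> = (\<lambda>i. (\<Sum>j<k. \<tau> j i) + b i)"
        using A[OF \<open>\<gamma> \<in> A\<close>] by blast
      have "\<tau> j i = 0" if "j < k" for j using \<tau>(1) that T'_cube i by (auto simp: cube_def)
      then show "\<gamma> i = 0" using \<tau>(2,3) i by (simp add: cube_def)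
    qed
    show "g \<noteq> 0" using w0 h x_nonzero by (simp add: g_def g0_def e_eq_0_iff)
  qed (use z Z in auto)
  moreover have "k ^ d * card T \<le> card A + k ^ d * (d * (N + 1) ^ (d - 1))"
    using card_thick_sumset[OF T'_cube, of k] by (simp add: A_def card_T')
  then have "card U * (k ^ d * card T) \<le> card U * card A + card U * (k ^ d * (d * (N + 1) ^ (d - 1)))"
    using mult_le_mono2[of _ _ "card U"] by (simp only: distrib_left[symmetric])
  moreover have "(N + 1) ^ (d - 1) \<le> ((L + 1) * p) ^ (d - 1)"
    using p by (intro power_mono) (auto simp: N_def)
  then have "card U * (k ^ d * (d * (N + 1) ^ (d - 1))) \<le> card U * (k ^ d * (d * ((L + 1) * p) ^ (d - 1)))"
    by (intro mult_le_mono2)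
  moreover have "card U * (k ^ d * (d * ((L + 1) * p) ^ (d - 1))) = k ^ d * (card U * (d * (L + 1) ^ (d - 1)) * p ^ (d - 1))"
    by (simp only: power_mult_distrib mult_ac)
  moreover have "k ^ d * dim W \<le> card U * (k ^ d * card T)"
    using mult_le_mono2[OF dimW', of "k ^ d"] by (simp only: mult_ac)
  moreover have "card U * card A = card A * card U" by (rule mult.commute)
  ultimately show ?thesis by linarith
qed

text \<open>The monomials with exponents in a cube, multiplied by \<open>h\<close>, have different values.\<close>
lemma dim_B_ge:
  assumes h: "h \<in> B q" "h \<noteq> 0" shows "(N + 1) ^ d \<le> dim (B ((d * N + 1) * a + q))"
proof -
  have "card (cube d N) \<le> dim (B ((d * N + 1) * a + q))"
  proof (rule card_values_le_dim[OF finite_cube _ _ fin_dim_B, where g = "e (x 0) ^ (d * N + 1) * e h"])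
    fix \<beta> assume \<beta>: "\<beta> \<in> cube d N"
    have "veq (e (mon (d * N + 1) \<beta> * h)) (e (x 0) ^ (d * N + 1) * e h * Y \<beta>)"
      unfolding e_mult e_mon_cube[OF \<beta>] by (simp only: mult_ac veq_refl)
    then show "\<exists>z\<in>B ((d * N + 1) * a + q). veq (e z) (e (x 0) ^ (d * N + 1) * e h * Y \<beta>)"
      using mult_mem[OF mon_cube_mem[OF \<beta>] h(1)] by blast
  qed (use h x_nonzero in \<open>auto simp: cube_def e_eq_0_iff\<close>)
  then show ?thesis by (simp add: card_cube)
qed

end

context approximable_graded_algebra
begin

text \<open>By approximability the symmetric powers of some \<open>B a\<close> fill at least half of \<open>B (n * a)\<close> for large
\<open>n\<close>, so a transcendence basis in \<open>B a\<close> controls the growth in degrees divisible by \<open>a\<close>; any other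
degree is reached by multiplying with a nonzero element. The last conclusion is \<open>key_inequality\<close> with
the auxiliary degree \<open>r\<close> free, provided that it is large in terms of \<open>p\<close>.\<close>
lemma polynomial_growth_estimates:
  obtains d D E :: nat and c :: real and R :: "nat \<Rightarrow> nat"
  where "c > 0" "\<And>n. n \<ge> 1 \<Longrightarrow> dim (B n) \<le> D * n ^ d"
    "\<forall>\<^sub>F n in sequentially. c * real n ^ d \<le> real (dim (B n))"
    "\<And>p r k W Z. p \<ge> 1 \<Longrightarrow> R p \<le> r \<Longrightarrow> subspace W \<Longrightarrow> W \<subseteq> B p \<Longrightarrow> subspace Z \<Longrightarrow> Z \<subseteq> B (k * p + r) \<Longrightarrow>
      (\<And>w b. (\<And>j. j < k \<Longrightarrow> w j \<in> W) \<Longrightarrow> b \<in> B r \<Longrightarrow> (\<Prod>j<k. w j) * b \<in> Z) \<Longrightarrow>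
      k ^ d * dim W \<le> dim Z + k ^ d * (d * (E * p ^ (d - 1)))"
proof -
  obtain N0 where N0: "\<And>n. n \<ge> N0 \<Longrightarrow> B n \<noteq> {0}" using eventually_nonzero by blast
  have nonzero_element: "\<exists>h\<in>B q. h \<noteq> 0" if "q \<ge> N0" for q
    using N0[OF that] subspace_0[OF subspace_component[of q]] by blast
  obtain p0 where p0: "p0 \<ge> 1" "\<And>p. p \<ge> p0 \<Longrightarrow>
      liminf (\<lambda>n. ereal (real (dim (sym_image n p)) / real (dim (B (n * p))))) > ereal (1 - 1 / 2)"
    using approximable[of "1 / 2"] by auto
  (* a degree that is approximable with epsilon = 1/2 and has nonzero elements *)
  define a where "a = max p0 N0"
  have a: "a \<ge> 1" "a \<ge> p0" "a \<ge> N0" using p0(1) by (auto simp: a_def)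
  have "\<forall>\<^sub>F n in sequentially. ereal (1 - 1 / 2) < ereal (real (dim (sym_image n a)) / real (dim (B (n * a))))"
    using less_LiminfD[OF p0(2)[OF a(2)]] .
  then obtain n1 where n1: "\<And>n. n \<ge> n1 \<Longrightarrow> 1 / 2 < real (dim (sym_image n a)) / real (dim (B (n * a)))"
    by (auto simp: eventually_sequentially)
  have half: "dim (B (n * a)) \<le> 2 * dim (sym_image n a)" if "n \<ge> n1" for n
  proof (cases "dim (B (n * a)) = 0")
    case False
    then have "real (dim (B (n * a))) < 2 * real (dim (sym_image n a))" using n1[OF that] by (simp add: field_simps)
    then show ?thesis by linarith
  qed simp
  obtain S where S: "S \<subseteq> B a" "independent S" "B a \<subseteq> span S" "finite S"
    by (rule fin_dim_basis[OF fin_dim_component[of a] order_refl]) blast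
  have span_S: "span S = B a" using S(3) span_minimal[OF S(1) subspace_component] by (rule subset_antisym[rotated])
  have "S \<noteq> {}"
  proof
    assume "S = {}"
    then have "B a = {0}" using span_S span_empty by metis
    with N0[OF a(3)] show False ..
  qed
  have S0: "0 \<notin> S" using S(2) dependent_zero[of S] by metis
  from transcendence_basis[OF S(4) \<open>S \<noteq> {}\<close> S0]
  obtain x d where x: "\<And>i. i \<le> d \<Longrightarrow> x i \<in> S \<and> \<not> algebraic (x i) (x ` {..<i})" and g: "growth S d"
    by (elim exE conjE) metis
  obtain C where C: "\<And>n. dim (prods n S) \<le> C * (n + 1) ^ d" using g by (auto simp: growth_def)
  have sym: "sym_image n a = prods n S" for n using prods_span[of n S] by (simp add: sym_image_eq_prods span_S)
  define D where "D = 2 * C * (N0 + n1 + 3) ^ d"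
  have growth_D: "dim (B m) \<le> D * m ^ d" if "m \<ge> 1" for m
  proof -
    define n where "n = m + N0 + n1 + 1"
    have "n \<le> n * a" using a(1) by simp
    then have q: "n * a - m \<ge> N0" "(n * a - m) + m = n * a" by (auto simp: n_def)
    obtain h where h: "h \<in> B (n * a - m)" "h \<noteq> 0" using nonzero_element[OF q(1)] by blast
    have "dim (B m) \<le> dim (B (n * a))"
      using mult_mem[OF h(1), of _ m] by (intro dim_le_of_mult[OF h(2) fin_dim_component]) (simp add: q(2))
    also have "\<dots> \<le> 2 * dim (prods n S)" using half[of n] by (simp add: n_def sym)
    also have "\<dots> \<le> 2 * (C * (n + 1) ^ d)" using C by (intro mult_le_mono2)
    also have "n + 1 \<le> (N0 + n1 + 3) * m" using \<open>m \<ge> 1\<close> by (cases m) (auto simp: n_def)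
    then have "2 * (C * (n + 1) ^ d) \<le> 2 * (C * ((N0 + n1 + 3) * m) ^ d)" by (intro mult_le_mono2 power_mono) auto
    also have "\<dots> = D * m ^ d" by (simp only: D_def power_mult_distrib mult_ac)
    finally show ?thesis .
  qed
  have x_alg: "\<not> algebraic (x i) (x ` {..<i})" and x_mem: "x i \<in> B a" and x_nz: "x i \<noteq> 0" if "i \<le> d" for i
    using x[OF that] S(1) S0 by auto
  obtain V where "valued_algebra scale B to_frac x d a V"
    using exists_valued_algebra[OF x_alg x_mem x_nz] by blast
  then have "bounded_valued_algebra scale B to_frac x d a V D"
    by (intro bounded_valued_algebra.intro bounded_valued_algebra_axioms.intro fin_dim_component growth_D a(1))
  then interpret bounded_valued_algebra scale B to_frac x d a V D .
  obtain U m where U: "U \<subseteq> B m" "finite U" "0 \<notin> U" "vind U" "reduced U"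
    and max: "\<And>U' m'. U' \<subseteq> B m' \<Longrightarrow> finite U' \<Longrightarrow> 0 \<notin> U' \<Longrightarrow> vind U' \<Longrightarrow> reduced U' \<Longrightarrow> card U' \<le> card U"
    by (rule max_reduced_set) blast
  define c where "c = (1 / (2 * (real d + 1) * real a)) ^ d"
  show thesis
  proof (rule that[where c = c and D = D and d = d and R = "\<lambda>p. (d * (L * p) + 1) * a + m + N0" and E = "card U * (L + 1) ^ (d - 1)"])
    show "c > 0" using a(1) by (simp add: c_def)
    show "dim (B n) \<le> D * n ^ d" if "n \<ge> 1" for n by (rule growth_D[OF that])
    show "\<forall>\<^sub>F n in sequentially. c * real n ^ d \<le> real (dim (B n))"
      unfolding eventually_sequentially
    proof (intro exI[of _ "2 * (a + N0)"] allI impI)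
      fix n assume n: "2 * (a + N0) \<le> n"
      define N where "N = (n - a - N0) div ((d + 1) * a)"
      define q where "q = n - (d * N + 1) * a"
      have "N * ((d + 1) * a) \<le> n - a - N0" by (simp add: N_def)
      then have "(d * N + 1) * a + N0 \<le> n" using n by (simp add: algebra_simps)
      then have q: "q \<ge> N0" "(d * N + 1) * a + q = n" by (auto simp: q_def)
      obtain h where "h \<in> B q" "h \<noteq> 0" using nonzero_element[OF q(1)] by blast
      from dim_B_ge[OF this, of N] have le: "(N + 1) ^ d \<le> dim (B n)" by (simp only: q(2))
      have lt: "n - a - N0 < (N + 1) * ((d + 1) * a)"
        using dividend_less_div_times[of "(d + 1) * a" "n - a - N0"] a(1)
        unfolding N_def[symmetric] by (simp add: add_mult_distrib)
      define P where "P = (N + 1) * ((d + 1) * a)"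
      have "n - a - N0 < P" using lt by (simp only: P_def)
      then have "n < P + (a + N0)" by (simp only: diff_diff_left less_diff_conv2 add.assoc)
      then have "n \<le> 2 * P" using n by presburger
      then have "real n \<le> real (2 * P)" by (simp only: of_nat_le_iff)
      define X where "X = 2 * (real d + 1) * real a"
      have "X > 0" using a(1) by (simp add: X_def)
      moreover have "real n \<le> real (N + 1) * X"
        using \<open>real n \<le> real (2 * P)\<close> by (simp add: P_def X_def algebra_simps)
      ultimately have "1 / X * real n \<le> real (N + 1)" by (simp add: pos_divide_le_eq)
      then have "(1 / X * real n) ^ d \<le> real (N + 1) ^ d"
        using \<open>X > 0\<close> by (intro power_mono) simp_all
      also have "\<dots> \<le> real (dim (B n))" using le by (simp only: of_nat_power[symmetric] of_nat_le_iff)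
      finally show "c * real n ^ d \<le> real (dim (B n))" by (simp only: c_def X_def power_mult_distrib)
    qed
    fix p r k W Z
    assume h: "p \<ge> 1" "(d * (L * p) + 1) * a + m + N0 \<le> r" "subspace W" "W \<subseteq> B p" "subspace Z" "Z \<subseteq> B (k * p + r)"
      "\<And>w b. (\<And>j. j < k \<Longrightarrow> w j \<in> W) \<Longrightarrow> b \<in> B r \<Longrightarrow> (\<Prod>j<k. w j) * b \<in> Z"
    define q where "q = r - ((d * (L * p) + 1) * a + m)"
    have q: "q \<ge> N0" "(d * (L * p) + 1) * a + m + q = r" using h(2) by (auto simp: q_def)
    obtain y where y: "y \<in> B q" "y \<noteq> 0" using nonzero_element[OF q(1)] by blast
    have fdZ: "fin_dim Z" using fin_dim_subspace[OF fin_dim_component h(6,5)] .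
    have "k ^ d * dim W \<le> dim Z + k ^ d * (card U * (d * (L + 1) ^ (d - 1)) * p ^ (d - 1))"
    proof (rule key_inequality[OF U max h(3,4,1) y fdZ])
      fix w b assume w: "\<And>j. j < k \<Longrightarrow> w j \<in> W" and b: "b \<in> B ((d * (L * p) + 1) * a + m + q)"
      show "(\<Prod>j<k. w j) * b \<in> Z" by (rule h(7)[OF w b[unfolded q(2)]])
    qed
    then show "k ^ d * dim W \<le> dim Z + k ^ d * (d * (card U * (L + 1) ^ (d - 1) * p ^ (d - 1)))"
      by (simp only: mult_ac)
  qed
qed

end

section \<open>Limits of almost increasing sequences\<close>

text \<open>The hypothesis bounds the limit superior by the limit inferior.\<close>
lemma convergent_if_almost_increasing:
  fixes v :: "nat \<Rightarrow> real"
  assumes bdd: "\<forall>\<^sub>F n in sequentially. v n \<le> C"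
    and inc: "\<And>\<eta>. \<eta> > 0 \<Longrightarrow> \<forall>\<^sub>F p in sequentially. \<forall>\<^sub>F n in sequentially. v p - \<eta> \<le> v n"
  obtains l where "v \<longlonglongrightarrow> l"
proof -
  define S where "S = {y. \<forall>\<^sub>F n in sequentially. y \<le> v n}"
  have le_C: "y \<le> C" if "y \<in> S" for y
  proof -
    have "\<forall>\<^sub>F n in sequentially. y \<le> v n" using that by (simp add: S_def)
    from this bdd have "\<forall>\<^sub>F n in sequentially. y \<le> C" by (rule eventually_elim2) linarith
    then show ?thesis by simp
  qed
  then have bddS: "bdd_above S" by (rule bdd_aboveI)
  obtain p where "\<forall>\<^sub>F n in sequentially. v p - 1 \<le> v n"
    using eventually_happens'[OF _ inc[of 1]] by auto
  then have ne: "S \<noteq> {}" by (auto simp: S_def)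
  have "v \<longlonglongrightarrow> Sup S"
  proof (rule LIMSEQ_I)
    fix r :: real assume r: "r > 0"
    obtain y where y: "y \<in> S" "Sup S - r < y" using less_cSup_iff[OF ne bddS, of "Sup S - r"] r by auto
    have "\<forall>\<^sub>F n in sequentially. Sup S - r < v n"
    proof (rule eventually_mono)
      show "\<forall>\<^sub>F n in sequentially. y \<le> v n" using y(1) by (simp add: S_def)
    qed (use y(2) in linarith)
    moreover have "\<forall>\<^sub>F p in sequentially. v p < Sup S + r"
      using inc[of "r / 2"]
    proof (rule eventually_mono)
      fix p assume "\<forall>\<^sub>F n in sequentially. v p - r / 2 \<le> v n"
      then have "v p - r / 2 \<le> Sup S" by (intro cSup_upper bddS) (simp add: S_def)
      then show "v p < Sup S + r" using r by linarith
    qed (use r in simp)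
    ultimately have "\<forall>\<^sub>F n in sequentially. norm (v n - Sup S) < r"
      by (rule eventually_elim2) (auto simp: abs_less_iff)
    then show "\<exists>no. \<forall>n\<ge>no. norm (v n - Sup S) < r" by (simp add: eventually_sequentially)
  qed
  then show thesis by (rule that)
qed

text \<open>Let \<open>h t\<close> be the limit inferior of the tails at \<open>t\<close>. By \<open>inc\<close> the limit superior of the tails at
\<open>t\<close> is at most \<open>h t'\<close> for every \<open>t' < t\<close>, so both agree wherever \<open>h\<close> is continuous. Its
right-continuous version \<open>H\<close> is the tail of a measure; \<open>low\<close> and \<open>high\<close> ensure that no mass escapes
to infinity.\<close>
lemma weak_limit_of_almost_increasing_tails:
  fixes \<mu> :: "nat \<Rightarrow> real measure"
  assumes \<mu>: "\<And>n. real_distribution (\<mu> n)"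
    and inc: "\<And>t t' \<eta>. t' < t \<Longrightarrow> \<eta> > 0 \<Longrightarrow> \<forall>\<^sub>F p in sequentially. \<forall>\<^sub>F n in sequentially.
        measure (\<mu> p) {t..} - \<eta> \<le> measure (\<mu> n) {t'..}"
    and low: "\<And>\<eta>. \<eta> > 0 \<Longrightarrow> \<exists>s. \<forall>\<^sub>F n in sequentially. 1 - \<eta> \<le> measure (\<mu> n) {s..}"
    and high: "\<exists>C. \<forall>\<^sub>F n in sequentially. measure (\<mu> n) {C..} = 0"
  shows "\<exists>\<nu>. real_distribution \<nu> \<and> weak_conv_m \<mu> \<nu>"
proof -
  define g where "g n t = measure (\<mu> n) {t..}" for n t
  have meas: "measure (\<mu> n) A \<le> measure (\<mu> n) A'" if "A \<subseteq> A'" "A' \<in> sets borel" for n A A'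
  proof -
    interpret real_distribution "\<mu> n" by (rule \<mu>)
    show ?thesis using that by (intro finite_measure_mono) auto
  qed
  have g_le: "g n t \<le> 1" for n t
  proof -
    interpret real_distribution "\<mu> n" by (rule \<mu>)
    show ?thesis by (simp add: g_def)
  qed
  (* The supremum of the eventual lower bounds is the limit inferior. *)
  define S where "S t = {y. \<forall>\<^sub>F n in sequentially. y \<le> g n t}" for t
  define h where "h t = Sup (S t)" for t
  have S0: "0 \<in> S t" for t by (simp add: S_def g_def)
  have S_le: "y \<le> 1" if "y \<in> S t" for y t
  proof -
    have "\<forall>\<^sub>F n in sequentially. y \<le> (1::real)"
      using that unfolding S_def mem_Collect_eq by (rule eventually_mono) (rule order_trans[OF _ g_le])
    then show ?thesis by simp
  qed
  have bddS: "bdd_above (S t)" for t by (rule bdd_aboveI[OF S_le])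
  have h_upper: "y \<le> h t" if "y \<in> S t" for y t unfolding h_def by (rule cSup_upper[OF that bddS])
  have h_le: "h t \<le> 1" for t unfolding h_def using S0 S_le by (intro cSup_least) auto
  have h_ge: "0 \<le> h t" for t by (rule h_upper[OF S0])
  have h_lower: "\<forall>\<^sub>F n in sequentially. y \<le> g n t" if y: "y < h t" for y t
  proof -
    have "S t \<noteq> {}" using S0[of t] by blast
    then obtain y' where y': "y' \<in> S t" "y < y'" using less_cSup_iff[OF _ bddS] y unfolding h_def by blast
    have "\<forall>\<^sub>F n in sequentially. y' \<le> g n t" using y'(1) by (simp add: S_def)
    then show ?thesis by (rule eventually_mono) (use y'(2) in linarith)
  qed
  have h_limsup: "\<forall>\<^sub>F p in sequentially. g p t \<le> h t' + \<eta>" if "t' < t" "\<eta> > 0" for t t' \<eta>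
    using inc[OF that]
  proof (rule eventually_mono)
    fix p assume "\<forall>\<^sub>F n in sequentially. measure (\<mu> p) {t..} - \<eta> \<le> measure (\<mu> n) {t'..}"
    then have "g p t - \<eta> \<le> h t'" by (intro h_upper) (simp add: S_def g_def)
    then show "g p t \<le> h t' + \<eta>" by simp
  qed
  define H where "H x = Sup (h ` {x<..})" for x
  have bddh: "bdd_above (h ` {x<..})" for x using h_le by (intro bdd_aboveI[of _ 1]) auto
  have neh: "h ` {x<..} \<noteq> {}" for x :: real by simp
  have H_upper: "h s \<le> H x" if "x < s" for s x unfolding H_def using that by (intro cSup_upper bddh) auto
  have H_le: "H x \<le> 1" for x unfolding H_def using h_le neh by (intro cSup_least) auto
  have H_ge: "0 \<le> H x" for x using H_upper[of x "x + 1"] h_ge[of "x + 1"] by simp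
  have H_near: "\<exists>s>x. y < h s" if "y < H x" for x y
    using less_cSup_iff[OF neh bddh, of y x] that by (auto simp: H_def)
  have H_anti: "H y \<le> H x" if "x \<le> y" for x y
    unfolding H_def[of y] using that by (intro cSup_least) (auto intro!: H_upper)
  define F where "F x = 1 - H x" for x
  have F_mono: "F x \<le> F y" if "x \<le> y" for x y using H_anti[OF that] by (simp add: F_def)
  have F_right: "continuous (at_right x) F" for x
    unfolding continuous_within
  proof (rule tendstoI)
    fix r :: real assume r: "r > 0"
    obtain s where s: "s > x" "H x - r < h s" using H_near[of "H x - r" x] r by auto
    have "dist (F y) (F x) < r" if "x < y" "y < s" for y
      using H_upper[OF that(2)] s(2) H_anti[of x y] that by (simp add: F_def dist_real_def)
    then show "\<forall>\<^sub>F y in at_right x. dist (F y) (F x) < r"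
      using s(1) unfolding eventually_at_right_field by blast
  qed
  have F_bot: "(F \<longlongrightarrow> 0) at_bot"
  proof (rule tendstoI)
    fix r :: real assume r: "r > 0"
    obtain s where "\<forall>\<^sub>F n in sequentially. 1 - r / 2 \<le> measure (\<mu> n) {s..}" using low[of "r / 2"] r by auto
    then have "1 - r / 2 \<le> h s" by (intro h_upper) (simp add: S_def g_def)
    then have "dist (F y) 0 < r" if "y < s" for y
      using H_upper[OF that] H_le[of y] r by (simp add: F_def dist_real_def)
    then show "\<forall>\<^sub>F y in at_bot. dist (F y) 0 < r"
      unfolding eventually_at_bot_dense by blast
  qed
  obtain C where C: "\<forall>\<^sub>F n in sequentially. measure (\<mu> n) {C..} = 0" using high by blast
  have F_top: "(F \<longlongrightarrow> 1) at_top"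
  proof (rule tendsto_eventually)
    have "h s \<le> 0" if "C < s" for s
      unfolding h_def
    proof (rule cSup_least)
      fix y assume "y \<in> S s"
      then have "\<forall>\<^sub>F n in sequentially. y \<le> g n s" by (simp add: S_def)
      then have "\<forall>\<^sub>F n in sequentially. y \<le> 0"
        using C
      proof (rule eventually_elim2)
        fix n assume "y \<le> g n s" "measure (\<mu> n) {C..} = 0"
        moreover have "g n s \<le> measure (\<mu> n) {C..}" unfolding g_def using \<open>C < s\<close> by (intro meas) auto
        ultimately show "y \<le> 0" by simp
      qed
      then show "y \<le> 0" by simp
    qed (use S0 in auto)
    then have "H y \<le> 0" if "C \<le> y" for y unfolding H_def using that by (intro cSup_least) auto
    then have "F y = 1" if "C \<le> y" for y using H_ge[of y] that by (simp add: F_def order_antisym)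
    then show "\<forall>\<^sub>F y in at_top. F y = 1" unfolding eventually_at_top_linorder by blast
  qed
  define \<nu> where "\<nu> = interval_measure F"
  have \<nu>: "real_distribution \<nu>" unfolding \<nu>_def
    by (rule real_distribution_interval_measure[OF F_mono F_right F_bot F_top])
  have cdf_\<nu>: "cdf \<nu> = F" unfolding \<nu>_def
    by (rule cdf_interval_measure[OF F_mono F_right F_bot])
  have "weak_conv_m \<mu> \<nu>"
    unfolding weak_conv_m_def weak_conv_def cdf_\<nu>
  proof (intro allI impI LIMSEQ_I)
    fix x r :: real assume cont: "isCont F x" and r: "r > 0"
    have cdf: "cdf (\<mu> n) x = 1 - measure (\<mu> n) {x<..}" for n
    proof -
      interpret real_distribution "\<mu> n" by (rule \<mu>)
      have "{x<..} = space (\<mu> n) - {..x}" by auto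
      then show ?thesis using prob_compl[of "{..x}"] by (simp add: cdf_def)
    qed
    obtain s where s: "s > x" "H x - r / 2 < h s" using H_near[of "H x - r / 2" x] r by auto
    have "\<forall>\<^sub>F n in sequentially. h s - r / 2 \<le> g n s" using r by (intro h_lower) simp
    then have lower: "\<forall>\<^sub>F n in sequentially. H x - r < measure (\<mu> n) {x<..}"
    proof (rule eventually_mono)
      fix n assume "h s - r / 2 \<le> g n s"
      moreover have "g n s \<le> measure (\<mu> n) {x<..}" unfolding g_def using s(1) by (intro meas) auto
      ultimately show "H x - r < measure (\<mu> n) {x<..}" using s(2) by linarith
    qed
    obtain \<delta> where \<delta>: "\<delta> > 0" "\<And>y. dist y x < \<delta> \<Longrightarrow> dist (F y) (F x) < r / 2"
      using cont half_gt_zero[OF r] unfolding continuous_at_eps_delta by blast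
    have Hy: "H (x - \<delta> / 2) < H x + r / 2"
    proof -
      have "dist (x - \<delta> / 2) x < \<delta>" using \<delta>(1) by (simp add: dist_real_def)
      from \<delta>(2)[OF this] show ?thesis unfolding dist_real_def F_def by linarith
    qed
    have hy: "h (x - \<delta> / 4) \<le> H (x - \<delta> / 2)" using \<delta>(1) by (intro H_upper) simp
    have "\<forall>\<^sub>F n in sequentially. g n x \<le> h (x - \<delta> / 4) + r / 2" using \<delta>(1) r by (intro h_limsup) auto
    then have upper: "\<forall>\<^sub>F n in sequentially. measure (\<mu> n) {x<..} < H x + r"
    proof (rule eventually_mono)
      fix n assume "g n x \<le> h (x - \<delta> / 4) + r / 2"
      moreover have "measure (\<mu> n) {x<..} \<le> g n x" unfolding g_def by (intro meas) auto
      ultimately show "measure (\<mu> n) {x<..} < H x + r" using Hy hy by linarith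
    qed
    have "\<forall>\<^sub>F n in sequentially. norm (cdf (\<mu> n) x - F x) < r"
      using lower upper by (rule eventually_elim2) (auto simp: cdf F_def abs_less_iff)
    then show "\<exists>no. \<forall>n\<ge>no. norm (cdf (\<mu> n) x - F x) < r" by (simp add: eventually_sequentially)
  qed
  then show ?thesis using \<nu> by blast
qed

lemma weak_conv_imp_vague_conv:
  assumes \<mu>: "\<And>n. real_distribution (\<mu> (n + N))" and \<nu>: "real_distribution \<nu>" and w: "weak_conv_m (\<lambda>n. \<mu> (n + N)) \<nu>"
  shows "vague_conv \<mu> \<nu>"
  unfolding vague_conv_def
proof (intro allI impI)
  fix h :: "real \<Rightarrow> real" assume h: "continuous_on UNIV h \<and> compactly_supported h"
  have "compact (h ` closure {x. h x \<noteq> 0})"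
    using h by (intro compact_continuous_image) (auto simp: compactly_supported_def intro: continuous_on_subset[of UNIV])
  then have "bounded (h ` closure {x. h x \<noteq> 0})" by (rule compact_imp_bounded)
  then obtain b where b: "\<forall>y\<in>h ` closure {x. h x \<noteq> 0}. norm y \<le> b"
    unfolding bounded_iff by blast
  have "norm (h x) \<le> max b 0" for x
  proof (cases "h x = 0")
    case False
    then have "x \<in> closure {x. h x \<noteq> 0}" using closure_subset[of "{x. h x \<noteq> 0}"] by blast
    then have "norm (h x) \<le> b" using b by blast
    then show ?thesis by simp
  qed simp
  moreover have "isCont h x" for x using h by (simp add: continuous_on_eq_continuous_at)
  ultimately have "(\<lambda>n. LINT x|\<mu> (n + N). h x) \<longlonglongrightarrow> (LINT x|\<nu>. h x)"
    using weak_conv_imp_integral_bdd_continuous_conv[OF \<mu> \<nu> w, of h "max b 0"] by blast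
  then show "(\<lambda>n. LINT x|\<mu> n. h x) \<longlonglongrightarrow> (LINT x|\<nu>. h x)" by (rule LIMSEQ_offset)
qed

section \<open>Quasi-filtered algebras\<close>

context vector_space
begin

lemma subspace_eq_of_dim_eq:
  assumes "fin_dim W" "V \<subseteq> W" "subspace V" "dim V = dim W"
  shows "V = W"
proof (rule ccontr)
  assume "V \<noteq> W"
  then obtain w where w: "w \<in> W" "w \<notin> V" using assms(2) by blast
  obtain Y where Y: "Y \<subseteq> V" "independent Y" "V \<subseteq> span Y" "card Y = dim V" "finite Y"
    by (rule fin_dim_basis[OF assms(1,2)]) blast
  have "w \<notin> span Y" using w(2) span_minimal[OF Y(1) assms(3)] by blast
  then have "independent (insert w Y)" using Y(2) by (rule independent_insertI)
  then have "card (insert w Y) \<le> dim W"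
    using independent_card_le_fin_dim(2)[OF assms(1)] w(1) Y(1) assms(2) by blast
  moreover have "w \<notin> Y" using w(2) Y(1) by blast
  ultimately show False using Y(4,5) assms(4) by simp
qed

text \<open>The supremum that defines the level of an element is attained: by left continuity the integer-valued
rank is constant just below \<open>t\<close>, so the subspace there equals the one at \<open>t\<close>.\<close>
lemma mem_filtration_iff:
  assumes W: "fin_dim W" and F: "R_filtration W F" and x: "x \<in> W"
  shows "x \<in> F t \<longleftrightarrow> ereal t \<le> filt_lambda F x"
proof
  note Fs = R_filtration_simps[OF F]
  show "ereal t \<le> filt_lambda F x" if "x \<in> F t" unfolding filt_lambda_def using that by (intro SUP_upper) simp
  assume t: "ereal t \<le> filt_lambda F x"
  have below: "x \<in> F s" if "s < t" for s
  proof -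
    have "ereal s < filt_lambda F x" using that t by (metis ereal_less_eq(3) less_le_trans less_ereal.simps(1))
    then obtain a where "x \<in> F a" "s < a" unfolding filt_lambda_def less_SUP_iff by auto
    then show ?thesis using Fs(3)[of s a] by auto
  qed
  have "((\<lambda>t. real (dim (F t))) \<longlongrightarrow> real (dim (F t))) (at_left t)"
    using Fs(6)[of t] by (simp add: continuous_within)
  then have "\<forall>\<^sub>F s in at_left t. dist (real (dim (F s))) (real (dim (F t))) < 1" by (rule tendstoD) simp
  moreover have "\<forall>\<^sub>F s in at_left t. s < t" by (simp add: eventually_at_filter)
  ultimately have "\<forall>\<^sub>F s in at_left t. s < t \<and> dist (real (dim (F s))) (real (dim (F t))) < 1"
    by (rule eventually_conj[rotated])
  then obtain s where s: "s < t" "dist (real (dim (F s))) (real (dim (F t))) < 1"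
    using eventually_happens'[OF trivial_limit_at_left_real] by blast
  then have "dim (F t) = dim (F s)" by (simp add: dist_real_def)
  then have "F t = F s"
    using subspace_eq_of_dim_eq[OF fin_dim_subspace[OF W Fs(2) Fs(1)] Fs(3) Fs(1)] s(1) by simp
  then show "x \<in> F t" using below[OF s(1)] by simp
qed

end

lemma nat_div_ratio_tendsto:
  assumes p: "p \<ge> (1::nat)"
  shows "(\<lambda>n. real ((n - R) div p) / real n) \<longlonglongrightarrow> 1 / real p"
proof (rule real_tendsto_sandwich)
  have "(\<lambda>n. 1 / real p - (real R + real p) / real p * (1 / real n)) \<longlonglongrightarrow> 1 / real p - (real R + real p) / real p * 0"
    by (intro tendsto_intros lim_1_over_n)
  then show "(\<lambda>n. 1 / real p - (real R + real p) / real p * (1 / real n)) \<longlonglongrightarrow> 1 / real p" by simp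
  show "\<forall>\<^sub>F n in sequentially. 1 / real p - (real R + real p) / real p * (1 / real n) \<le> real ((n - R) div p) / real n"
    using eventually_ge_at_top[of 1]
  proof (rule eventually_mono)
    fix n :: nat assume n: "1 \<le> n"
    have "n - R < p + (n - R) div p * p" using p by (intro dividend_less_div_times) simp
    then have "n \<le> (n - R) div p * p + R + p" by linarith
    then have "real n \<le> real ((n - R) div p * p + R + p)" by (simp only: of_nat_le_iff)
    then have "(real n - real R - real p) / real p \<le> real ((n - R) div p)"
      using p by (simp add: pos_divide_le_eq)
    then have "(real n - real R - real p) / real p / real n \<le> real ((n - R) div p) / real n"
      by (rule divide_right_mono) simp
    moreover have "1 / real p - (real R + real p) / real p * (1 / real n) = (real n - real R - real p) / real p / real n"
      using p n by (simp add: field_simps)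
    ultimately show "1 / real p - (real R + real p) / real p * (1 / real n) \<le> real ((n - R) div p) / real n" by simp
  qed
  show "\<forall>\<^sub>F n in sequentially. real ((n - R) div p) / real n \<le> 1 / real p"
    using eventually_ge_at_top[of 1]
  proof (rule eventually_mono)
    fix n :: nat assume n: "1 \<le> n"
    have "(n - R) div p * p \<le> n" by (meson div_times_less_eq_dividend diff_le_self le_trans)
    then have "real ((n - R) div p * p) \<le> real n" by (simp only: of_nat_le_iff)
    then show "real ((n - R) div p) / real n \<le> 1 / real p" using n p by (simp add: field_simps)
  qed
qed simp

locale quasi_filtered_algebra = approximable_graded_algebra scale B
  for scale :: "'k::field \<Rightarrow> 'b::idom \<Rightarrow> 'b" and B :: "nat \<Rightarrow> 'b set" +
  fixes \<F> :: "nat \<Rightarrow> real \<Rightarrow> 'b set" and f :: "nat \<Rightarrow> real"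
  assumes filtration: "R_filtration (B n) (\<F> n)"
    and quasi: "quasi_filtered B \<F> f"
    and lambda_bound: "(SUP n\<in>{1..}. lambda_max (B n) (\<F> n) / ereal (real n)) < \<infinity>"
    and f_sublinear: "(\<lambda>n. f n / real n) \<longlonglongrightarrow> 0"
begin

lemmas F_simps = R_filtration_simps[OF filtration]
lemmas mem_F_iff = mem_filtration_iff[OF fin_dim_component filtration]

lemma nonzero_element: "B n \<noteq> {0} \<Longrightarrow> \<exists>x\<in>B n. x \<noteq> 0"
  using subspace_0[OF subspace_component[of n]] by blast

lemma F_nonzero_iff: "\<F> n t \<noteq> {0} \<longleftrightarrow> (\<exists>x\<in>\<F> n t. x \<noteq> 0)"
  using subspace_0[OF F_simps(1)[of n t]] by blast

text \<open>Quasi-filteredness, for \<open>k\<close> factors of one degree and one factor of another degree.\<close>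
lemma product_level:
  obtains n0 where "\<And>p r k s t w b. p \<ge> n0 \<Longrightarrow> r \<ge> n0 \<Longrightarrow> k \<ge> 1 \<Longrightarrow> (\<And>j. j < k \<Longrightarrow> w j \<in> \<F> p t) \<Longrightarrow> b \<in> \<F> r s \<Longrightarrow>
     (\<Prod>j<k. w j) * b \<in> \<F> (k * p + r) (real k * (t - f p) + (s - f r))"
proof -
  obtain n0 where n0: "\<And>l (e :: nat \<Rightarrow> nat) x. l \<ge> 2 \<Longrightarrow> (\<forall>i<l. e i \<ge> n0 \<and> x i \<in> B (e i)) \<Longrightarrow>
      (\<Sum>i<l. filt_lambda (\<F> (e i)) (x i) - ereal (f (e i))) \<le> filt_lambda (\<F> (\<Sum>i<l. e i)) (\<Prod>i<l. x i)"
    using quasi unfolding quasi_filtered_def by blast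
  have "(\<Prod>j<k. w j) * b \<in> \<F> (k * p + r) (real k * (t - f p) + (s - f r))"
    if p: "p \<ge> n0" and r: "r \<ge> n0" and k: "k \<ge> 1" and w: "\<And>j. j < k \<Longrightarrow> w j \<in> \<F> p t" and b: "b \<in> \<F> r s"
    for p r k s t w b
  proof -
    define e where "e i = (if i < k then p else r)" for i
    define x where "x i = (if i < k then w i else b)" for i
    define \<tau> where "\<tau> i = (if i < k then t else s)" for i
    have x: "x i \<in> \<F> (e i) (\<tau> i)" if "i < Suc k" for i using w b that by (auto simp: x_def e_def \<tau>_def)
    have xB: "x i \<in> B (e i)" if "i < Suc k" for i using x[OF that] F_simps(2) by blast
    have sum_e: "(\<Sum>i<Suc k. e i) = k * p + r" by (simp add: e_def)
    have prod_x: "(\<Prod>i<Suc k. x i) = (\<Prod>j<k. w j) * b" by (simp add: x_def)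
    have sum_\<tau>: "(\<Sum>i<Suc k. \<tau> i - f (e i)) = real k * (t - f p) + (s - f r)" by (simp add: \<tau>_def e_def)
    have prod_B: "(\<Prod>i<m. x i) \<in> B (\<Sum>i<m. e i)" if "m \<le> Suc k" for m
      using that
    proof (induction m)
      case (Suc m)
      then show ?case using mult_mem[of "\<Prod>i<m. x i" "\<Sum>i<m. e i" "x m" "e m"] xB[of m] by simp
    qed (simp add: one_mem)
    have "ereal (\<Sum>i<Suc k. \<tau> i - f (e i)) = (\<Sum>i<Suc k. ereal (\<tau> i - f (e i)))" by (rule sum_ereal[symmetric])
    also have "\<dots> \<le> (\<Sum>i<Suc k. filt_lambda (\<F> (e i)) (x i) - ereal (f (e i)))"
    proof (rule sum_mono)
      fix i assume "i \<in> {..<Suc k}"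
      then have "ereal (\<tau> i) \<le> filt_lambda (\<F> (e i)) (x i)" using x[of i] mem_F_iff[OF xB[of i]] by simp
      then have "ereal (\<tau> i) - ereal (f (e i)) \<le> filt_lambda (\<F> (e i)) (x i) - ereal (f (e i))"
        by (rule ereal_minus_mono) simp
      then show "ereal (\<tau> i - f (e i)) \<le> filt_lambda (\<F> (e i)) (x i) - ereal (f (e i))" by simp
    qed
    also have "\<dots> \<le> filt_lambda (\<F> (\<Sum>i<Suc k. e i)) (\<Prod>i<Suc k. x i)"
    proof (rule n0)
      show "2 \<le> Suc k" using k by simp
      show "\<forall>i<Suc k. n0 \<le> e i \<and> x i \<in> B (e i)" using xB p r by (simp add: e_def)
    qed
    finally have "(\<Prod>i<Suc k. x i) \<in> \<F> (\<Sum>i<Suc k. e i) (\<Sum>i<Suc k. \<tau> i - f (e i))"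
      using mem_F_iff[OF prod_B[OF order_refl]] by blast
    then show ?thesis by (simp only: sum_e prod_x sum_\<tau>)
  qed
  then show thesis by (rule that)
qed

text \<open>Every large \<open>n\<close> is \<open>k * p + r\<close> with \<open>r\<close> in a window of \<open>p\<close> consecutive degrees that begins at \<open>R\<close>.
Only finitely many spaces \<open>B r\<close> occur, so all their elements lie above a common level, and the
contribution of the last factor to the level is absorbed by \<open>n * \<eta>\<close>.\<close>
lemma eventually_power_products:
  obtains p1 where "p1 \<ge> 1" "\<And>p s \<eta> R. p \<ge> p1 \<Longrightarrow> \<eta> > 0 \<Longrightarrow> R \<ge> p1 \<Longrightarrow>
    \<forall>\<^sub>F n in sequentially. \<exists>k r. n = k * p + r \<and> R \<le> r \<and> k = (n - R) div p \<and>
      (\<forall>w b. (\<forall>j<k. w j \<in> \<F> p (real p * s)) \<longrightarrow> b \<in> B r \<longrightarrow>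
        (\<Prod>j<k. w j) * b \<in> \<F> n (real n * (s - f p / real p - \<eta>)))"
proof -
  obtain n0 where n0: "\<And>p r k s t w b. p \<ge> n0 \<Longrightarrow> r \<ge> n0 \<Longrightarrow> k \<ge> 1 \<Longrightarrow> (\<And>j. j < k \<Longrightarrow> w j \<in> \<F> p t) \<Longrightarrow> b \<in> \<F> r s \<Longrightarrow>
     (\<Prod>j<k. w j) * b \<in> \<F> (k * p + r) (real k * (t - f p) + (s - f r))"
    by (rule product_level) blast
  have "\<forall>\<^sub>F n in sequentially. \<exists>k r. n = k * p + r \<and> R \<le> r \<and> k = (n - R) div p \<and>
      (\<forall>w b. (\<forall>j<k. w j \<in> \<F> p (real p * s)) \<longrightarrow> b \<in> B r \<longrightarrow>
        (\<Prod>j<k. w j) * b \<in> \<F> n (real n * (s - f p / real p - \<eta>)))"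
    if p: "p \<ge> max n0 1" and \<eta>: "\<eta> > 0" and R: "R \<ge> max n0 1" for p s \<eta> R
  proof -
    let ?I = "{R..<R + p}"
    have "\<forall>\<^sub>F \<sigma> in at_bot. \<forall>r\<in>?I. \<F> r \<sigma> = B r"
      by (intro eventually_ball_finite) (auto intro: F_simps(5))
    from eventually_happens'[OF trivial_limit_at_bot_linorder this]
    obtain \<sigma> where \<sigma>: "\<And>r. r \<in> ?I \<Longrightarrow> \<F> r \<sigma> = B r" by blast
    (* a bound for the loss of level caused by the last factor, valid for every r in the window *)
    define M where "M = (\<Sum>r\<in>?I. \<bar>real r * (s - f p / real p) - \<sigma> + f r\<bar>)"
    have M: "real r * (s - f p / real p) - \<sigma> + f r \<le> M" if "r \<in> ?I" for r
    proof -
      have "\<bar>real r * (s - f p / real p) - \<sigma> + f r\<bar> \<le> M" unfolding M_def using that by (intro member_le_sum) auto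
      then show ?thesis by linarith
    qed
    obtain n1 where n1: "M / \<eta> < real n1" using reals_Archimedean2[of "M / \<eta>"] by blast
    show ?thesis
      unfolding eventually_sequentially
    proof (rule exI[of _ "max n1 (R + p)"], intro allI impI)
      fix n assume n: "max n1 (R + p) \<le> n"
      define k where "k = (n - R) div p"
      define r where "r = R + (n - R) mod p"
      have "R \<le> n" using n by simp
      then have nkr: "n = k * p + r" using div_mult_mod_eq[of "n - R" p] unfolding k_def r_def by linarith
      have r: "r \<in> ?I" using p by (simp add: r_def)
      have "p \<le> n - R" using n by presburger
      then have k1: "k \<ge> 1" using p unfolding k_def by (simp add: div_greater_zero_iff Suc_le_eq)
      have lev: "real n * (s - f p / real p - \<eta>) \<le> real k * (real p * s - f p) + (\<sigma> - f r)"
      proof -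
        have "M < \<eta> * real n1" using n1 \<eta> by (simp add: pos_divide_less_eq mult.commute)
        also have "\<dots> \<le> \<eta> * real n" using n \<eta> by simp
        finally have "real r * (s - f p / real p) - \<sigma> + f r \<le> \<eta> * real n" using M[OF r] by linarith
        moreover have "real n * (s - f p / real p - \<eta>) = real k * (real p * s - f p) + real r * (s - f p / real p) - \<eta> * real n"
        proof -
          have "real n * (s - f p / real p - \<eta>) = (real k * real p + real r) * (s - f p / real p) - \<eta> * real n"
            by (simp add: nkr algebra_simps)
          moreover have "real p * (s - f p / real p) = real p * s - f p" using p by (simp add: right_diff_distrib)
          ultimately show ?thesis by (simp add: distrib_right mult.assoc)
        qed
        ultimately show ?thesis by linarith
      qed
      have "(\<Prod>j<k. w j) * b \<in> \<F> n (real n * (s - f p / real p - \<eta>))"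
        if w: "\<forall>j<k. w j \<in> \<F> p (real p * s)" and b: "b \<in> B r" for w b
      proof -
        have "(\<Prod>j<k. w j) * b \<in> \<F> (k * p + r) (real k * (real p * s - f p) + (\<sigma> - f r))"
        proof (rule n0)
          show "p \<ge> n0" "r \<ge> n0" using p R r by auto
          show "b \<in> \<F> r \<sigma>" using b \<sigma>[OF r] by simp
        qed (use k1 w in auto)
        then show ?thesis using F_simps(3)[OF lev, of n] unfolding nkr[symmetric] by blast
      qed
      moreover have "R \<le> r" using r by simp
      ultimately show "\<exists>k r. n = k * p + r \<and> R \<le> r \<and> k = (n - R) div p \<and>
        (\<forall>w b. (\<forall>j<k. w j \<in> \<F> p (real p * s)) \<longrightarrow> b \<in> B r \<longrightarrow>
          (\<Prod>j<k. w j) * b \<in> \<F> n (real n * (s - f p / real p - \<eta>)))"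
        using nkr k_def by blast
    qed
  qed
  then show thesis by (intro that[of "max n0 1"]) auto
qed

lemma f_eventually_small: "\<eta> > 0 \<Longrightarrow> \<forall>\<^sub>F p in sequentially. f p / real p < \<eta>"
  using order_tendstoD(2)[OF f_sublinear] by blast

lemma lambda_max_le:
  obtains C where "\<And>n. n \<ge> 1 \<Longrightarrow> lambda_max (B n) (\<F> n) \<le> ereal (C * real n)"
proof -
  obtain C where C: "(SUP n\<in>{1..}. lambda_max (B n) (\<F> n) / ereal (real n)) \<le> ereal C"
    using lambda_bound by (metis less_imp_le less_ereal.simps(4) ereal_infty_less_eq2(1) not_le ereal_dense2 top_ereal_def)
  have "lambda_max (B n) (\<F> n) \<le> ereal (C * real n)" if n: "n \<ge> 1" for n
  proof -
    have "lambda_max (B n) (\<F> n) / ereal (real n) \<le> ereal C"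
      using n by (intro order_trans[OF SUP_upper C]) simp
    then show ?thesis using n by (simp add: ereal_divide_le_pos mult.commute)
  qed
  then show thesis by (rule that)
qed

lemma F_nonzero_le_lambda_max: "\<F> n t \<noteq> {0} \<Longrightarrow> ereal t \<le> lambda_max (B n) (\<F> n)"
proof -
  assume "\<F> n t \<noteq> {0}"
  then obtain x where x: "x \<in> \<F> n t" "x \<noteq> 0" using F_nonzero_iff by blast
  then have xB: "x \<in> B n" using F_simps(2) by blast
  have "ereal t \<le> filt_lambda (\<F> n) x" using x(1) mem_F_iff[OF xB] by simp
  also have "\<dots> \<le> lambda_max (B n) (\<F> n)" unfolding lambda_max_def using x(2) xB by (intro SUP_upper) simp
  finally show ?thesis .
qed

lemma F_nonzero_below_lambda_max: "ereal t < lambda_max (B n) (\<F> n) \<Longrightarrow> \<F> n t \<noteq> {0}"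
proof -
  assume "ereal t < lambda_max (B n) (\<F> n)"
  then obtain x where x: "x \<in> B n" "x \<noteq> 0" "ereal t < filt_lambda (\<F> n) x"
    unfolding lambda_max_def less_SUP_iff by auto
  then have "x \<in> \<F> n t" using mem_F_iff[OF x(1)] by simp
  then show ?thesis using x(2) by blast
qed

text \<open>Powers of an element of \<open>B p\<close> whose level nearly attains the maximum, multiplied by any nonzero
element of degree \<open>r\<close>, show that the sequence is almost increasing.\<close>
lemma lambda_max_converges: "\<exists>l::real. (\<lambda>n. lambda_max (B n) (\<F> n) / ereal (real n)) \<longlonglongrightarrow> ereal l"
proof -
  obtain N0 where N0: "\<And>n. n \<ge> N0 \<Longrightarrow> B n \<noteq> {0}" using eventually_nonzero by blast
  obtain C where C: "\<And>n. n \<ge> 1 \<Longrightarrow> lambda_max (B n) (\<F> n) \<le> ereal (C * real n)" using lambda_max_le by blast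
  obtain p1 where p1: "p1 \<ge> 1" "\<And>p s \<eta> R. p \<ge> p1 \<Longrightarrow> \<eta> > 0 \<Longrightarrow> R \<ge> p1 \<Longrightarrow>
    \<forall>\<^sub>F n in sequentially. \<exists>k r. n = k * p + r \<and> R \<le> r \<and> k = (n - R) div p \<and>
      (\<forall>w b. (\<forall>j<k. w j \<in> \<F> p (real p * s)) \<longrightarrow> b \<in> B r \<longrightarrow>
        (\<Prod>j<k. w j) * b \<in> \<F> n (real n * (s - f p / real p - \<eta>)))"
    by (rule eventually_power_products) blast
  define v where "v n = real_of_ereal (lambda_max (B n) (\<F> n)) / real n" for n
  have lam: "lambda_max (B n) (\<F> n) = ereal (real n * v n)" if n: "n \<ge> max N0 1" for n
  proof -
    obtain t where t: "\<F> n t = B n"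
      using eventually_happens'[OF trivial_limit_at_bot_linorder F_simps(5)[of n]] by blast
    have "ereal t \<le> lambda_max (B n) (\<F> n)" by (rule F_nonzero_le_lambda_max) (use t N0 n in simp)
    moreover have "lambda_max (B n) (\<F> n) \<le> ereal (C * real n)" using C n by simp
    ultimately have "\<bar>lambda_max (B n) (\<F> n)\<bar> \<noteq> \<infinity>" by (cases "lambda_max (B n) (\<F> n)") auto
    then show ?thesis using n by (simp add: v_def ereal_real)
  qed
  have "\<forall>\<^sub>F n in sequentially. v n \<le> C"
    using eventually_ge_at_top[of "max N0 1"]
  proof (rule eventually_mono)
    fix n assume n: "max N0 1 \<le> n"
    then have "ereal (real n * v n) \<le> ereal (C * real n)" using C[of n] lam[OF n] by simp
    then show "v n \<le> C" using n by (simp add: mult.commute)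
  qed
  moreover have "\<forall>\<^sub>F p in sequentially. \<forall>\<^sub>F n in sequentially. v p - \<eta> \<le> v n" if \<eta>: "\<eta> > 0" for \<eta>
    using eventually_conj[OF eventually_ge_at_top[of "max (max N0 1) p1"] f_eventually_small[of "\<eta> / 3"]]
  proof (rule eventually_mono)
    fix p assume p: "max (max N0 1) p1 \<le> p \<and> f p / real p < \<eta> / 3"
    define s where "s = v p - \<eta> / 3"
    have "real p * s < real p * v p" using p \<eta> by (intro mult_strict_left_mono) (auto simp: s_def)
    then have "ereal (real p * s) < lambda_max (B p) (\<F> p)" using lam[of p] p by simp
    from F_nonzero_below_lambda_max[OF this]
    obtain w where w: "w \<in> \<F> p (real p * s)" "w \<noteq> 0" unfolding F_nonzero_iff by blast
    have "\<forall>\<^sub>F n in sequentially. \<exists>k r. n = k * p + r \<and> max N0 p1 \<le> r \<and> k = (n - max N0 p1) div p \<and>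
      (\<forall>w b. (\<forall>j<k. w j \<in> \<F> p (real p * s)) \<longrightarrow> b \<in> B r \<longrightarrow>
        (\<Prod>j<k. w j) * b \<in> \<F> n (real n * (s - f p / real p - \<eta> / 3)))"
      by (rule p1(2)) (use p \<eta> in auto)
    from this eventually_ge_at_top[of "max N0 1"] show "\<forall>\<^sub>F n in sequentially. v p - \<eta> \<le> v n"
    proof (rule eventually_elim2)
      fix n assume ex: "\<exists>k r. n = k * p + r \<and> max N0 p1 \<le> r \<and> k = (n - max N0 p1) div p \<and>
        (\<forall>w b. (\<forall>j<k. w j \<in> \<F> p (real p * s)) \<longrightarrow> b \<in> B r \<longrightarrow>
          (\<Prod>j<k. w j) * b \<in> \<F> n (real n * (s - f p / real p - \<eta> / 3)))" and n: "max N0 1 \<le> n"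
      obtain k r :: nat where kr: "max N0 p1 \<le> r" "\<forall>w b. (\<forall>j<k. w j \<in> \<F> p (real p * s)) \<longrightarrow> b \<in> B r \<longrightarrow>
          (\<Prod>j<k. w j) * b \<in> \<F> n (real n * (s - f p / real p - \<eta> / 3))"
        using ex by blast
      have "B r \<noteq> {0}" using kr(1) by (intro N0) simp
      from nonzero_element[OF this] obtain b where b: "b \<in> B r" "b \<noteq> 0" by blast
      have "(\<Prod>j<k. w) * b \<in> \<F> n (real n * (s - f p / real p - \<eta> / 3))" 
        using kr(2)[THEN spec[of _ "\<lambda>_. w"], THEN spec[of _ b]] w(1) b(1) by simp
      moreover have "(\<Prod>j<k. w) * b \<noteq> 0" using w(2) b(2) by simp
      ultimately have "\<F> n (real n * (s - f p / real p - \<eta> / 3)) \<noteq> {0}" by blast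
      then have "ereal (real n * (s - f p / real p - \<eta> / 3)) \<le> ereal (real n * v n)"
        unfolding lam[OF n, symmetric] by (rule F_nonzero_le_lambda_max)
      then have "s - f p / real p - \<eta> / 3 \<le> v n" using n by simp
      then show "v p - \<eta> \<le> v n" using p unfolding s_def by linarith
    qed
  qed (use \<eta> in simp)
  ultimately obtain l where "v \<longlonglongrightarrow> l" using convergent_if_almost_increasing[of v C] by blast
  then have "(\<lambda>n. ereal (v n)) \<longlonglongrightarrow> ereal l" by simp
  moreover have "\<forall>\<^sub>F n in sequentially. ereal (v n) = lambda_max (B n) (\<F> n) / ereal (real n)"
    using eventually_ge_at_top[of "max N0 1"] by (rule eventually_mono) (simp add: lam)
  ultimately have "(\<lambda>n. lambda_max (B n) (\<F> n) / ereal (real n)) \<longlonglongrightarrow> ereal l"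
    by (rule Lim_transform_eventually)
  then show ?thesis by blast
qed

lemma dim_F_mono: "t' \<le> t \<Longrightarrow> dim (\<F> n t) \<le> dim (\<F> n t')"
  by (rule fin_dim_dim_mono[OF fin_dim_subspace[OF fin_dim_component F_simps(2,1)] F_simps(3)])

lemma dim_F_le: "dim (\<F> n t) \<le> dim (B n)"
  by (rule fin_dim_dim_mono[OF fin_dim_component F_simps(2)])

text \<open>Apply the rank inequality to the level \<open>p * t\<close> of \<open>B p\<close> and the products in degree \<open>n\<close>. After
division by \<open>n ^ d\<close> the factor \<open>k / n\<close> tends to \<open>1 / p\<close> and the error is of order \<open>1 / p\<close>. For \<open>t\<close>
so small that the level is all of \<open>B p\<close>, the same inequality shows that \<open>dim (B n) / n ^ d\<close> is
almost increasing, hence convergent, and that a fixed level already carries almost the whole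
rank.\<close>
lemma filtered_ranks:
  obtains d :: nat and vol :: real where "vol > 0" "(\<lambda>n. real (dim (B n)) / real n ^ d) \<longlonglongrightarrow> vol"
    "\<And>t t' \<eta>. t' < t \<Longrightarrow> \<eta> > 0 \<Longrightarrow> \<forall>\<^sub>F p in sequentially. \<forall>\<^sub>F n in sequentially.
      real (dim (\<F> p (real p * t))) / real p ^ d - \<eta> \<le> real (dim (\<F> n (real n * t'))) / real n ^ d"
    "\<And>\<eta>. \<eta> > 0 \<Longrightarrow> \<exists>s. \<forall>\<^sub>F n in sequentially. vol - \<eta> \<le> real (dim (\<F> n (real n * s))) / real n ^ d"
proof -
  obtain d D E c R where c: "c > 0" and D: "\<And>n. n \<ge> 1 \<Longrightarrow> dim (B n) \<le> D * n ^ d"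
    and lower: "\<forall>\<^sub>F n in sequentially. c * real n ^ d \<le> real (dim (B n))"
    and key: "\<And>p r k W Z. p \<ge> 1 \<Longrightarrow> R p \<le> r \<Longrightarrow> subspace W \<Longrightarrow> W \<subseteq> B p \<Longrightarrow> subspace Z \<Longrightarrow> Z \<subseteq> B (k * p + r) \<Longrightarrow>
      (\<And>w b. (\<And>j. j < k \<Longrightarrow> w j \<in> W) \<Longrightarrow> b \<in> B r \<Longrightarrow> (\<Prod>j<k. w j) * b \<in> Z) \<Longrightarrow>
      k ^ d * dim W \<le> dim Z + k ^ d * (d * (E * p ^ (d - 1)))"
    by (rule polynomial_growth_estimates) blast
  obtain p1 where p1: "p1 \<ge> 1" "\<And>p s \<eta> R. p \<ge> p1 \<Longrightarrow> \<eta> > 0 \<Longrightarrow> R \<ge> p1 \<Longrightarrow>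
    \<forall>\<^sub>F n in sequentially. \<exists>k r. n = k * p + r \<and> R \<le> r \<and> k = (n - R) div p \<and>
      (\<forall>w b. (\<forall>j<k. w j \<in> \<F> p (real p * s)) \<longrightarrow> b \<in> B r \<longrightarrow>
        (\<Prod>j<k. w j) * b \<in> \<F> n (real n * (s - f p / real p - \<eta>)))"
    by (rule eventually_power_products) blast
  define v where "v n = real (dim (B n)) / real n ^ d" for n
  define q where "q n t = real (dim (\<F> n (real n * t))) / real n ^ d" for n t
  define E' where "E' = real d * real E"
  have q_mono: "q n t \<le> q n t'" if "t' \<le> t" for n t t'
    unfolding q_def by (intro divide_right_mono) (auto intro!: dim_F_mono mult_left_mono that)
  have q_le_v: "q n t \<le> v n" for n t
    unfolding q_def v_def by (intro divide_right_mono) (auto intro!: dim_F_le)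
  have main: "\<forall>\<^sub>F n in sequentially. q p s - E' / real p - \<eta> \<le> q n (s - f p / real p - \<eta>)"
    if p: "p \<ge> p1" and \<eta>: "\<eta> > 0" for p s \<eta>
  proof -
    have p0: "p \<ge> 1" using p p1(1) by simp
    define R' where "R' = max (R p) p1"
    (* the rank of the level of B p, diminished by the boundary term *)
    define X where "X = real (dim (\<F> p (real p * s))) - E' * real p ^ (d - 1)"
    have "(\<lambda>n. (real ((n - R') div p) / real n) ^ d * X) \<longlonglongrightarrow> (1 / real p) ^ d * X"
      by (intro tendsto_intros nat_div_ratio_tendsto p0)
    then have "\<forall>\<^sub>F n in sequentially. (1 / real p) ^ d * X - \<eta> < (real ((n - R') div p) / real n) ^ d * X"
      by (rule order_tendstoD) (use \<eta> in simp)
    moreover have "\<forall>\<^sub>F n in sequentially. \<exists>k r. n = k * p + r \<and> R' \<le> r \<and> k = (n - R') div p \<and>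
      (\<forall>w b. (\<forall>j<k. w j \<in> \<F> p (real p * s)) \<longrightarrow> b \<in> B r \<longrightarrow>
        (\<Prod>j<k. w j) * b \<in> \<F> n (real n * (s - f p / real p - \<eta>)))"
      by (rule p1(2)[OF p \<eta>]) (simp add: R'_def)
    ultimately show ?thesis
    proof (rule eventually_elim2)
      fix n assume lim: "(1 / real p) ^ d * X - \<eta> < (real ((n - R') div p) / real n) ^ d * X"
        and "\<exists>k r. n = k * p + r \<and> R' \<le> r \<and> k = (n - R') div p \<and>
          (\<forall>w b. (\<forall>j<k. w j \<in> \<F> p (real p * s)) \<longrightarrow> b \<in> B r \<longrightarrow>
            (\<Prod>j<k. w j) * b \<in> \<F> n (real n * (s - f p / real p - \<eta>)))"
      from this(2) obtain k r where kr: "n = k * p + r" "R' \<le> r" "k = (n - R') div p"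
        "\<forall>w b. (\<forall>j<k. w j \<in> \<F> p (real p * s)) \<longrightarrow> b \<in> B r \<longrightarrow>
            (\<Prod>j<k. w j) * b \<in> \<F> n (real n * (s - f p / real p - \<eta>))" by blast
      let ?W = "\<F> p (real p * s)" and ?Z = "\<F> n (real n * (s - f p / real p - \<eta>))"
      have "k ^ d * dim ?W \<le> dim ?Z + k ^ d * (d * (E * p ^ (d - 1)))"
      proof (rule key[OF p0 _ F_simps(1,2) F_simps(1)])
        show "R p \<le> r" using kr(2) by (simp add: R'_def)
        show "?Z \<subseteq> B (k * p + r)" using F_simps(2)[of n] by (simp only: kr(1)[symmetric])
        show "(\<Prod>j<k. w j) * b \<in> ?Z" if "\<And>j. j < k \<Longrightarrow> w j \<in> ?W" "b \<in> B r" for w b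
          using kr(4) that by blast
      qed
      then have "real (k ^ d * dim ?W) \<le> real (dim ?Z + k ^ d * (d * (E * p ^ (d - 1))))" by (simp only: of_nat_le_iff)
      then have "real k ^ d * X \<le> real (dim ?Z)" by (simp add: X_def E'_def algebra_simps)
      then have "real k ^ d * X / real n ^ d \<le> q n (s - f p / real p - \<eta>)"
        unfolding q_def by (intro divide_right_mono) auto
      then have "(real ((n - R') div p) / real n) ^ d * X \<le> q n (s - f p / real p - \<eta>)"
        unfolding kr(3) by (simp add: power_divide)
      moreover have "q p s - E' / real p \<le> (1 / real p) ^ d * X"
      proof -
        have "(1 / real p) ^ d * X = q p s - E' * real p ^ (d - 1) / real p ^ d"
          by (simp add: q_def X_def power_divide diff_divide_distrib)
        moreover have "E' * real p ^ (d - 1) / real p ^ d \<le> E' / real p"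
          using p0 by (cases d) (auto simp: E'_def)
        ultimately show ?thesis by linarith
      qed
      ultimately show "q p s - E' / real p - \<eta> \<le> q n (s - f p / real p - \<eta>)" using lim by linarith
    qed
  qed
  have E'_small: "\<forall>\<^sub>F p in sequentially. E' / real p < \<eta>" if "\<eta> > 0" for \<eta>
    by (rule order_tendstoD(2)[OF tendsto_divide_0[OF tendsto_const filterlim_real_at_infinity_sequentially] that])
  have inc: "\<forall>\<^sub>F p in sequentially. \<forall>\<^sub>F n in sequentially. q p t - \<eta> \<le> q n t'" if t: "t' < t" and \<eta>: "\<eta> > 0" for t t' \<eta>
  proof -
    define \<eta>' where "\<eta>' = min (\<eta> / 2) ((t - t') / 2)"
    have \<eta>': "\<eta>' > 0" using t \<eta> by (simp add: \<eta>'_def)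
    have "\<forall>\<^sub>F p in sequentially. (p \<ge> p1 \<and> f p / real p < (t - t') / 2) \<and> E' / real p < \<eta> / 2"
      using t \<eta> by (intro eventually_conj eventually_ge_at_top f_eventually_small E'_small) auto
    then show ?thesis
    proof (rule eventually_mono)
      fix p assume p: "(p \<ge> p1 \<and> f p / real p < (t - t') / 2) \<and> E' / real p < \<eta> / 2"
      have ps: "p \<ge> p1" "f p / real p < (t - t') / 2" "E' / real p < \<eta> / 2" using p by blast+
      from main[OF ps(1) \<eta>', of t] show "\<forall>\<^sub>F n in sequentially. q p t - \<eta> \<le> q n t'"
      proof (rule eventually_mono)
        fix n assume n: "q p t - E' / real p - \<eta>' \<le> q n (t - f p / real p - \<eta>')"
        have "\<eta>' \<le> \<eta> / 2" "\<eta>' \<le> (t - t') / 2" unfolding \<eta>'_def by (rule min.cobounded1, rule min.cobounded2)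
        then have "t' \<le> t - f p / real p - \<eta>'" using ps(2) by argo
        then have "q n (t - f p / real p - \<eta>') \<le> q n t'" by (rule q_mono)
        then show "q p t - \<eta> \<le> q n t'" using n ps(3) \<open>\<eta>' \<le> \<eta> / 2\<close> by linarith
      qed
    qed
  qed
  have total: "\<forall>\<^sub>F p in sequentially. \<exists>s. \<forall>\<^sub>F n in sequentially. v p - \<eta> \<le> q n s" if \<eta>: "\<eta> > 0" for \<eta>
  proof -
    have "\<forall>\<^sub>F p in sequentially. p \<ge> p1 \<and> E' / real p < \<eta> / 2"
      using \<eta> by (intro eventually_conj eventually_ge_at_top E'_small) auto
    then show ?thesis
    proof (rule eventually_mono)
      fix p assume pE: "p \<ge> p1 \<and> E' / real p < \<eta> / 2"
      then have p: "p \<ge> p1" and E: "E' / real p < \<eta> / 2" by blast+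
      obtain t where t: "\<F> p t = B p"
        using eventually_happens'[OF trivial_limit_at_bot_linorder F_simps(5)[of p]] by blast
      have "real p * (t / real p) = t" using p p1(1) by simp
      then have "q p (t / real p) = v p" by (simp only: q_def v_def t)
      moreover have "\<forall>\<^sub>F n in sequentially. q p (t / real p) - E' / real p - \<eta> / 2 \<le> q n (t / real p - f p / real p - \<eta> / 2)"
        using p \<eta> by (intro main) auto
      ultimately have "\<forall>\<^sub>F n in sequentially. v p - E' / real p - \<eta> / 2 \<le> q n (t / real p - f p / real p - \<eta> / 2)" by (simp only:)
      then have "\<forall>\<^sub>F n in sequentially. v p - \<eta> \<le> q n (t / real p - f p / real p - \<eta> / 2)"
        by (rule eventually_mono) (use E in linarith)
      then show "\<exists>s. \<forall>\<^sub>F n in sequentially. v p - \<eta> \<le> q n s" by blast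
    qed
  qed
  have v_le: "\<forall>\<^sub>F n in sequentially. v n \<le> real D"
    using eventually_ge_at_top[of 1]
  proof (rule eventually_mono)
    fix n :: nat assume n: "1 \<le> n"
    have "real (dim (B n)) \<le> real (D * n ^ d)" using D[OF n] by (simp only: of_nat_le_iff)
    then show "v n \<le> real D" using n by (simp add: v_def pos_divide_le_eq)
  qed
  have v_inc: "\<forall>\<^sub>F p in sequentially. \<forall>\<^sub>F n in sequentially. v p - \<eta> \<le> v n" if "\<eta> > 0" for \<eta>
    using total[OF that]
  proof (rule eventually_mono)
    fix p assume "\<exists>s. \<forall>\<^sub>F n in sequentially. v p - \<eta> \<le> q n s"
    then obtain s where "\<forall>\<^sub>F n in sequentially. v p - \<eta> \<le> q n s" by blast
    then show "\<forall>\<^sub>F n in sequentially. v p - \<eta> \<le> v n" by (rule eventually_mono) (rule order_trans[OF _ q_le_v])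
  qed
  obtain vol where vol: "v \<longlonglongrightarrow> vol" by (rule convergent_if_almost_increasing[OF v_le v_inc])
  have "\<forall>\<^sub>F n in sequentially. c \<le> v n"
    using lower eventually_ge_at_top[of 1] by (rule eventually_elim2) (simp add: v_def pos_le_divide_eq)
  then have "c \<le> vol" by (rule tendsto_lowerbound[OF vol]) simp
  then have "vol > 0" using c by linarith
  moreover have "\<exists>s. \<forall>\<^sub>F n in sequentially. vol - \<eta> \<le> q n s" if \<eta>: "\<eta> > 0" for \<eta>
  proof -
    have "\<forall>\<^sub>F p in sequentially. vol - \<eta> / 2 < v p" by (rule order_tendstoD(1)[OF vol]) (use \<eta> in simp)
    with total[of "\<eta> / 2"] \<eta> have "\<forall>\<^sub>F p in sequentially. (\<exists>s. \<forall>\<^sub>F n in sequentially. v p - \<eta> / 2 \<le> q n s) \<and> vol - \<eta> / 2 < v p"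
      by (intro eventually_conj) auto
    from eventually_happens'[OF trivial_limit_sequentially this]
    obtain p s where ps: "\<forall>\<^sub>F n in sequentially. v p - \<eta> / 2 \<le> q n s" "vol - \<eta> / 2 < v p" by blast
    from ps(1) have "\<forall>\<^sub>F n in sequentially. vol - \<eta> \<le> q n s" by (rule eventually_mono) (use ps(2) in linarith)
    then show ?thesis by blast
  qed
  ultimately show thesis using that[of vol d] vol inc unfolding v_def q_def by blast
qed

text \<open>Dividing the estimates of \<open>filtered_ranks\<close> by the limit \<open>vol\<close> of \<open>dim (B n) / n ^ d\<close> gives the same
estimates for the tails \<open>g n t\<close> of the rescaled measures.\<close>
lemma vague_limit_exists:
  "\<exists>\<nu>. real_distribution \<nu> \<and>
    vague_conv (\<lambda>n. rescale_measure (1 / real n) (filt_measure (B n) (\<F> n))) \<nu>"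
proof -
  define \<mu> where "\<mu> n = rescale_measure (1 / real n) (filt_measure (B n) (\<F> n))" for n
  obtain N0 where N0: "\<And>n. n \<ge> N0 \<Longrightarrow> B n \<noteq> {0}" using eventually_nonzero by blast
  (* From here on the measures are probability measures; earlier ones may be zero and do not affect
     the limit. *)
  define N where "N = max N0 1"
  define g where "g n t = real (dim (\<F> n (real n * t))) / real (dim (B n))" for n t
  have \<mu>: "real_distribution (\<mu> n)" "measure (\<mu> n) {t..} = g n t" if "n \<ge> N" for n t
    using rescaled_filt_measure[OF fin_dim_component subspace_component N0 filtration, of n "real n"] that
    by (simp_all add: \<mu>_def g_def N_def)
  obtain d vol where vol: "vol > 0" and v: "(\<lambda>n. real (dim (B n)) / real n ^ d) \<longlonglongrightarrow> vol"
    and inc: "\<And>t t' \<eta>. t' < t \<Longrightarrow> \<eta> > 0 \<Longrightarrow> \<forall>\<^sub>F p in sequentially. \<forall>\<^sub>F n in sequentially.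
      real (dim (\<F> p (real p * t))) / real p ^ d - \<eta> \<le> real (dim (\<F> n (real n * t'))) / real n ^ d"
    and low: "\<And>\<eta>. \<eta> > 0 \<Longrightarrow> \<exists>s. \<forall>\<^sub>F n in sequentially. vol - \<eta> \<le> real (dim (\<F> n (real n * s))) / real n ^ d"
    by (rule filtered_ranks) blast
  define q where "q n t = real (dim (\<F> n (real n * t))) / real n ^ d" for n t
  have close: "\<forall>\<^sub>F n in sequentially. \<forall>t. \<bar>g n t - q n t / vol\<bar> \<le> \<eta>" if \<eta>: "\<eta> > 0" for \<eta>
  proof -
    have "(\<lambda>n. real (dim (B n)) / real n ^ d / vol) \<longlonglongrightarrow> vol / vol" using vol by (intro tendsto_intros v) simp
    then have "\<forall>\<^sub>F n in sequentially. dist (real (dim (B n)) / real n ^ d / vol) 1 < \<eta>"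
      using vol \<eta> by (intro tendstoD) auto
    with eventually_ge_at_top[of N] show ?thesis
    proof (rule eventually_elim2, intro allI)
      fix n t assume n: "N \<le> n" and "dist (real (dim (B n)) / real n ^ d / vol) 1 < \<eta>"
      then have small: "\<bar>1 - real (dim (B n)) / real n ^ d / vol\<bar> < \<eta>" by (simp add: dist_real_def abs_minus_commute)
      have nz: "dim (B n) \<noteq> 0" using fin_dim_dim_eq_0[OF fin_dim_component subspace_component] N0 n by (simp add: N_def)
      have "g n t - q n t / vol = g n t * (1 - real (dim (B n)) / real n ^ d / vol)"
        using nz by (simp add: g_def q_def right_diff_distrib)
      then have "\<bar>g n t - q n t / vol\<bar> = \<bar>g n t\<bar> * \<bar>1 - real (dim (B n)) / real n ^ d / vol\<bar>"
        by (simp only: abs_mult)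
      also have "\<bar>g n t\<bar> * \<bar>1 - real (dim (B n)) / real n ^ d / vol\<bar> \<le> \<bar>1 - real (dim (B n)) / real n ^ d / vol\<bar>"
        using dim_F_le[of n "real n * t"] nz by (intro mult_left_le_one_le) (simp_all add: g_def divide_le_eq_1)
      finally show "\<bar>g n t - q n t / vol\<bar> \<le> \<eta>" using small by (rule order_trans[OF _ less_imp_le])
    qed
  qed
  have g_inc: "\<forall>\<^sub>F p in sequentially. \<forall>\<^sub>F n in sequentially. g p t - \<eta> \<le> g n t'" if t: "t' < t" and \<eta>: "\<eta> > 0" for t t' \<eta>
  proof -
    have "\<forall>\<^sub>F p in sequentially. \<forall>\<^sub>F n in sequentially. q p t - \<eta> / 3 * vol \<le> q n t'"
      unfolding q_def using t \<eta> vol by (intro inc) auto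
    moreover have cl: "\<forall>\<^sub>F n in sequentially. \<forall>t. \<bar>g n t - q n t / vol\<bar> \<le> \<eta> / 3" using \<eta> by (intro close) simp
    ultimately show ?thesis
    proof (rule eventually_elim2)
      fix p assume p1: "\<forall>\<^sub>F n in sequentially. q p t - \<eta> / 3 * vol \<le> q n t'" and p2: "\<forall>t. \<bar>g p t - q p t / vol\<bar> \<le> \<eta> / 3"
      from p1 cl show "\<forall>\<^sub>F n in sequentially. g p t - \<eta> \<le> g n t'"
      proof (rule eventually_elim2)
        fix n assume n1: "q p t - \<eta> / 3 * vol \<le> q n t'" and n2: "\<forall>t. \<bar>g n t - q n t / vol\<bar> \<le> \<eta> / 3"
        have "(q p t - \<eta> / 3 * vol) / vol \<le> q n t' / vol" using n1 vol by (intro divide_right_mono) auto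
        then have "q p t / vol - \<eta> / 3 \<le> q n t' / vol" using vol by (simp add: diff_divide_distrib)
        then show "g p t - \<eta> \<le> g n t'" using p2[THEN spec, of t] n2[THEN spec, of t'] by linarith
      qed
    qed
  qed
  have g_low: "\<exists>s. \<forall>\<^sub>F n in sequentially. 1 - \<eta> \<le> g n s" if \<eta>: "\<eta> > 0" for \<eta>
  proof -
    obtain s where s: "\<forall>\<^sub>F n in sequentially. vol - \<eta> / 2 * vol \<le> q n s"
      unfolding q_def using low[of "\<eta> / 2 * vol"] \<eta> vol by auto
    have "\<forall>\<^sub>F n in sequentially. \<forall>t. \<bar>g n t - q n t / vol\<bar> \<le> \<eta> / 2" using \<eta> by (intro close) simp
    with s have "\<forall>\<^sub>F n in sequentially. 1 - \<eta> \<le> g n s"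
    proof (rule eventually_elim2)
      fix n assume n1: "vol - \<eta> / 2 * vol \<le> q n s" and n2: "\<forall>t. \<bar>g n t - q n t / vol\<bar> \<le> \<eta> / 2"
      have "(vol - \<eta> / 2 * vol) / vol \<le> q n s / vol" using n1 vol by (intro divide_right_mono) auto
      then have "1 - \<eta> / 2 \<le> q n s / vol" using vol by (simp add: diff_divide_distrib)
      then show "1 - \<eta> \<le> g n s" using n2[THEN spec, of s] by linarith
    qed
    then show ?thesis by blast
  qed
  obtain C where C: "\<And>n. n \<ge> 1 \<Longrightarrow> lambda_max (B n) (\<F> n) \<le> ereal (C * real n)" by (rule lambda_max_le) blast
  have g_high: "g n (C + 1) = 0" if n: "n \<ge> 1" for n
  proof -
    have "\<F> n (real n * (C + 1)) = {0}"
    proof (rule ccontr)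
      assume "\<F> n (real n * (C + 1)) \<noteq> {0}"
      then have "ereal (real n * (C + 1)) \<le> ereal (C * real n)" using F_nonzero_le_lambda_max C[OF n] order_trans by blast
      then show False using n by (simp add: algebra_simps)
    qed
    then show ?thesis by (simp add: g_def dim_zero_subspace)
  qed
  have "\<exists>\<nu>. real_distribution \<nu> \<and> weak_conv_m (\<lambda>n. \<mu> (n + N)) \<nu>"
  proof (rule weak_limit_of_almost_increasing_tails)
    show "real_distribution (\<mu> (n + N))" for n by (rule \<mu>) simp
    have m: "measure (\<mu> (n + N)) {t..} = g (n + N) t" for n t by (rule \<mu>) simp
    show "\<forall>\<^sub>F p in sequentially. \<forall>\<^sub>F n in sequentially. measure (\<mu> (p + N)) {t..} - \<eta> \<le> measure (\<mu> (n + N)) {t'..}"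
      if "t' < t" "\<eta> > 0" for t t' \<eta>
      unfolding m using g_inc[OF that]
      by (subst eventually_sequentially_seg[of "\<lambda>n. g _ t - \<eta> \<le> g n t'"],
          subst eventually_sequentially_seg[of "\<lambda>p. \<forall>\<^sub>F n in sequentially. g p t - \<eta> \<le> g n t'"])
    show "\<exists>s. \<forall>\<^sub>F n in sequentially. 1 - \<eta> \<le> measure (\<mu> (n + N)) {s..}" if "\<eta> > 0" for \<eta>
      unfolding m using g_low[OF that] by (subst eventually_sequentially_seg[of "\<lambda>n. 1 - \<eta> \<le> g n _"])
    show "\<exists>C. \<forall>\<^sub>F n in sequentially. measure (\<mu> (n + N)) {C..} = 0"
      unfolding m using g_high by (intro exI[of _ "C + 1"] always_eventually) (simp add: N_def)
  qed
  then obtain \<nu> where \<nu>: "real_distribution \<nu>" "weak_conv_m (\<lambda>n. \<mu> (n + N)) \<nu>" by blast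
  have "vague_conv \<mu> \<nu>" by (rule weak_conv_imp_vague_conv[OF _ \<nu>]) (rule \<mu>, simp)
  then show ?thesis using \<nu>(1) unfolding \<mu>_def by blast
qed

end

theorem theorem2p11:
  fixes scale :: "'k::field \<Rightarrow> 'b::idom \<Rightarrow> 'b"
    and B :: "nat \<Rightarrow> 'b set"
    and \<F> :: "nat \<Rightarrow> real \<Rightarrow> 'b set"
    and f :: "nat \<Rightarrow> real"
  assumes "approximable_graded_algebra scale B"
    and "\<forall>n. f n \<ge> 0"
    and "\<forall>n. vector_space.R_filtration scale (B n) (\<F> n)"
    and "quasi_filtered B \<F> f"
    and "(SUP n\<in>{1..}. lambda_max (B n) (\<F> n) / ereal (real n)) < \<infinity>"
    and "(\<lambda>n. f n / real n) \<longlonglongrightarrow> 0"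
  shows "(\<exists>l::real. (\<lambda>n. lambda_max (B n) (\<F> n) / ereal (real n)) \<longlonglongrightarrow> ereal l) \<and>
    (\<exists>\<nu>. real_distribution \<nu> \<and>
       vague_conv (\<lambda>n. rescale_measure (1 / real n) (vector_space.filt_measure scale (B n) (\<F> n))) \<nu>)"
proof -
  have "quasi_filtered_algebra scale B \<F> f"
    using assms by (intro quasi_filtered_algebra.intro quasi_filtered_algebra_axioms.intro) blast+
  then interpret quasi_filtered_algebra scale B \<F> f .
  show ?thesis using lambda_max_converges vague_limit_exists by blast
qed

end
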